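(* Let $n\ge 1$ and $\alpha\in\mathbb{R}^n$ with $\alpha_i>-\frac12$ for all $i$. 1. Let $p\in[1,+\infty)$ and $s,t\in\mathbb{R}$ with $s\le t$. Then $E_\alpha^{t,p}\subset E_\alpha^{s,p}$. Moreover $\|T\|_{E_\alpha^{s,p}}\le\|T\|_{E_\alpha^{t,p}}$ for all $T\in E_\alpha^{t,p}$, so that the embedding $E_\alpha^{t,p}\hookrightarrow E_\alpha^{s,p}$ is continuous. 2. Let $(s,p)\in\mathbb{R}\times[1,+\infty)$. Then $(-\Delta_\alpha)^k(E_\alpha^{s,p})\subset E_\alpha^{s-k,p}$ for all $k\in\mathbb{N}$. Moreover, the operator $(-\Delta_\alpha)^k:E_\alpha^{s,p}\to E_\alpha^{s-k,p}$ is continuous and $\|(-\Delta_\alpha)^k(T)\|_{E_\alpha^{s-k,p}}\le\|T\|_{E_\alpha^{s,p}}$ for all $T\in E_\alpha^{s,p}$.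
   Context: Fix $n\ge1$ and $\alpha=(\alpha_1,\dots,\alpha_n)\in\mathbb{R}^n$ with $\alpha_i>-\frac12$; $|\alpha|=\alpha_1+\dots+\alpha_n$, $\|x\|$ is the Euclidean norm, $\mathbb{N}=\{0,1,2,\dots\}$. $\mathbb{R}^n_+=\{x\in\mathbb{R}^n: x_1>0,\dots,x_n>0\}$, $d\mu_\alpha(x)=\prod_{i=1}^n x_i^{2\alpha_i+1}dx_i$, and $L^p_\alpha(\mathbb{R}^n_+)=L^p(\mathbb{R}^n_+,d\mu_\alpha)$ (complex-valued functions). A function on $\mathbb{R}^n$ is called even if it is even in each variable. $\mathcal{S}_e(\mathbb{R}^n)$ is the space of even Schwartz functions with its usual Fréchet topology, and $\mathcal{S}'_e(\mathbb{R}^n)$ is its topological dual (even tempered distributions). A function $\psi\in L^p_\alpha(\mathbb{R}^n_+)$ is identified with the element of $\mathcal{S}'_e(\mathbb{R}^n)$ given by $\langle\psi,f\rangle=\int_{\mathbb{R}^n_+}\psi f\,d\mu_\alpha$. An even smooth function $h$ all of whose derivatives grow at most polynomially acts on $\mathcal{S}'_e(\mathbb{R}^n)$ by $\langle hT,\varphi\rangle=\langle T,h\varphi\rangle$. The Poly-axially operator is $\Delta_\alpha=\sum_{i=1}^n\left(\frac{\partial^2}{\partial x_i^2}+\frac{2\alpha_i+1}{x_i}\frac{\partial}{\partial x_i}\right)$; it acts on $\mathcal{S}_e(\mathbb{R}^n)$ and, by duality, on $\mathcal{S}'_e(\mathbb{R}^n)$: $\langle\Delta_\alpha T,\varphi\rangle=\langle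 T,\Delta_\alpha\varphi\rangle$. For $\gamma>-\frac12$, $j_\gamma(t)=\Gamma(\gamma+1)\sum_{k\ge0}\frac{(-1)^k}{k!\,\Gamma(k+\gamma+1)}\left(\frac t2\right)^{2k}$ is the normalized Bessel function. The Fourier-Bessel transform is $\mathcal{F}_\alpha f(\lambda)=\int_{\mathbb{R}^n_+}f(x)\prod_{i=1}^n j_{\alpha_i}(\lambda_ix_i)\,d\mu_\alpha(x)$; it is a topological isomorphism of $\mathcal{S}_e(\mathbb{R}^n)$ with inverse $c_\alpha^2\mathcal{F}_\alpha$, where $c_\alpha=\frac{2^{-|\alpha|}}{\prod_{i=1}^n\Gamma(\alpha_i+1)}$. It is extended to $\mathcal{S}'_e(\mathbb{R}^n)$ by $\langle\mathcal{F}_\alpha(T),\varphi\rangle=\langle T,\mathcal{F}_\alpha(\varphi)\rangle$. For $s\in\mathbb{R}$, $p\in[1,+\infty)$: $E_\alpha^{s,p}=E_\alpha^{s,p}(\mathbb{R}^n_+)=\{T\in\mathcal{S}'_e(\mathbb{R}^n): (1+\|\xi\|^2)^s\mathcal{F}_\alpha(T)\in L^p_\alpha(\mathbb{R}^n_+)\}$, with norm $\|T\|_{E_\alpha^{s,p}}=c_\alpha\|(1+\|\xi\|^2)^s\mathcal{F}_\alpha(T)\|_{L^p_\alpha}$. *)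

theory Defs
  imports "HOL-Analysis.Analysis"
begin

text \<open>The topology on a set \<open>V\<close> of complex-valued functions (closed under subtraction) given by a
  family \<open>P\<close> of seminorms: the neighbourhoods of \<open>x\<close> are the sets containing a ball around \<open>x\<close> for
  finitely many of the seminorms. Used with a countable family for the Schwartz space, and with a
  single norm for the spaces \<open>E\<close>.\<close>

definition seminorm_topology ::
    "('a \<Rightarrow> complex) set \<Rightarrow> (('a \<Rightarrow> complex) \<Rightarrow> real) set \<Rightarrow> ('a \<Rightarrow> complex) topology" where
  "seminorm_topology V P = topology (\<lambda>W. W \<subseteq> V \<and>
     (\<forall>x\<in>W. \<exists>F r. finite F \<and> F \<subseteq> P \<and> 0 < r \<and> {y \<in> V. \<forall>q\<in>F. q (y - x) < r} \<subseteq> W))"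

lemma openin_seminorm_topology:
  "openin (seminorm_topology V P) W \<longleftrightarrow> W \<subseteq> V \<and>
     (\<forall>x\<in>W. \<exists>F r. finite F \<and> F \<subseteq> P \<and> 0 < r \<and> {y \<in> V. \<forall>q\<in>F. q (y - x) < r} \<subseteq> W)"
proof -
  define nb where "nb W x \<longleftrightarrow>
      (\<exists>F r. finite F \<and> F \<subseteq> P \<and> 0 < (r::real) \<and> {y \<in> V. \<forall>q\<in>F. q (y - x) < r} \<subseteq> W)" for W x
  have mono: "nb W' x" if 1: "nb W x" and 2: "W \<subseteq> W'" for W W' x
  proof -
    obtain F r where F: "finite F" "F \<subseteq> P" "0 < r" "{y \<in> V. \<forall>q\<in>F. q (y - x) < r} \<subseteq> W"
      using 1 unfolding nb_def by (elim exE conjE)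
    have "{y \<in> V. \<forall>q\<in>F. q (y - x) < r} \<subseteq> W'"
      using F(4) 2 by (rule subset_trans)
    with F(1-3) show ?thesis
      unfolding nb_def by (intro exI conjI)
  qed
  have int: "nb (A \<inter> B) x" if 1: "nb A x" and 2: "nb B x" for A B x
  proof -
    obtain F r where F: "finite F" "F \<subseteq> P" "0 < r" "{y \<in> V. \<forall>q\<in>F. q (y - x) < r} \<subseteq> A"
      using 1 unfolding nb_def by (elim exE conjE)
    obtain G r' where G: "finite G" "G \<subseteq> P" "0 < r'" "{y \<in> V. \<forall>q\<in>G. q (y - x) < r'} \<subseteq> B"
      using 2 unfolding nb_def by (elim exE conjE)
    have "{y \<in> V. \<forall>q\<in>F \<union> G. q (y - x) < min r r'} \<subseteq> {y \<in> V. \<forall>q\<in>F. q (y - x) < r}"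
      and "{y \<in> V. \<forall>q\<in>F \<union> G. q (y - x) < min r r'} \<subseteq> {y \<in> V. \<forall>q\<in>G. q (y - x) < r'}"
      by simp_all (simp_all add: subset_iff)
    then have "{y \<in> V. \<forall>q\<in>F \<union> G. q (y - x) < min r r'} \<subseteq> A \<inter> B"
      using F(4) G(4) by (meson le_infI subset_trans)
    moreover have "finite (F \<union> G)" "F \<union> G \<subseteq> P" "0 < min r r'"
      using F G by simp_all
    ultimately show ?thesis
      unfolding nb_def by (intro exI conjI)
  qed
  have "istopology (\<lambda>W. W \<subseteq> V \<and> (\<forall>x\<in>W. nb W x))"
    unfolding istopology_def
  proof (intro conjI allI impI)
    fix A B assume "A \<subseteq> V \<and> (\<forall>x\<in>A. nb A x)" "B \<subseteq> V \<and> (\<forall>x\<in>B. nb B x)"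
    then show "A \<inter> B \<subseteq> V" "\<forall>x\<in>A \<inter> B. nb (A \<inter> B) x"
      using int by blast+
  next
    fix K assume K: "\<forall>W\<in>K. W \<subseteq> V \<and> (\<forall>x\<in>W. nb W x)"
    show "\<Union>K \<subseteq> V" using K by blast
    show "\<forall>x\<in>\<Union>K. nb (\<Union>K) x"
      using K mono by (meson UnionE Union_upper)
  qed
  then show ?thesis
    unfolding seminorm_topology_def nb_def[symmetric] by (simp only: topology_inverse')
qed

lemma topspace_seminorm_topology [simp]: "topspace (seminorm_topology V P) = V"
proof
  show "topspace (seminorm_topology V P) \<subseteq> V"
    by (metis openin_seminorm_topology openin_topspace)
  have "openin (seminorm_topology V P) V"
    unfolding openin_seminorm_topology
    by (intro conjI ballI exI[of _ "{}"] exI[of _ "1::real"]) auto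
  then show "V \<subseteq> topspace (seminorm_topology V P)"
    by (rule openin_subset)
qed

definition partial_deriv :: "'n::finite \<Rightarrow> (real^'n \<Rightarrow> complex) \<Rightarrow> real^'n \<Rightarrow> complex" where
  "partial_deriv i f x = frechet_derivative f (at x) (axis i 1)"

definition partials :: "'n::finite list \<Rightarrow> (real^'n \<Rightarrow> complex) \<Rightarrow> real^'n \<Rightarrow> complex" where
  "partials is f = foldr partial_deriv is f"

definition smooth_fun :: "(real^'n::finite \<Rightarrow> complex) \<Rightarrow> bool" where
  "smooth_fun f \<longleftrightarrow> (\<forall>is x. partials is f differentiable (at x))"

definition even_fun :: "(real^'n::finite \<Rightarrow> complex) \<Rightarrow> bool" where
  "even_fun f \<longleftrightarrow> (\<forall>i x. f (\<chi> j. if j = i then - (x $ j) else x $ j) = f x)"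

definition schwartz_even :: "(real^'n::finite \<Rightarrow> complex) set" where
  "schwartz_even = {f. smooth_fun f \<and> even_fun f \<and>
     (\<forall>m is. bounded (range (\<lambda>x. (1 + (norm x)\<^sup>2) ^ m *\<^sub>R partials is f x)))}"

definition schwartz_seminorm :: "nat \<Rightarrow> 'n::finite list \<Rightarrow> (real^'n \<Rightarrow> complex) \<Rightarrow> real" where
  "schwartz_seminorm m is f = (SUP x. (1 + (norm x)\<^sup>2) ^ m * norm (partials is f x))"

definition schwartz_topology :: "(real^'n::finite \<Rightarrow> complex) topology" where
  "schwartz_topology =
     seminorm_topology schwartz_even (range (\<lambda>(m, is). schwartz_seminorm m is))"

text \<open>Functionals on \<open>schwartz_even\<close> are total functions normalised to be \<open>0\<close> off
  \<open>schwartz_even\<close>, so that equality of functionals is equality in HOL.\<close>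

type_synonym 'n functional = "(real^'n \<Rightarrow> complex) \<Rightarrow> complex"

definition tempered_even :: "'n::finite functional set" where
  "tempered_even = {T.
     (\<forall>f\<in>schwartz_even. \<forall>g\<in>schwartz_even. T (\<lambda>x. f x + g x) = T f + T g) \<and>
     (\<forall>c. \<forall>f\<in>schwartz_even. T (\<lambda>x. c * f x) = c * T f) \<and>
     continuous_map schwartz_topology euclidean T \<and>
     (\<forall>f. f \<notin> schwartz_even \<longrightarrow> T f = 0)}"

definition dual_op ::
    "((real^'n::finite \<Rightarrow> complex) \<Rightarrow> (real^'n \<Rightarrow> complex)) \<Rightarrow> 'n functional \<Rightarrow> 'n functional" where
  "dual_op A T = (\<lambda>\<phi>. if \<phi> \<in> schwartz_even then T (A \<phi>) else 0)"

definition mult_dist :: "(real^'n::finite \<Rightarrow> complex) \<Rightarrow> 'n functional \<Rightarrow> 'n functional" where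
  "mult_dist h = dual_op (\<lambda>\<phi> x. h x * \<phi> x)"

definition pos_orthant :: "(real^'n::finite) set" where
  "pos_orthant = {x. \<forall>i. 0 < x $ i}"

definition mu :: "real^'n::finite \<Rightarrow> (real^'n) measure" where
  "mu \<alpha> = density (restrict_space lborel pos_orthant)
            (\<lambda>x. ennreal (\<Prod>i\<in>UNIV. x $ i powr (2 * \<alpha> $ i + 1)))"

definition Lp :: "real^'n::finite \<Rightarrow> real \<Rightarrow> (real^'n \<Rightarrow> complex) set" where
  "Lp \<alpha> p = {\<psi>. \<psi> \<in> borel_measurable (mu \<alpha>) \<and> integrable (mu \<alpha>) (\<lambda>x. norm (\<psi> x) powr p)}"

definition Lp_norm :: "real^'n::finite \<Rightarrow> real \<Rightarrow> (real^'n \<Rightarrow> complex) \<Rightarrow> real" where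
  "Lp_norm \<alpha> p \<psi> = (\<integral>x. norm (\<psi> x) powr p \<partial>mu \<alpha>) powr (1 / p)"

definition dist_of_fun :: "real^'n::finite \<Rightarrow> (real^'n \<Rightarrow> complex) \<Rightarrow> 'n functional" where
  "dist_of_fun \<alpha> \<psi> =
     (\<lambda>\<phi>. if \<phi> \<in> schwartz_even then (\<integral>x. \<psi> x * \<phi> x \<partial>mu \<alpha>) else 0)"

definition dist_in_Lp :: "real^'n::finite \<Rightarrow> real \<Rightarrow> 'n functional \<Rightarrow> bool" where
  "dist_in_Lp \<alpha> p T \<longleftrightarrow> (\<exists>\<psi>\<in>Lp \<alpha> p. dist_of_fun \<alpha> \<psi> = T)"

text \<open>The function representing \<open>T\<close> is unique up to null sets, so its norm does not depend on the
  choice.\<close>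

definition dist_Lp_norm :: "real^'n::finite \<Rightarrow> real \<Rightarrow> 'n functional \<Rightarrow> real" where
  "dist_Lp_norm \<alpha> p T = Lp_norm \<alpha> p (SOME \<psi>. \<psi> \<in> Lp \<alpha> p \<and> dist_of_fun \<alpha> \<psi> = T)"

text \<open>On the hyperplane \<open>x\<^sub>i = 0\<close> the quotient \<open>\<partial>\<^sub>i f / x\<^sub>i\<close> is read as its continuous extension: for
  \<open>f\<close> smooth and even the limit is \<open>\<partial>\<^sub>i\<^sup>2 f\<close>. (HOL division by zero would give the wrong value
  \<open>0\<close>.)\<close>

definition laplace :: "real^'n::finite \<Rightarrow> (real^'n \<Rightarrow> complex) \<Rightarrow> real^'n \<Rightarrow> complex" where
  "laplace \<alpha> f x = (\<Sum>i\<in>UNIV. partial_deriv i (partial_deriv i f) x +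
     of_real (2 * \<alpha> $ i + 1) *
       (if x $ i = 0 then partial_deriv i (partial_deriv i f) x
        else partial_deriv i f x / of_real (x $ i)))"

definition laplace_dist :: "real^'n::finite \<Rightarrow> 'n functional \<Rightarrow> 'n functional" where
  "laplace_dist \<alpha> = dual_op (laplace \<alpha>)"

definition neg_laplace_pow :: "real^'n::finite \<Rightarrow> nat \<Rightarrow> 'n functional \<Rightarrow> 'n functional" where
  "neg_laplace_pow \<alpha> k = (\<lambda>T. - laplace_dist \<alpha> T) ^^ k"

definition bessel_j :: "real \<Rightarrow> real \<Rightarrow> real" where
  "bessel_j \<gamma> t = Gamma (\<gamma> + 1) *
     (\<Sum>k. (-1) ^ k / (fact k * Gamma (real k + \<gamma> + 1)) * (t / 2) ^ (2 * k))"

definition fourier_bessel :: "real^'n::finite \<Rightarrow> (real^'n \<Rightarrow> complex) \<Rightarrow> real^'n \<Rightarrow> complex" where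
  "fourier_bessel \<alpha> f \<xi> =
     (\<integral>x. f x * of_real (\<Prod>i\<in>UNIV. bessel_j (\<alpha> $ i) (\<xi> $ i * x $ i)) \<partial>mu \<alpha>)"

definition fourier_bessel_dist :: "real^'n::finite \<Rightarrow> 'n functional \<Rightarrow> 'n functional" where
  "fourier_bessel_dist \<alpha> = dual_op (fourier_bessel \<alpha>)"

definition c_const :: "real^'n::finite \<Rightarrow> real" where
  "c_const \<alpha> = 2 powr (- (\<Sum>i\<in>UNIV. \<alpha> $ i)) / (\<Prod>i\<in>UNIV. Gamma (\<alpha> $ i + 1))"

definition weighted_transform ::
    "real^'n::finite \<Rightarrow> real \<Rightarrow> 'n functional \<Rightarrow> 'n functional" where
  "weighted_transform \<alpha> s T =
     mult_dist (\<lambda>\<xi>. of_real ((1 + (norm \<xi>)\<^sup>2) powr s)) (fourier_bessel_dist \<alpha> T)"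

definition E_space :: "real^'n::finite \<Rightarrow> real \<Rightarrow> real \<Rightarrow> 'n functional set" where
  "E_space \<alpha> s p = {T \<in> tempered_even. dist_in_Lp \<alpha> p (weighted_transform \<alpha> s T)}"

definition E_norm :: "real^'n::finite \<Rightarrow> real \<Rightarrow> real \<Rightarrow> 'n functional \<Rightarrow> real" where
  "E_norm \<alpha> s p T = c_const \<alpha> * dist_Lp_norm \<alpha> p (weighted_transform \<alpha> s T)"

definition E_topology :: "real^'n::finite \<Rightarrow> real \<Rightarrow> real \<Rightarrow> 'n functional topology" where
  "E_topology \<alpha> s p = seminorm_topology (E_space \<alpha> s p) {E_norm \<alpha> s p}"

end

theory Submission
  imports Defs "HOL-Probability.Sinc_Integral"
begin

text \<open>
  The transform side is a multiplier problem: if \<open>\<psi>\<close> represents \<open>(1 + |\<xi>|\<^sup>2)\<^sup>t F(T)\<close>, then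
  \<open>(1 + |\<xi>|\<^sup>2)\<^bsup>s-t\<^esup> \<psi>\<close> represents \<open>(1 + |\<xi>|\<^sup>2)\<^sup>s F(T)\<close>, and \<open>|\<xi>|\<^sup>2 / (1 + |\<xi>|\<^sup>2) \<psi>\<close> represents
  \<open>(1 + |\<xi>|\<^sup>2)\<^bsup>t-1\<^esup> F(- \<Delta> T)\<close>; both multipliers take values in \<open>[0, 1]\<close>. By duality the second
  claim is \<open>\<Delta> F \<phi> = - F(|x|\<^sup>2 \<phi>)\<close> for even Schwartz functions, which is Bessel's equation under the
  integral.

  Since distributions are functionals on even Schwartz functions, \<open>\<Delta>\<close> must act continuously there,
  and \<open>F\<close> must map these functions to themselves. Smoothness of \<open>F \<phi>\<close> with bounded derivatives
  follows from the boundedness of all derivatives of \<open>j\<^sub>\<gamma>\<close>, and decay from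
  \<open>(1 + |\<xi>|\<^sup>2) F \<phi> = F(\<phi> - \<Delta> \<phi>)\<close>, an integration by parts.

  The norm is well defined because an \<open>L\<^sup>p\<close> function is determined almost everywhere by its pairings
  with Schwartz functions: the functions \<open>exp (- |x|\<^sup>2 - \<Sum>\<^sub>i (x\<^sub>i / b\<^sub>i)\<^bsup>2k\<^esup> / k)\<close> converge on the
  orthant to a Gaussian cut off to the box \<open>x \<le> b\<close>.
\<close>

subsection \<open>Partial derivatives\<close>

abbreviation differential :: "('n::finite \<Rightarrow> 'b::real_vector) \<Rightarrow> real^'n \<Rightarrow> 'b" where
  "differential d \<equiv> (\<lambda>h. \<Sum>i\<in>UNIV. (h $ i) *\<^sub>R d i)"

lemma differential_axis [simp]: "differential d (axis i 1) = d i"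
proof -
  have "differential d (axis i 1) = (\<Sum>j\<in>UNIV. if j = i then d j else 0)"
    by (rule sum.cong) (auto simp: axis_def)
  then show ?thesis by simp
qed

lemma linear_eq_differential:
  fixes D :: "real^'n::finite \<Rightarrow> 'b::real_vector"
  assumes "linear D"
  shows "D = differential (\<lambda>i. D (axis i 1))"
proof
  fix h :: "real^'n"
  have "D h = D (\<Sum>i\<in>UNIV. (h $ i) *\<^sub>R axis i 1)"
    using basis_expansion[of h] by (simp add: scalar_mult_eq_scaleR)
  then show "D h = differential (\<lambda>i. D (axis i 1)) h"
    by (simp add: linear_sum[OF assms] linear_cmul[OF assms])
qed

lemma bounded_linear_differential: "bounded_linear (differential d)"
  for d :: "'n::finite \<Rightarrow> 'b::real_normed_vector"
  by (intro bounded_linear_sum bounded_linear_scaleR_const bounded_linear_vec_nth)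

lemma onorm_differential_le: "onorm (differential d) \<le> (\<Sum>i\<in>UNIV. norm (d i))"
  for d :: "'n::finite \<Rightarrow> 'b::real_normed_vector"
proof (rule onorm_le)
  fix h :: "real^'n"
  have "norm (differential d h) \<le> (\<Sum>i\<in>UNIV. norm (d i) * norm h)"
    by (intro sum_norm_le)
      (simp add: mult.commute[of "norm (d _)"] mult_right_mono component_le_norm_cart)
  then show "norm (differential d h) \<le> (\<Sum>i\<in>UNIV. norm (d i)) * norm h"
    by (simp add: sum_distrib_right)
qed

lemma partial_deriv_eqI:
  assumes "(f has_derivative D) (at x)"
  shows "partial_deriv i f x = D (axis i 1)"
  using frechet_derivative_at[OF assms] by (simp add: partial_deriv_def)

lemma partial_deriv_eq_differentialI:
  assumes "(f has_derivative differential d) (at x)"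
  shows "partial_deriv i f x = d i"
  using partial_deriv_eqI[OF assms] by simp

lemma has_derivative_differential:
  assumes "f differentiable (at x)"
  shows "(f has_derivative differential (\<lambda>i. partial_deriv i f x)) (at x)"
proof -
  have deriv: "(f has_derivative frechet_derivative f (at x)) (at x)"
    using assms by (simp add: frechet_derivative_works)
  have "frechet_derivative f (at x) = differential (\<lambda>i. partial_deriv i f x)"
    unfolding partial_deriv_def by (rule linear_eq_differential[OF has_derivative_linear[OF deriv]])
  with deriv show ?thesis by simp
qed

lemma partial_deriv_add:
  assumes "f differentiable (at x)" "g differentiable (at x)"
  shows "partial_deriv i (\<lambda>x. f x + g x) x = partial_deriv i f x + partial_deriv i g x"
  using partial_deriv_eqI[OF has_derivative_add[OF assms[THEN has_derivative_differential]]] by simp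

lemma partial_deriv_diff:
  assumes "f differentiable (at x)" "g differentiable (at x)"
  shows "partial_deriv i (\<lambda>x. f x - g x) x = partial_deriv i f x - partial_deriv i g x"
  using partial_deriv_eqI[OF has_derivative_diff[OF assms[THEN has_derivative_differential]]]
  by simp

lemma partial_deriv_mult:
  assumes "f differentiable (at x)" "g differentiable (at x)"
  shows "partial_deriv i (\<lambda>x. f x * g x) x = partial_deriv i f x * g x + f x * partial_deriv i g x"
  using partial_deriv_eqI[OF has_derivative_mult[OF assms[THEN has_derivative_differential]]]
  by simp

lemma partial_deriv_const [simp]: "partial_deriv i (\<lambda>x. c) = (\<lambda>x. 0)"
  by (rule ext, rule partial_deriv_eqI[OF has_derivative_const])

lemma has_derivative_coord:
  "((\<lambda>x::real^'n::finite. complex_of_real (x $ i)) has_derivative (\<lambda>h. of_real (h $ i))) (at x)"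
  by (intro has_derivative_of_real has_derivative_ident
      bounded_linear.has_derivative[OF bounded_linear_vec_nth])

lemma differentiable_coord: "(\<lambda>x. complex_of_real (x $ i)) differentiable (at x)"
  using has_derivative_coord unfolding differentiable_def by blast

lemma partial_deriv_coord:
  "partial_deriv j (\<lambda>x. complex_of_real (x $ i)) = (\<lambda>x. if i = j then 1 else 0)"
  using partial_deriv_eqI[OF has_derivative_coord[of i]] by (simp add: axis_def fun_eq_iff)

lemma has_vector_derivative_axis_line:
  assumes "f differentiable (at (x + t *\<^sub>R axis i 1))"
  shows "((\<lambda>t. f (x + t *\<^sub>R axis i 1)) has_vector_derivative
    partial_deriv i f (x + t *\<^sub>R axis i 1)) (at t)"
proof -
  let ?df = "differential (\<lambda>j. partial_deriv j f (x + t *\<^sub>R axis i 1))"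
  have "((\<lambda>t. x + t *\<^sub>R axis i (1::real)) has_derivative (\<lambda>s. s *\<^sub>R axis i 1)) (at t)"
    by (auto intro!: derivative_eq_intros)
  from has_derivative_compose[OF this has_derivative_differential[OF assms]]
  have "((\<lambda>t. f (x + t *\<^sub>R axis i 1)) has_derivative (\<lambda>s. ?df (s *\<^sub>R axis i 1))) (at t)" .
  moreover have "?df (s *\<^sub>R axis i 1) = s *\<^sub>R ?df (axis i 1)" for s
    by (simp only: linear_cmul[OF bounded_linear.linear[OF bounded_linear_differential]])
  ultimately show ?thesis by (simp add: has_vector_derivative_def)
qed

lemma partials_Nil [simp]: "partials [] f = f"
  and partials_Cons [simp]: "partials (i # is) f = partial_deriv i (partials is f)"
  and partials_append: "partials (is @ js) f = partials is (partials js f)"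
  by (simp_all add: partials_def)

lemma smooth_fun_differentiable: "smooth_fun f \<Longrightarrow> f differentiable (at x)"
  unfolding smooth_fun_def by (metis partials_Nil)

lemma smooth_fun_partials: "smooth_fun f \<Longrightarrow> smooth_fun (partials is f)"
  unfolding smooth_fun_def by (metis partials_append)

lemma smooth_fun_partial_deriv: "smooth_fun f \<Longrightarrow> smooth_fun (partial_deriv i f)"
  using smooth_fun_partials[of f "[i]"] by simp

lemma smooth_fun_continuous_on: "smooth_fun f \<Longrightarrow> continuous_on UNIV f"
  by (meson differentiable_at_withinI differentiable_imp_continuous_on differentiable_on_def
      smooth_fun_differentiable)

lemma smooth_fun_borel_measurable: "smooth_fun f \<Longrightarrow> f \<in> borel_measurable borel"
  by (rule borel_measurable_continuous_onI[OF smooth_fun_continuous_on])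

lemma partials_add:
  assumes "smooth_fun f" "smooth_fun g"
  shows "partials is (\<lambda>x. f x + g x) = (\<lambda>x. partials is f x + partials is g x)"
proof (induction "is")
  case (Cons i "is")
  show ?case
    using assms by (auto simp: Cons smooth_fun_def intro!: ext partial_deriv_add)
qed auto

lemma partials_cmult:
  assumes "smooth_fun f"
  shows "partials is (\<lambda>x. c * f x) = (\<lambda>x. c * partials is f x)"
proof (induction "is")
  case (Cons i "is")
  have "partial_deriv i (\<lambda>x. c * partials is f x) x = c * partial_deriv i (partials is f) x" for x
    using partial_deriv_mult[of "\<lambda>_. c" x "partials is f" i] assms by (simp add: smooth_fun_def)
  with Cons show ?case by auto
qed auto

lemma smooth_fun_add: "smooth_fun f \<Longrightarrow> smooth_fun g \<Longrightarrow> smooth_fun (\<lambda>x. f x + g x)"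
  by (simp add: smooth_fun_def partials_add)

lemma smooth_fun_cmult: "smooth_fun f \<Longrightarrow> smooth_fun (\<lambda>x. c * f x)"
  by (simp add: smooth_fun_def partials_cmult)

subsection \<open>Scaling one coordinate\<close>

definition scale_coord :: "'n::finite \<Rightarrow> real \<Rightarrow> real^'n \<Rightarrow> real^'n" where
  "scale_coord i t x = (\<chi> j. if j = i then t * x $ j else x $ j)"

lemma scale_coord_nth [simp]: "scale_coord i t x $ j = (if j = i then t * x $ j else x $ j)"
  by (simp add: scale_coord_def)

lemma scale_coord_conv_axis_line: "scale_coord i t x = x + ((t - 1) * x $ i) *\<^sub>R axis i 1"
  by (auto simp: vec_eq_iff axis_def algebra_simps)

lemma scale_coord_one [simp]: "scale_coord i 1 x = x"
  by (simp add: vec_eq_iff)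

lemma scale_coord_fixed: "x $ i = 0 \<Longrightarrow> scale_coord i t x = x"
  by (auto simp: vec_eq_iff)

lemma norm_power2_eq_sum: "(norm x)\<^sup>2 = (\<Sum>i\<in>UNIV. (x $ i)\<^sup>2)" for x :: "real^'n::finite"
  by (simp add: norm_vec_def L2_set_def sum_nonneg)

lemma norm_scale_coord_minus_one: "norm (scale_coord i (- 1) x) = norm x"
  unfolding norm_vec_def by (rule L2_set_cong) auto

lemma continuous_on_scale_coord: "continuous_on UNIV (\<lambda>t. scale_coord i t x)"
  unfolding scale_coord_conv_axis_line by (intro continuous_intros)

lemma has_derivative_comp_scale_coord:
  assumes "f differentiable (at (scale_coord i t x))"
  shows "((\<lambda>x. f (scale_coord i t x)) has_derivative
    differential (\<lambda>j. (if j = i then t else 1) *\<^sub>R partial_deriv j f (scale_coord i t x))) (at x)"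
proof -
  have "bounded_linear (scale_coord i t)"
    unfolding linear_conv_bounded_linear[symmetric]
    by (rule linearI) (auto simp: vec_eq_iff algebra_simps)
  from has_derivative_compose[OF bounded_linear_imp_has_derivative[OF this]
      has_derivative_differential[OF assms]]
  have "((\<lambda>x. f (scale_coord i t x)) has_derivative
    (\<lambda>h. differential (\<lambda>j. partial_deriv j f (scale_coord i t x)) (scale_coord i t h))) (at x)" .
  moreover have "differential (\<lambda>j. d j) (scale_coord i t h) =
      differential (\<lambda>j. (if j = i then t else 1) *\<^sub>R d j) h" for d :: "'a \<Rightarrow> complex" and h
    by (rule sum.cong) auto
  ultimately show ?thesis by simp
qed

lemma even_fun_iff_scale_coord: "even_fun f \<longleftrightarrow> (\<forall>i x. f (scale_coord i (- 1) x) = f x)"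
proof -
  have "(\<chi> j. if j = i then - (x $ j) else x $ j) = scale_coord i (- 1) x" for i and x :: "real^'a"
    by (simp add: vec_eq_iff)
  then show ?thesis by (simp add: even_fun_def)
qed

lemma even_fun_radial: "even_fun (\<lambda>x. f (norm x))"
  by (simp add: even_fun_iff_scale_coord norm_scale_coord_minus_one)

lemma partial_deriv_scale_coord_minus_one:
  assumes "smooth_fun f" and parity: "\<And>x. f (scale_coord i (- 1) x) = c * f x"
  shows "partial_deriv j f (scale_coord i (- 1) x) =
    (if j = i then - c else c) * partial_deriv j f x"
proof -
  have "partial_deriv j (\<lambda>x. f (scale_coord i (- 1) x)) x =
      (if j = i then - 1 else 1) *\<^sub>R partial_deriv j f (scale_coord i (- 1) x)"
    by (intro partial_deriv_eq_differentialI has_derivative_comp_scale_coord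
        smooth_fun_differentiable assms(1))
  moreover have "partial_deriv j (\<lambda>x. f (scale_coord i (- 1) x)) x = c * partial_deriv j f x"
    using partials_cmult[OF assms(1), of "[j]" c] by (simp add: parity)
  ultimately show ?thesis by (auto split: if_splits simp: minus_equation_iff)
qed

lemma partial_deriv_even_scale_coord_minus_one:
  assumes "smooth_fun f" "even_fun f"
  shows "partial_deriv j f (scale_coord i (- 1) x) =
    (if j = i then - 1 else 1) * partial_deriv j f x"
  using partial_deriv_scale_coord_minus_one[OF assms(1), of i 1 j x] assms(2)
  by (simp add: even_fun_iff_scale_coord)

lemma partial_deriv_even_eq_0:
  assumes "smooth_fun f" "even_fun f" "x $ i = 0"
  shows "partial_deriv i f x = 0"
  using partial_deriv_even_scale_coord_minus_one[OF assms(1,2), of i i x]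
  by (simp add: scale_coord_fixed[OF assms(3)])

lemma even_fun_partial_deriv_partial_deriv:
  assumes "smooth_fun f" "even_fun f"
  shows "even_fun (partial_deriv i (partial_deriv i f))"
  using partial_deriv_scale_coord_minus_one[OF smooth_fun_partial_deriv[OF assms(1)]
      partial_deriv_even_scale_coord_minus_one[OF assms]]
  by (simp add: even_fun_iff_scale_coord)

subsection \<open>Polynomial growth and symbol classes\<close>

abbreviation bracket :: "'a::real_normed_vector \<Rightarrow> real" where
  "bracket x \<equiv> 1 + (norm x)\<^sup>2"

lemma bracket_ge_1: "1 \<le> bracket x"
  by simp

lemma bracket_pos [simp]: "0 < bracket x"
  by (rule less_le_trans[OF zero_less_one bracket_ge_1])

lemma bracket_nonzero [simp]: "bracket x \<noteq> 0"
  by (rule less_imp_neq[OF bracket_pos, symmetric])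

lemma bracket_le_translate:
  assumes "norm h \<le> 1"
  shows "bracket x \<le> 3 * bracket (x + h)"
proof -
  have "norm x \<le> norm (x + h) + 1"
    using norm_triangle_ineq4[of "x + h" h] assms by simp
  then have "(norm x)\<^sup>2 \<le> (norm (x + h) + 1)\<^sup>2"
    by (intro power_mono) auto
  also have "\<dots> \<le> 2 * (norm (x + h))\<^sup>2 + 2"
    using zero_le_power2[of "norm (x + h) - 1"] by (simp add: power2_eq_square algebra_simps)
  finally show ?thesis by (simp add: algebra_simps) (smt (verit) zero_le_power2)
qed

lemma bracket_powr_translate_le:
  assumes "norm h \<le> 1" "0 \<le> r"
  shows "bracket (x + h) powr (- r) \<le> 3 powr r * bracket x powr (- r)"
proof -
  have "bracket (x + h) powr (- r) = 3 powr r * (3 * bracket (x + h)) powr (- r)"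
    by (subst powr_mult) (simp add: powr_minus)
  also have "\<dots> \<le> 3 powr r * bracket x powr (- r)"
    using bracket_le_translate[OF assms(1), of x] assms(2)
    by (intro mult_left_mono powr_mono2') auto
  finally show ?thesis .
qed

definition growth :: "real \<Rightarrow> ('a::real_normed_vector \<Rightarrow> 'b::real_normed_vector) set" where
  "growth K = {f. \<exists>C. \<forall>x. norm (f x) \<le> C * bracket x powr K}"

lemma growthI: "(\<And>x. norm (f x) \<le> C * bracket x powr K) \<Longrightarrow> f \<in> growth K"
  unfolding growth_def by blast

lemma growthE:
  assumes "f \<in> growth K"
  obtains C where "0 \<le> C" "\<And>x. norm (f x) \<le> C * bracket x powr K"
proof -
  obtain C where C: "\<And>x. norm (f x) \<le> C * bracket x powr K"
    using assms unfolding growth_def by blast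
  have "norm (f x) \<le> \<bar>C\<bar> * bracket x powr K" for x
    by (rule order_trans[OF C mult_right_mono]) auto
  then show ?thesis by (rule that[OF abs_ge_zero])
qed

lemma growth_mono:
  assumes "f \<in> growth K" "K \<le> L"
  shows "f \<in> growth L"
proof -
  obtain C where C: "0 \<le> C" "\<And>x. norm (f x) \<le> C * bracket x powr K"
    using growthE[OF assms(1)] by blast
  have "norm (f x) \<le> C * bracket x powr L" for x
    using order_trans[OF C(2) mult_left_mono[OF powr_mono[OF assms(2) bracket_ge_1] C(1)]] .
  then show ?thesis by (rule growthI)
qed

lemma growth_le:
  assumes "g \<in> growth K" "\<And>x. norm (f x) \<le> norm (g x)"
  shows "f \<in> growth K"
  using assms order_trans unfolding growth_def by blast

lemma growth_add:
  assumes "f \<in> growth K" "g \<in> growth K"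
  shows "(\<lambda>x. f x + g x) \<in> growth K"
proof -
  obtain C D where "\<And>x. norm (f x) \<le> C * bracket x powr K" "\<And>x. norm (g x) \<le> D * bracket x powr K"
    using assms growthE by metis
  then have "norm (f x + g x) \<le> (C + D) * bracket x powr K" for x
    by (simp add: distrib_right norm_triangle_mono)
  then show ?thesis by (rule growthI)
qed

lemma growth_scaleR:
  assumes "f \<in> growth K" "g \<in> growth L"
  shows "(\<lambda>x. f x *\<^sub>R g x) \<in> growth (K + L)"
proof -
  obtain C where C: "0 \<le> C" "\<And>x. norm (f x) \<le> C * bracket x powr K"
    using growthE[OF assms(1)] by blast
  obtain D where D: "0 \<le> D" "\<And>x. norm (g x) \<le> D * bracket x powr L"
    using growthE[OF assms(2)] by blast
  have "norm (f x *\<^sub>R g x) \<le> (C * D) * bracket x powr (K + L)" for x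
    using mult_mono[OF C(2) D(2), of x x] C(1) by (simp add: powr_add mult_ac)
  then show ?thesis by (rule growthI)
qed

lemma growth_mult:
  fixes f g :: "'a::real_normed_vector \<Rightarrow> 'b::real_normed_algebra"
  assumes "f \<in> growth K" "g \<in> growth L"
  shows "(\<lambda>x. f x * g x) \<in> growth (K + L)"
proof (rule growth_le)
  show "(\<lambda>x. norm (f x) *\<^sub>R norm (g x)) \<in> growth (K + L)"
    using assms by (intro growth_scaleR) (auto elim: growth_le)
qed (simp add: norm_mult_ineq)

lemma growth_const: "0 \<le> K \<Longrightarrow> (\<lambda>x. c) \<in> growth K"
  by (rule growth_mono[OF growthI[of _ "norm c" 0]]) auto

lemma growth_0_iff_bounded: "f \<in> growth 0 \<longleftrightarrow> bounded (range f)"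
  by (auto simp: growth_def bounded_iff)

lemma growth_prod:
  fixes f :: "'i \<Rightarrow> 'a::real_normed_vector \<Rightarrow> 'b::real_normed_field"
  assumes "\<And>i. i \<in> I \<Longrightarrow> f i \<in> growth (K i)"
  shows "(\<lambda>x. \<Prod>i\<in>I. f i x) \<in> growth (\<Sum>i\<in>I. K i)"
  using assms
proof (induction I rule: infinite_finite_induct)
  case (insert i I)
  then show ?case using growth_mult[of "f i" "K i"] by simp
qed (auto intro: growth_const)

lemma growth_power:
  fixes f :: "'a::real_normed_vector \<Rightarrow> 'b::real_normed_field"
  assumes "f \<in> growth K"
  shows "(\<lambda>x. f x ^ m) \<in> growth (real m * K)"
  using growth_prod[of "{..<m}" "\<lambda>_. f" "\<lambda>_. K"] assms by simp

lemma growth_bracket_powr: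
  "(\<lambda>x. of_real (bracket x powr K) :: 'b::real_normed_algebra_1) \<in> growth K"
  by (rule growthI[of _ 1]) simp

lemma growth_uminus_of_nat_iff:
  "f \<in> growth (- real m) \<longleftrightarrow> bounded (range (\<lambda>x. bracket x ^ m *\<^sub>R f x))"
proof -
  have "norm (f x) \<le> C * bracket x powr (- real m) \<longleftrightarrow> norm (bracket x ^ m *\<^sub>R f x) \<le> C" for C x
    by (simp add: powr_minus powr_realpow field_simps)
  then show ?thesis by (simp add: growth_def bounded_iff)
qed

lemma growth_coord: "(\<lambda>x::real^'n::finite. x $ i) \<in> growth (1 / 2)"
proof (rule growthI)
  fix x :: "real^'n"
  have "\<bar>x $ i\<bar> \<le> sqrt ((norm x)\<^sup>2)" using component_le_norm_cart[of x i] by simp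
  also have "\<dots> \<le> sqrt (bracket x)" by (rule real_sqrt_le_mono) simp
  finally show "norm (x $ i) \<le> 1 * bracket x powr (1 / 2)" by (simp add: powr_half_sqrt)
qed

text \<open>The order is counted in powers of \<open>1 + |x|\<^sup>2\<close>, and derivatives need not gain decay.\<close>

definition symbols :: "real \<Rightarrow> (real^'n::finite \<Rightarrow> complex) set" where
  "symbols K = {f. smooth_fun f \<and> (\<forall>is. partials is f \<in> growth K)}"

lemma symbols_smooth: "f \<in> symbols K \<Longrightarrow> smooth_fun f"
  by (simp add: symbols_def)

lemma symbols_differentiable: "f \<in> symbols K \<Longrightarrow> f differentiable (at x)"
  by (simp add: symbols_smooth smooth_fun_differentiable)

lemma symbols_growth: "f \<in> symbols K \<Longrightarrow> f \<in> growth K"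
  unfolding symbols_def using partials_Nil by (metis (mono_tags, lifting) mem_Collect_eq)

lemma symbols_partials: "f \<in> symbols K \<Longrightarrow> partials is f \<in> symbols K"
  unfolding symbols_def by (auto intro: smooth_fun_partials simp: partials_append[symmetric])

lemma symbols_partial_deriv: "f \<in> symbols K \<Longrightarrow> partial_deriv i f \<in> symbols K"
  using symbols_partials[of f K "[i]"] by simp

lemma symbols_mono: "f \<in> symbols K \<Longrightarrow> K \<le> L \<Longrightarrow> f \<in> symbols L"
  by (auto simp: symbols_def intro: growth_mono)

text \<open>The Leibniz rule leaves a class of products, but not its additive closure.\<close>

inductive_set additive_closure :: "('a \<Rightarrow> 'b::plus) set \<Rightarrow> ('a \<Rightarrow> 'b) set" for A where
  incl: "f \<in> A \<Longrightarrow> f \<in> additive_closure A"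
| add: "f \<in> additive_closure A \<Longrightarrow> g \<in> additive_closure A \<Longrightarrow> (\<lambda>x. f x + g x) \<in> additive_closure A"

lemma additive_closure_subset_symbols:
  assumes diff: "\<And>f x. f \<in> A \<Longrightarrow> f differentiable (at x)"
    and growth: "\<And>f. f \<in> A \<Longrightarrow> f \<in> growth K"
    and deriv: "\<And>f i. f \<in> A \<Longrightarrow> partial_deriv i f \<in> additive_closure A"
  shows "additive_closure A \<subseteq> symbols K"
proof
  have closure: "(\<forall>x. f differentiable (at x)) \<and> f \<in> growth K \<and>
      (\<forall>i. partial_deriv i f \<in> additive_closure A)" if "f \<in> additive_closure A" for f
    using that
  proof induction
    case (add f g)
    then have "partial_deriv i (\<lambda>x. f x + g x) =
        (\<lambda>x. partial_deriv i f x + partial_deriv i g x)" for i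
      by (intro ext partial_deriv_add) auto
    with add show ?case
      by (auto intro!: differentiable_add growth_add additive_closure.add)
  qed (use assms in auto)
  fix f assume "f \<in> additive_closure A"
  then have "partials is f \<in> additive_closure A" for "is"
    by (induction "is") (use closure in auto)
  then show "f \<in> symbols K"
    unfolding symbols_def smooth_fun_def using closure by blast
qed

lemma symbols_coinduct:
  assumes "f \<in> A"
    and "\<And>f x. f \<in> A \<Longrightarrow> f differentiable (at x)"
    and "\<And>f. f \<in> A \<Longrightarrow> f \<in> growth K"
    and "\<And>f i. f \<in> A \<Longrightarrow> partial_deriv i f \<in> additive_closure A"
  shows "f \<in> symbols K"
  using additive_closure_subset_symbols[OF assms(2-4)] additive_closure.incl[OF assms(1)] by blast

lemma symbols_add:
  assumes "f \<in> symbols K" "g \<in> symbols K"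
  shows "(\<lambda>x. f x + g x) \<in> symbols K"
proof -
  have "additive_closure (symbols K) \<subseteq> (symbols K :: (real^'a \<Rightarrow> complex) set)"
    by (intro additive_closure_subset_symbols symbols_differentiable symbols_growth
        additive_closure.incl symbols_partial_deriv)
  with assms show ?thesis by (blast intro: additive_closure.intros)
qed

lemma symbols_mult:
  assumes "f \<in> symbols K" "g \<in> symbols L"
  shows "(\<lambda>x. f x * g x) \<in> symbols (K + L)"
proof (rule symbols_coinduct)
  let ?A = "{(\<lambda>x. f x * g x) | f g :: real^'a \<Rightarrow> complex. f \<in> symbols K \<and> g \<in> symbols L}"
  have incl: "(\<lambda>x. f x * g x) \<in> ?A" if "f \<in> symbols K" "g \<in> symbols L" for f g
    using that by blast
  show "(\<lambda>x. f x * g x) \<in> ?A" using assms by (rule incl)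
  fix h assume "h \<in> ?A"
  then obtain f g where h: "h = (\<lambda>x. f x * g x)" and f: "f \<in> symbols K" and g: "g \<in> symbols L"
    by blast
  note diff = f[THEN symbols_differentiable] g[THEN symbols_differentiable]
  show "h differentiable (at x)" for x
    unfolding h by (intro differentiable_mult diff)
  show "h \<in> growth (K + L)"
    unfolding h by (intro growth_mult symbols_growth f g)
  have leibniz: "partial_deriv i h = (\<lambda>x. partial_deriv i f x * g x + f x * partial_deriv i g x)"
    for i
    unfolding h by (intro ext partial_deriv_mult diff)
  show "partial_deriv i h \<in> additive_closure ?A" for i
    unfolding leibniz
    by (intro additive_closure.add additive_closure.incl incl symbols_partial_deriv f g)
qed

lemma symbols_const: "0 \<le> K \<Longrightarrow> (\<lambda>x. c) \<in> symbols K"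
  by (rule symbols_coinduct[of _ "range (\<lambda>c x. c)"])
    (auto intro: growth_const additive_closure.incl)

lemma symbols_cmult: "f \<in> symbols K \<Longrightarrow> (\<lambda>x. c * f x) \<in> symbols K"
  using symbols_mult[OF symbols_const[of 0 c]] by fastforce

lemma symbols_diff:
  assumes "f \<in> symbols K" "g \<in> symbols K"
  shows "(\<lambda>x. f x - g x) \<in> symbols K"
  using symbols_add[OF assms(1) symbols_cmult[OF assms(2), of "- 1"]] by simp

lemma symbols_sum:
  assumes "\<And>i. i \<in> I \<Longrightarrow> f i \<in> symbols K" "0 \<le> K"
  shows "(\<lambda>x. \<Sum>i\<in>I. f i x) \<in> symbols K"
  using assms(1)
proof (induction I rule: infinite_finite_induct)
  case (insert i I)
  then show ?case using symbols_add[of "f i"] by simp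
qed (simp_all add: symbols_const assms(2))

lemma symbols_power:
  assumes "f \<in> symbols K"
  shows "(\<lambda>x. f x ^ m) \<in> symbols (real m * K)"
proof (induction m)
  case 0
  show ?case by (simp add: symbols_const)
next
  case (Suc m)
  show ?case using symbols_mult[OF assms Suc] by (simp add: algebra_simps)
qed

lemma symbols_coord: "(\<lambda>x::real^'n::finite. complex_of_real (x $ i)) \<in> symbols (1 / 2)"
proof (rule symbols_coinduct)
  let ?A = "insert (\<lambda>x::real^'n. complex_of_real (x $ i)) (range (\<lambda>c x. c))"
  show "(\<lambda>x. complex_of_real (x $ i)) \<in> ?A" by simp
  fix h assume "h \<in> ?A"
  then consider "h = (\<lambda>x. complex_of_real (x $ i))" | c where "h = (\<lambda>x. c)" by blast
  note h_cases = this
  show "h differentiable (at x)" for x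
    by (cases rule: h_cases) (simp_all add: differentiable_coord)
  show "h \<in> growth (1 / 2)"
    by (cases rule: h_cases) (auto intro: growth_const growth_le[OF growth_coord[of i]])
  show "partial_deriv j h \<in> additive_closure ?A" for j
    by (cases rule: h_cases) (auto simp: partial_deriv_coord intro: additive_closure.incl)
qed

lemma symbols_norm_power2: "(\<lambda>x::real^'n::finite. complex_of_real ((norm x)\<^sup>2)) \<in> symbols 1"
proof -
  have "(\<lambda>x::real^'n. complex_of_real (x $ i) ^ 2) \<in> symbols 1" for i
    using symbols_power[OF symbols_coord, where m = 2] by simp
  then have "(\<lambda>x::real^'n. \<Sum>i\<in>UNIV. complex_of_real (x $ i) ^ 2) \<in> symbols 1"
    by (intro symbols_sum) auto
  then show ?thesis by (simp add: norm_power2_eq_sum)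
qed

lemma has_derivative_bracket_powr:
  "((\<lambda>x::real^'n::finite. complex_of_real (bracket x powr r)) has_derivative
     differential (\<lambda>i. of_real (2 * r * (x $ i) * bracket x powr (r - 1)))) (at x)"
proof -
  have "((\<lambda>x::real^'n. bracket x) has_derivative (\<lambda>h. 2 * (x \<bullet> h))) (at x)"
    unfolding power2_norm_eq_inner by (auto intro!: derivative_eq_intros simp: inner_commute)
  moreover have "((\<lambda>y. y powr r) has_derivative (\<lambda>h. h * (r * bracket x powr (r - 1))))
      (at (bracket x))"
    using has_real_derivative_powr[of "bracket x" r]
    by (simp add: has_field_derivative_def mult.commute[of _ "r * _"])
  ultimately have "((\<lambda>x::real^'n. complex_of_real (bracket x powr r)) has_derivative
     (\<lambda>h. of_real (2 * (x \<bullet> h) * (r * bracket x powr (r - 1))))) (at x)"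
    by (rule has_derivative_of_real[OF has_derivative_compose])
  moreover have "complex_of_real (2 * (x \<bullet> h) * (r * bracket x powr (r - 1))) =
      differential (\<lambda>i. of_real (2 * r * (x $ i) * bracket x powr (r - 1))) h" for h
    by (simp add: inner_vec_def scaleR_conv_of_real sum_distrib_left sum_distrib_right mult_ac)
  ultimately show ?thesis by simp
qed

lemma symbols_bracket_powr:
  "(\<lambda>x::real^'n::finite. complex_of_real (bracket x powr s)) \<in> symbols s"
proof (rule symbols_coinduct)
  let ?A = "{(\<lambda>x::real^'n. p x * of_real (bracket x powr r)) | p a r. p \<in> symbols a \<and> a + r = s}"
  have incl: "(\<lambda>x. p x * of_real (bracket x powr r)) \<in> ?A" if "p \<in> symbols a" "a + r = s" for p a r
    using that by blast
  show "(\<lambda>x. complex_of_real (bracket x powr s)) \<in> ?A"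
    using incl[of "\<lambda>x. 1" 0 s] by (simp add: symbols_const)
  fix h assume "h \<in> ?A"
  then obtain p a r
    where h: "h = (\<lambda>x. p x * of_real (bracket x powr r))" and p: "p \<in> symbols a" and "a + r = s"
    by blast
  have diff: "(\<lambda>x::real^'n. complex_of_real (bracket x powr r)) differentiable (at x)" for x
    using has_derivative_bracket_powr unfolding differentiable_def by blast
  show "h differentiable (at x)" for x
    unfolding h by (intro differentiable_mult symbols_differentiable[OF p] diff)
  show "h \<in> growth s"
    unfolding h \<open>a + r = s\<close>[symmetric]
    by (intro growth_mult symbols_growth[OF p] growth_bracket_powr)
  show "partial_deriv i h \<in> additive_closure ?A" for i
  proof -
    have leibniz: "partial_deriv i h = (\<lambda>x. partial_deriv i p x * of_real (bracket x powr r) +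
        (2 * of_real r) * (of_real (x $ i) * p x) * of_real (bracket x powr (r - 1)))"
      unfolding h partial_deriv_mult[OF symbols_differentiable[OF p] diff, abs_def]
        partial_deriv_eq_differentialI[OF has_derivative_bracket_powr]
      by (simp add: mult_ac)
    have "(\<lambda>x. (2 * of_real r) * (of_real (x $ i) * p x)) \<in> symbols (a + 1)"
      by (intro symbols_cmult symbols_mono[OF symbols_mult[OF symbols_coord p]]) simp
    then show ?thesis
      unfolding leibniz using \<open>a + r = s\<close>
      by (intro additive_closure.add additive_closure.incl incl)
        (auto intro: symbols_partial_deriv p)
  qed
qed

lemma symbols_all_orders:
  assumes "\<And>m. f \<in> symbols (- real m)"
  shows "f \<in> symbols K"
  using assms[of "nat \<lceil>- K\<rceil>"] by (rule symbols_mono) linarith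

subsection \<open>Even Schwartz functions\<close>

lemma schwartz_even_iff: "f \<in> schwartz_even \<longleftrightarrow> even_fun f \<and> (\<forall>K. f \<in> symbols K)"
proof -
  have "f \<in> schwartz_even \<longleftrightarrow> even_fun f \<and> (\<forall>m. f \<in> symbols (- real m))"
    by (auto simp: schwartz_even_def symbols_def growth_uminus_of_nat_iff)
  then show ?thesis using symbols_all_orders by blast
qed

lemma schwartz_even_symbols: "f \<in> schwartz_even \<Longrightarrow> f \<in> symbols K"
  by (simp add: schwartz_even_iff)

lemma schwartz_even_smooth: "f \<in> schwartz_even \<Longrightarrow> smooth_fun f"
  by (simp add: schwartz_even_def)

lemma schwartz_even_even: "f \<in> schwartz_even \<Longrightarrow> even_fun f"
  by (simp add: schwartz_even_def)

lemma schwartz_even_borel_measurable: "f \<in> schwartz_even \<Longrightarrow> f \<in> borel_measurable borel"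
  by (intro smooth_fun_borel_measurable schwartz_even_smooth)

lemma schwartz_even_mult_symbol:
  assumes "h \<in> symbols K" "even_fun h" "f \<in> schwartz_even"
  shows "(\<lambda>x. h x * f x) \<in> schwartz_even"
proof -
  have "(\<lambda>x. h x * f x) \<in> symbols L" for L
    using symbols_mult[OF assms(1) schwartz_even_symbols[OF assms(3), of "L - K"]] by simp
  then show ?thesis using assms by (auto simp: schwartz_even_iff even_fun_def)
qed

lemma schwartz_even_cmult: "f \<in> schwartz_even \<Longrightarrow> (\<lambda>x. c * f x) \<in> schwartz_even"
  by (auto simp: schwartz_even_iff even_fun_def intro: symbols_cmult)

lemma schwartz_even_add:
  "f \<in> schwartz_even \<Longrightarrow> g \<in> schwartz_even \<Longrightarrow> (\<lambda>x. f x + g x) \<in> schwartz_even"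
  by (auto simp: schwartz_even_iff even_fun_def intro: symbols_add)

lemma schwartz_even_diff:
  "f \<in> schwartz_even \<Longrightarrow> g \<in> schwartz_even \<Longrightarrow> (\<lambda>x. f x - g x) \<in> schwartz_even"
  by (auto simp: schwartz_even_iff even_fun_def intro: symbols_diff)

lemma schwartz_even_norm_power2_mult:
  "f \<in> schwartz_even \<Longrightarrow> (\<lambda>x. of_real ((norm x)\<^sup>2) * f x) \<in> schwartz_even"
  by (rule schwartz_even_mult_symbol[OF symbols_norm_power2
        even_fun_radial[of "\<lambda>r. of_real (r\<^sup>2)"]])

subsection \<open>Normalized Bessel functions\<close>

definition bessel_coeff :: "real \<Rightarrow> nat \<Rightarrow> real" where
  "bessel_coeff \<gamma> k = (-1) ^ k / (fact k * pochhammer (\<gamma> + 1) k)"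

definition bessel_series :: "real \<Rightarrow> real \<Rightarrow> real" where
  "bessel_series \<gamma> u = (\<Sum>k. bessel_coeff \<gamma> k * u ^ k)"

lemma pochhammer_ge_min: "min 1 a \<le> pochhammer a k" if "0 < a" for a :: real
proof (cases k)
  case (Suc m)
  have "1 \<le> pochhammer (a + 1) m"
  proof (induction m)
    case (Suc m)
    then show ?case
      using that mult_mono[of 1 "a + 1 + real m" 1 "pochhammer (a + 1) m"]
      by (simp add: pochhammer_rec')
  qed simp
  then have "a \<le> pochhammer a k"
    using that by (simp add: Suc pochhammer_rec)
  then show ?thesis by simp
qed simp

lemma summable_bessel_coeff:
  assumes "- 1 < \<gamma>"
  shows "summable (\<lambda>k. bessel_coeff \<gamma> k * u ^ k)"
proof (rule summable_comparison_test')
  define c where "c = min 1 (\<gamma> + 1)"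
  show "summable (\<lambda>k. inverse c * (inverse (fact k) * \<bar>u\<bar> ^ k))"
    by (intro summable_mult summable_exp)
  fix k :: nat
  have "0 < c" "c \<le> pochhammer (\<gamma> + 1) k"
    using assms pochhammer_ge_min[of "\<gamma> + 1" k] by (auto simp: c_def)
  then have "inverse (pochhammer (\<gamma> + 1) k) \<le> inverse c"
    by (rule le_imp_inverse_le[rotated])
  then have "inverse (pochhammer (\<gamma> + 1) k) * (inverse (fact k) * \<bar>u\<bar> ^ k)
      \<le> inverse c * (inverse (fact k) * \<bar>u\<bar> ^ k)"
    by (rule mult_right_mono) simp
  then show "norm (bessel_coeff \<gamma> k * u ^ k) \<le> inverse c * (inverse (fact k) * \<bar>u\<bar> ^ k)"
    using \<open>0 < c\<close> \<open>c \<le> pochhammer (\<gamma> + 1) k\<close>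
    by (simp add: bessel_coeff_def abs_mult power_abs divide_inverse mult_ac)
qed

lemma bessel_series_sums:
  "- 1 < \<gamma> \<Longrightarrow> (\<lambda>k. bessel_coeff \<gamma> k * u ^ k) sums bessel_series \<gamma> u"
  unfolding bessel_series_def by (intro summable_sums summable_bessel_coeff)

lemma diffs_bessel_coeff:
  assumes "- 1 < \<gamma>"
  shows "diffs (bessel_coeff \<gamma>) k = (- 1 / (\<gamma> + 1)) * bessel_coeff (\<gamma> + 1) k"
proof -
  have "0 < pochhammer (\<gamma> + 2) k" using assms by (intro pochhammer_pos) auto
  then show ?thesis
    using assms by (simp add: diffs_def bessel_coeff_def pochhammer_rec add.commute divide_simps)
qed

lemma has_real_derivative_bessel_series:
  assumes "- 1 < \<gamma>"
  shows "(bessel_series \<gamma> has_real_derivative - bessel_series (\<gamma> + 1) u / (\<gamma> + 1)) (at u)"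
proof -
  have "((\<lambda>u. \<Sum>k. bessel_coeff \<gamma> k * u ^ k) has_real_derivative
      (\<Sum>k. diffs (bessel_coeff \<gamma>) k * u ^ k)) (at u)"
    by (rule termdiffs_strong_converges_everywhere) (rule summable_bessel_coeff[OF assms])
  moreover have "(\<Sum>k. diffs (bessel_coeff \<gamma>) k * u ^ k) = - 1 / (\<gamma> + 1) * bessel_series (\<gamma> + 1) u"
    unfolding bessel_series_def diffs_bessel_coeff[OF assms] mult.assoc
    using assms by (intro suminf_mult summable_bessel_coeff) auto
  ultimately show ?thesis
    by (simp add: bessel_series_def[abs_def])
qed

lemma bessel_coeff_contiguous:
  assumes "- 1 < \<gamma>"
  shows "bessel_coeff \<gamma> (Suc k) =
    bessel_coeff (\<gamma> + 1) (Suc k) - bessel_coeff (\<gamma> + 2) k / ((\<gamma> + 1) * (\<gamma> + 2))"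
proof -
  define P where "P = pochhammer (\<gamma> + 3) k"
  have nonzero: "P \<noteq> 0" "\<gamma> + 1 \<noteq> 0" "\<gamma> + 2 \<noteq> 0" "\<gamma> + 2 + real k \<noteq> 0" "1 + real k \<noteq> 0"
    using assms pochhammer_pos[of "\<gamma> + 3" k] by (auto simp: P_def)
  have suc1: "pochhammer (\<gamma> + 2) (Suc k) = (\<gamma> + 2) * P"
    by (simp add: P_def pochhammer_rec add.commute)
  then have "pochhammer (\<gamma> + 2) k = (\<gamma> + 2) * P / (\<gamma> + 2 + real k)"
    using nonzero by (simp add: pochhammer_rec' field_simps)
  then have suc0: "pochhammer (\<gamma> + 1) (Suc k) = (\<gamma> + 1) * ((\<gamma> + 2) * P / (\<gamma> + 2 + real k))"
    by (simp add: pochhammer_rec add.commute add.assoc)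
  have coeffs:
    "bessel_coeff \<gamma> (Suc k) = - ((-1) ^ k) * (\<gamma> + 2 + real k) /
       ((1 + real k) * fact k * ((\<gamma> + 1) * ((\<gamma> + 2) * P)))"
    "bessel_coeff (\<gamma> + 1) (Suc k) = - ((-1) ^ k) / ((1 + real k) * fact k * ((\<gamma> + 2) * P))"
    "bessel_coeff (\<gamma> + 2) k = (-1) ^ k / (fact k * P)"
    using suc0 suc1 nonzero by (simp_all add: bessel_coeff_def add.assoc P_def)
  show ?thesis
    unfolding coeffs using nonzero by (simp add: divide_simps) (simp add: algebra_simps)
qed

lemma bessel_series_contiguous:
  assumes "- 1 < \<gamma>"
  shows "bessel_series \<gamma> u =
    bessel_series (\<gamma> + 1) u - u / ((\<gamma> + 1) * (\<gamma> + 2)) * bessel_series (\<gamma> + 2) u"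
proof -
  let ?c = "u / ((\<gamma> + 1) * (\<gamma> + 2))"
  have tail: "(\<lambda>k. bessel_coeff \<delta> (Suc k) * u ^ Suc k) sums (bessel_series \<delta> u - 1)"
    if "- 1 < \<delta>" for \<delta>
    using bessel_series_sums[OF that, of u]
    by (subst sums_Suc_iff) (simp add: bessel_coeff_def)
  have "(\<lambda>k. bessel_coeff (\<gamma> + 1) (Suc k) * u ^ Suc k - ?c * (bessel_coeff (\<gamma> + 2) k * u ^ k))
      sums (bessel_series (\<gamma> + 1) u - 1 - ?c * bessel_series (\<gamma> + 2) u)"
    using assms by (intro sums_diff sums_mult tail bessel_series_sums) auto
  then have "(\<lambda>k. bessel_coeff \<gamma> (Suc k) * u ^ Suc k)
      sums (bessel_series (\<gamma> + 1) u - 1 - ?c * bessel_series (\<gamma> + 2) u)"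
    by (simp add: bessel_coeff_contiguous[OF assms] left_diff_distrib right_diff_distrib mult_ac)
  from sums_unique2[OF tail[OF assms] this] show ?thesis by simp
qed

lemma bessel_j_eq_bessel_series:
  assumes "- 1 < \<gamma>"
  shows "bessel_j \<gamma> t = bessel_series \<gamma> ((t / 2)\<^sup>2)"
proof -
  have Gamma_pos: "0 < Gamma (\<gamma> + 1)" using assms by (intro Gamma_real_pos) auto
  have "(-1) ^ k / (fact k * Gamma (real k + \<gamma> + 1)) * (t / 2) ^ (2 * k)
      = bessel_coeff \<gamma> k * ((t / 2)\<^sup>2) ^ k / Gamma (\<gamma> + 1)" for k
  proof -
    have "\<gamma> + 1 \<notin> \<int>\<^sub>\<le>\<^sub>0" using assms by (auto elim!: nonpos_Ints_cases)
    then have "pochhammer (\<gamma> + 1) k = Gamma (\<gamma> + 1 + real k) / Gamma (\<gamma> + 1)"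
      by (rule pochhammer_Gamma)
    then have "Gamma (real k + \<gamma> + 1) = pochhammer (\<gamma> + 1) k * Gamma (\<gamma> + 1)"
      using Gamma_pos by (simp add: add_ac)
    then show ?thesis
      unfolding bessel_coeff_def power_mult by simp
  qed
  then show ?thesis
    unfolding bessel_j_def bessel_series_def
    using suminf_divide[OF summable_bessel_coeff[OF assms], of "(t / 2)\<^sup>2" "Gamma (\<gamma> + 1)"]
      Gamma_pos
    by simp
qed

lemma bessel_j_minus [simp]: "bessel_j \<gamma> (- t) = bessel_j \<gamma> t"
  by (simp add: bessel_j_def)

lemma bessel_j_0: "- 1 < \<gamma> \<Longrightarrow> bessel_j \<gamma> 0 = 1"
  using powser_zero[of "bessel_coeff \<gamma>"]
  by (simp add: bessel_j_eq_bessel_series bessel_series_def bessel_coeff_def)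

text \<open>The recursion is \<open>j\<^sub>\<gamma>'' = - j\<^sub>\<gamma> + (2\<gamma> + 1) / (2\<gamma> + 2) j\<^bsub>\<gamma>+1\<^esub>\<close>. It has constant coefficients,
  so that all derivatives are bounded as soon as \<open>j\<close> and \<open>j'\<close> are.\<close>

fun bessel_deriv :: "nat \<Rightarrow> real \<Rightarrow> real \<Rightarrow> real" where
  "bessel_deriv 0 \<gamma> t = bessel_j \<gamma> t"
| "bessel_deriv (Suc 0) \<gamma> t = - (t / (2 * (\<gamma> + 1))) * bessel_j (\<gamma> + 1) t"
| "bessel_deriv (Suc (Suc m)) \<gamma> t =
     - bessel_deriv m \<gamma> t + (2 * \<gamma> + 1) / (2 * \<gamma> + 2) * bessel_deriv m (\<gamma> + 1) t"

lemma has_real_derivative_bessel_j: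
  assumes "- 1 < \<gamma>"
  shows "(bessel_j \<gamma> has_real_derivative bessel_deriv 1 \<gamma> t) (at t)"
proof -
  have "((\<lambda>t. (t / 2)\<^sup>2) has_real_derivative t / 2) (at t)"
    by (auto intro!: derivative_eq_intros simp: field_simps)
  from DERIV_chain2[OF has_real_derivative_bessel_series[OF assms] this]
  have "((\<lambda>t. bessel_series \<gamma> ((t / 2)\<^sup>2)) has_real_derivative
     - bessel_series (\<gamma> + 1) ((t / 2)\<^sup>2) / (\<gamma> + 1) * (t / 2)) (at t)" .
  moreover have "bessel_j \<gamma> = (\<lambda>t. bessel_series \<gamma> ((t / 2)\<^sup>2))"
    using assms by (intro ext bessel_j_eq_bessel_series) auto
  ultimately show ?thesis
    using assms by (simp add: bessel_j_eq_bessel_series mult_ac)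
qed

lemma has_real_derivative_bessel_deriv_1:
  assumes "- 1 < \<gamma>"
  shows "(bessel_deriv 1 \<gamma> has_real_derivative bessel_deriv 2 \<gamma> t) (at t)"
proof -
  define a where "a = 1 / (\<gamma> + 1)"
  define b where "b = 1 / (\<gamma> + 2)"
  have fractions: "(2 * \<gamma> + 1) / (2 * \<gamma> + 2) = 1 - a / 2"
    "1 / (2 * (\<gamma> + 1)) = a / 2" "t / (2 * (\<gamma> + 1)) = t * a / 2" "t / (2 * (\<gamma> + 1 + 1)) = t * b / 2"
    "(t / 2)\<^sup>2 / ((\<gamma> + 1) * (\<gamma> + 2)) = t\<^sup>2 / 4 * a * b"
    using assms
    by (simp_all add: a_def b_def divide_simps power2_eq_square) (simp add: algebra_simps)
  have contiguous: "bessel_j \<gamma> t = bessel_j (\<gamma> + 1) t -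
      (t / 2)\<^sup>2 / ((\<gamma> + 1) * (\<gamma> + 2)) * bessel_j (\<gamma> + 1 + 1) t"
    using bessel_series_contiguous[OF assms] assms
    by (simp add: bessel_j_eq_bessel_series add.assoc)
  have "((\<lambda>t. - (t / (2 * (\<gamma> + 1))) * bessel_j (\<gamma> + 1) t) has_real_derivative
      - (1 / (2 * (\<gamma> + 1))) * bessel_j (\<gamma> + 1) t +
      bessel_deriv 1 (\<gamma> + 1) t * (- (t / (2 * (\<gamma> + 1))))) (at t)"
    using assms
    by (intro DERIV_mult has_real_derivative_bessel_j) (auto intro!: derivative_eq_intros)
  moreover have "- (1 / (2 * (\<gamma> + 1))) * bessel_j (\<gamma> + 1) t +
      bessel_deriv 1 (\<gamma> + 1) t * (- (t / (2 * (\<gamma> + 1)))) = bessel_deriv 2 \<gamma> t"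
    unfolding numeral_2_eq_2
    by (simp only: One_nat_def bessel_deriv.simps contiguous fractions)
      (simp add: algebra_simps power2_eq_square)
  moreover have "bessel_deriv 1 \<gamma> = (\<lambda>t. - (t / (2 * (\<gamma> + 1))) * bessel_j (\<gamma> + 1) t)"
    by auto
  ultimately show ?thesis by (simp only:)
qed

lemma has_real_derivative_bessel_deriv:
  assumes "- 1 < \<gamma>"
  shows "(bessel_deriv m \<gamma> has_real_derivative bessel_deriv (Suc m) \<gamma> t) (at t)"
  using assms
proof (induction m \<gamma> t rule: bessel_deriv.induct)
  case (1 \<gamma> t)
  moreover have "bessel_deriv 0 \<gamma> = bessel_j \<gamma>" by auto
  ultimately show ?case using has_real_derivative_bessel_j[of \<gamma> t] by simp
next
  case (2 \<gamma> t)
  then show ?case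
    using has_real_derivative_bessel_deriv_1[of \<gamma> t] by (simp only: One_nat_def numeral_2_eq_2)
next
  case (3 m \<gamma> t)
  have "((\<lambda>t. - bessel_deriv m \<gamma> t + (2 * \<gamma> + 1) / (2 * \<gamma> + 2) * bessel_deriv m (\<gamma> + 1) t)
     has_real_derivative (- bessel_deriv (Suc m) \<gamma> t +
       (2 * \<gamma> + 1) / (2 * \<gamma> + 2) * bessel_deriv (Suc m) (\<gamma> + 1) t)) (at t)"
    using 3 by (intro DERIV_add DERIV_minus DERIV_cmult) auto
  then show ?case by simp
qed

lemma bessel_deriv_borel_measurable: "- 1 < \<gamma> \<Longrightarrow> bessel_deriv m \<gamma> \<in> borel_measurable borel"
  by (intro borel_measurable_continuous_onI DERIV_continuous_on[of UNIV])
    (auto intro: has_field_derivative_at_within has_real_derivative_bessel_deriv)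

lemma bessel_equation:
  assumes "- 1 < \<gamma>" "t \<noteq> 0"
  shows "bessel_deriv 2 \<gamma> t + (2 * \<gamma> + 1) / t * bessel_deriv 1 \<gamma> t = - bessel_j \<gamma> t"
  using assms by (simp add: numeral_2_eq_2 divide_simps)

lemma bessel_equation_0:
  assumes "- 1 < \<gamma>"
  shows "bessel_deriv 2 \<gamma> 0 + (2 * \<gamma> + 1) * bessel_deriv 2 \<gamma> 0 = - bessel_j \<gamma> 0"
  using assms by (simp add: numeral_2_eq_2 bessel_j_0 divide_simps)

lemma has_real_derivative_bessel_energy:
  assumes "- 1 < \<gamma>"
  shows "((\<lambda>t. (bessel_j \<gamma> t)\<^sup>2 + (bessel_deriv 1 \<gamma> t)\<^sup>2) has_real_derivative
    - (2 * (2 * \<gamma> + 1) / t * (bessel_deriv 1 \<gamma> t)\<^sup>2)) (at t)"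
proof -
  have "((\<lambda>t. (bessel_j \<gamma> t)\<^sup>2 + (bessel_deriv 1 \<gamma> t)\<^sup>2) has_real_derivative
      2 * bessel_deriv 1 \<gamma> t * (bessel_j \<gamma> t + bessel_deriv 2 \<gamma> t)) (at t)"
    by (rule DERIV_cong[OF DERIV_add[OF DERIV_power[OF has_real_derivative_bessel_j[OF assms]]
          DERIV_power[OF has_real_derivative_bessel_deriv_1[OF assms]]]])
      (simp add: distrib_left mult_ac del: bessel_deriv.simps)
  moreover have "2 * bessel_deriv 1 \<gamma> t * (bessel_j \<gamma> t + bessel_deriv 2 \<gamma> t) =
      - (2 * (2 * \<gamma> + 1) / t * (bessel_deriv 1 \<gamma> t)\<^sup>2)"
  proof (cases "t = 0")
    case False
    then have "bessel_j \<gamma> t + bessel_deriv 2 \<gamma> t = - ((2 * \<gamma> + 1) / t * bessel_deriv 1 \<gamma> t)"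
      using bessel_equation[OF assms, of t] by simp
    then show ?thesis by (simp add: power2_eq_square del: bessel_deriv.simps)
  qed simp
  ultimately show ?thesis by simp
qed

lemma bessel_energy_le_1:
  assumes "- 1 / 2 \<le> \<gamma>"
  shows "(bessel_j \<gamma> t)\<^sup>2 + (bessel_deriv 1 \<gamma> t)\<^sup>2 \<le> 1"
proof -
  have order_gt: "- 1 < \<gamma>" using assms by simp
  define e where "e t = (bessel_j \<gamma> t)\<^sup>2 + (bessel_deriv 1 \<gamma> t)\<^sup>2" for t
  have "e \<bar>t\<bar> \<le> e 0"
  proof (rule DERIV_nonpos_imp_nonincreasing[OF abs_ge_zero])
    fix s :: real assume "0 \<le> s"
    then have "- (2 * (2 * \<gamma> + 1) / s * (bessel_deriv 1 \<gamma> s)\<^sup>2) \<le> 0"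
      using assms by (simp add: zero_le_mult_iff zero_le_divide_iff del: bessel_deriv.simps)
    then show "\<exists>y. DERIV e s :> y \<and> y \<le> 0"
      using has_real_derivative_bessel_energy[OF order_gt, of s] unfolding e_def[abs_def] by blast
  qed
  moreover have "e 0 = 1" using order_gt by (simp add: e_def bessel_j_0)
  moreover have "e \<bar>t\<bar> = e t" by (cases "0 \<le> t") (simp_all add: e_def)
  ultimately show ?thesis by (simp add: e_def)
qed

lemma abs_bessel_j_le_1: "\<bar>bessel_j \<gamma> t\<bar> \<le> 1"
  and abs_bessel_deriv_1_le_1: "\<bar>bessel_deriv 1 \<gamma> t\<bar> \<le> 1" if "- 1 / 2 \<le> \<gamma>"
proof -
  have "(bessel_j \<gamma> t)\<^sup>2 \<le> 1" "(bessel_deriv 1 \<gamma> t)\<^sup>2 \<le> 1"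
    using bessel_energy_le_1[OF that, of t] zero_le_power2[of "bessel_j \<gamma> t"]
      zero_le_power2[of "bessel_deriv 1 \<gamma> t"] by linarith+
  then show "\<bar>bessel_j \<gamma> t\<bar> \<le> 1" "\<bar>bessel_deriv 1 \<gamma> t\<bar> \<le> 1"
    by (simp_all only: abs_square_le_1)
qed

lemma bounded_bessel_deriv:
  assumes "- 1 / 2 \<le> \<gamma>"
  shows "bounded (range (bessel_deriv m \<gamma>))"
  using assms
proof (induction m arbitrary: \<gamma> rule: induct_nat_012)
  case 0
  show ?case using abs_bessel_j_le_1[OF 0] by (auto simp: bounded_iff intro: exI[of _ 1])
next
  case 1
  show ?case using abs_bessel_deriv_1_le_1[OF 1] by (auto simp: bounded_iff intro: exI[of _ 1])
next
  case (ge2 m)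
  have "bessel_deriv m \<gamma> \<in> growth 0" "bessel_deriv m (\<gamma> + 1) \<in> growth 0"
    using ge2 by (auto simp: growth_0_iff_bounded)
  then have "(\<lambda>t. (- 1) *\<^sub>R bessel_deriv m \<gamma> t +
      ((2 * \<gamma> + 1) / (2 * \<gamma> + 2)) *\<^sub>R bessel_deriv m (\<gamma> + 1) t) \<in> growth (0 + 0)"
    by (intro growth_add growth_scaleR growth_const order_refl)
  then show ?case by (simp add: growth_0_iff_bounded)
qed

subsection \<open>Differentiation under the integral sign\<close>

lemma bounded_linear_integral:
  fixes f :: "'a \<Rightarrow> 'b::real_normed_vector \<Rightarrow> 'c::{banach, second_countable_topology}"
  assumes bounded_linear: "\<And>t. t \<in> space M \<Longrightarrow> bounded_linear (f t)"
    and norm_le: "\<And>t h. t \<in> space M \<Longrightarrow> norm (f t h) \<le> B t * norm h"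
    and int: "\<And>h. integrable M (\<lambda>t. f t h)" and int_bound: "integrable M B"
  shows "bounded_linear (\<lambda>h. \<integral>t. f t h \<partial>M)"
proof (rule bounded_linear_intro)
  fix h k and r :: real
  have "f t (h + k) = f t h + f t k" "f t (r *\<^sub>R h) = r *\<^sub>R f t h" if "t \<in> space M" for t
    using bounded_linear[OF that] by (simp_all add: linear_simps)
  then have "(\<integral>t. f t (h + k) \<partial>M) = (\<integral>t. f t h + f t k \<partial>M)"
    "(\<integral>t. f t (r *\<^sub>R h) \<partial>M) = (\<integral>t. r *\<^sub>R f t h \<partial>M)"
    by (simp_all only: cong: Bochner_Integration.integral_cong)
  then show "(\<integral>t. f t (h + k) \<partial>M) = (\<integral>t. f t h \<partial>M) + (\<integral>t. f t k \<partial>M)"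
    "(\<integral>t. f t (r *\<^sub>R h) \<partial>M) = r *\<^sub>R (\<integral>t. f t h \<partial>M)"
    using int by simp_all
  have "norm (\<integral>t. f t h \<partial>M) \<le> (\<integral>t. B t * norm h \<partial>M)"
    by (intro order_trans[OF integral_norm_bound integral_mono]) (use int int_bound norm_le in auto)
  then show "norm (\<integral>t. f t h \<partial>M) \<le> norm h * (\<integral>t. B t \<partial>M)"
    by (simp add: mult.commute)
qed

lemma integral_dominated_convergence_at_within:
  fixes f :: "'a::first_countable_topology \<Rightarrow> 'b \<Rightarrow> 'c::{banach, second_countable_topology}"
  assumes lim: "\<And>t. t \<in> space M \<Longrightarrow> ((\<lambda>y. f y t) \<longlongrightarrow> l t) (at x within S)"
    and meas: "\<And>y. y \<in> S \<Longrightarrow> f y \<in> borel_measurable M" "l \<in> borel_measurable M"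
    and bound: "\<And>y t. y \<in> S \<Longrightarrow> y \<noteq> x \<Longrightarrow> t \<in> space M \<Longrightarrow> norm (f y t) \<le> B t"
    and int_bound: "integrable M B"
  shows "((\<lambda>y. \<integral>t. f y t \<partial>M) \<longlongrightarrow> (\<integral>t. l t \<partial>M)) (at x within S)"
  unfolding tendsto_at_iff_sequentially o_def
proof (intro allI impI)
  fix X assume X: "\<forall>n. X n \<in> S - {x}" "X \<longlonglongrightarrow> x"
  show "(\<lambda>n. \<integral>t. f (X n) t \<partial>M) \<longlonglongrightarrow> (\<integral>t. l t \<partial>M)"
  proof (rule integral_dominated_convergence[OF meas(2) _ int_bound])
    show "AE t in M. (\<lambda>n. f (X n) t) \<longlonglongrightarrow> l t"
      using lim X unfolding tendsto_at_iff_sequentially o_def by (intro AE_I2) blast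
  qed (use X(1) meas(1) bound in auto)
qed

lemma has_derivative_integral:
  fixes f :: "'a::real_normed_vector \<Rightarrow> 'b \<Rightarrow> 'c::{banach, second_countable_topology}"
  assumes "convex S" "x \<in> S"
    and deriv: "\<And>y t. y \<in> S \<Longrightarrow> t \<in> space M \<Longrightarrow>
      ((\<lambda>y. f y t) has_derivative f' y t) (at y within S)"
    and onorm_le: "\<And>y t. y \<in> S \<Longrightarrow> t \<in> space M \<Longrightarrow> onorm (f' y t) \<le> B t"
    and int: "\<And>y. y \<in> S \<Longrightarrow> integrable M (f y)"
    and int': "\<And>h. integrable M (\<lambda>t. f' x t h)"
    and int_bound: "integrable M B"
  shows "((\<lambda>y. \<integral>t. f y t \<partial>M) has_derivative (\<lambda>h. \<integral>t. f' x t h \<partial>M)) (at x within S)"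
  unfolding has_derivative_at_within
proof
  have bounded_linear: "bounded_linear (f' x t)" if "t \<in> space M" for t
    using deriv[OF \<open>x \<in> S\<close> that] by (rule has_derivative_bounded_linear)
  have norm_le: "norm (f' x t h) \<le> B t * norm h" if "t \<in> space M" for t h
    using onorm[OF bounded_linear[OF that], of h] onorm_le[OF \<open>x \<in> S\<close> that]
    by (meson mult_right_mono norm_ge_zero order_trans)
  show "bounded_linear (\<lambda>h. \<integral>t. f' x t h \<partial>M)"
    by (rule bounded_linear_integral[OF bounded_linear norm_le int' int_bound])
  define q where "q y t = (f y t - f x t - f' x t (y - x)) /\<^sub>R norm (y - x)" for y t
  have q_int: "integrable M (q y)" if "y \<in> S" for y
    unfolding q_def using int[OF that] int[OF \<open>x \<in> S\<close>] int' by simp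
  have q_lim: "((\<lambda>y. \<integral>t. q y t \<partial>M) \<longlongrightarrow> (\<integral>t. 0 \<partial>M)) (at x within S)"
  proof (rule integral_dominated_convergence_at_within)
    show "((\<lambda>y. q y t) \<longlongrightarrow> 0) (at x within S)" if "t \<in> space M" for t
      using deriv[OF \<open>x \<in> S\<close> that] unfolding has_derivative_at_within q_def by blast
    show "integrable M (\<lambda>t. 2 * B t)" using int_bound by simp
    fix y t assume y: "y \<in> S" "y \<noteq> x" and t: "t \<in> space M"
    have "norm (f y t - f x t) \<le> B t * norm (y - x)"
      by (rule differentiable_bound[of S "\<lambda>y. f y t" "\<lambda>y. f' y t"])
        (use assms(1,2) deriv onorm_le y t in auto)
    then have "norm (f y t - f x t - f' x t (y - x)) \<le> 2 * B t * norm (y - x)"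
      using norm_triangle_ineq4[of "f y t - f x t" "f' x t (y - x)"] norm_le[OF t, of "y - x"]
      by linarith
    then show "norm (q y t) \<le> 2 * B t"
      using y(2) by (simp add: q_def divide_simps)
  qed (use q_int in auto)
  have "(\<integral>t. q y t \<partial>M) =
      ((\<integral>t. f y t \<partial>M) - (\<integral>t. f x t \<partial>M) - (\<integral>t. f' x t (y - x) \<partial>M)) /\<^sub>R norm (y - x)" if "y \<in> S" for y
    unfolding q_def using int[OF that] int[OF \<open>x \<in> S\<close>] int' by simp
  then show "((\<lambda>y. ((\<integral>t. f y t \<partial>M) - (\<integral>t. f x t \<partial>M) - (\<integral>t. f' x t (y - x) \<partial>M)) /\<^sub>R
      norm (y - x)) \<longlongrightarrow> 0) (at x within S)"
    using Lim_transform_within[OF q_lim zero_less_one] by simp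
qed

lemma has_derivative_integral_differential:
  fixes f :: "real^'n::finite \<Rightarrow> 'b \<Rightarrow> complex"
  assumes deriv: "\<And>y t. t \<in> space M \<Longrightarrow>
      ((\<lambda>y. f y t) has_derivative differential (\<lambda>i. d i y t)) (at y)"
    and bound: "\<And>i y t. t \<in> space M \<Longrightarrow> norm (d i y t) \<le> B i t"
    and int: "\<And>y. integrable M (f y)" "\<And>i. integrable M (d i x)" "\<And>i. integrable M (B i)"
  shows "((\<lambda>y. \<integral>t. f y t \<partial>M) has_derivative differential (\<lambda>i. \<integral>t. d i x t \<partial>M)) (at x)"
proof -
  have "onorm (differential (\<lambda>i. d i y t)) \<le> (\<Sum>i\<in>UNIV. B i t)" if "t \<in> space M" for y t
    by (rule order_trans[OF onorm_differential_le sum_mono]) (rule bound[OF that])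
  then have "((\<lambda>y. \<integral>t. f y t \<partial>M) has_derivative
      (\<lambda>h. \<integral>t. differential (\<lambda>i. d i x t) h \<partial>M)) (at x within UNIV)"
    using int deriv
    by (intro has_derivative_integral[where B = "\<lambda>t. \<Sum>i\<in>UNIV. B i t"]
        Bochner_Integration.integrable_sum integrable_scaleR_right) auto
  then show ?thesis
    using int(2) by (simp add: Bochner_Integration.integral_sum)
qed

lemma integral_lborel_translation:
  fixes g :: "'a::euclidean_space \<Rightarrow> 'b::{banach, second_countable_topology}"
  assumes [measurable]: "g \<in> borel_measurable borel"
  shows integrable_lborel_translation_iff:
      "integrable lborel (\<lambda>x. g (x + c)) \<longleftrightarrow> integrable lborel g"
    and "(\<integral>x. g (x + c) \<partial>lborel) = (\<integral>x. g x \<partial>lborel)"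
proof -
  have "integrable (distr lborel borel ((+) c)) g \<longleftrightarrow> integrable lborel (\<lambda>x. g (c + x))"
    by (rule integrable_distr_eq) measurable
  then show "integrable lborel (\<lambda>x. g (x + c)) \<longleftrightarrow> integrable lborel g"
    by (simp add: lborel_distr_plus add.commute)
  have "(\<integral>x. g x \<partial>distr lborel borel ((+) c)) = (\<integral>x. g (c + x) \<partial>lborel)"
    by (rule integral_distr) measurable
  then show "(\<integral>x. g (x + c) \<partial>lborel) = (\<integral>x. g x \<partial>lborel)"
    by (simp add: lborel_distr_plus add.commute)
qed

lemma has_vector_derivative_line_shift:
  fixes g :: "'a::real_vector \<Rightarrow> 'b::real_normed_vector"
  assumes "((\<lambda>s. g ((x + t *\<^sub>R e) + s *\<^sub>R e)) has_vector_derivative g') (at 0)"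
  shows "((\<lambda>t. g (x + t *\<^sub>R e)) has_vector_derivative g') (at t)"
proof -
  have "((\<lambda>s. s - t) has_vector_derivative 1) (at t)"
    by (auto intro!: derivative_eq_intros)
  moreover have "((\<lambda>s. g ((x + t *\<^sub>R e) + s *\<^sub>R e)) has_vector_derivative g') (at (t - t))"
    using assms by simp
  ultimately have "((\<lambda>s. g ((x + t *\<^sub>R e) + s *\<^sub>R e)) \<circ> (\<lambda>s. s - t) has_vector_derivative
      1 *\<^sub>R g') (at t)"
    by (rule vector_diff_chain_at)
  then show ?thesis by (simp add: o_def scaleR_diff_left)
qed

text \<open>By translation invariance \<open>\<integral> g (x + t e) dx\<close> does not depend on \<open>t\<close>.\<close>

lemma integral_directional_derivative_eq_0:
  fixes g g' :: "'a::euclidean_space \<Rightarrow> 'b::{banach, second_countable_topology}"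
  assumes g: "integrable lborel g" and [measurable]: "g' \<in> borel_measurable borel"
    and deriv: "\<And>x. ((\<lambda>t. g (x + t *\<^sub>R e)) has_vector_derivative g' x) (at 0)"
    and bound: "integrable lborel B" "\<And>x t. \<bar>t\<bar> \<le> 1 \<Longrightarrow> norm (g' (x + t *\<^sub>R e)) \<le> B x"
  shows "(\<integral>x. g' x \<partial>lborel) = 0"
proof -
  let ?S = "{- 1<..<1::real}"
  have g_meas: "g \<in> borel_measurable borel" using borel_measurable_integrable[OF g] by simp
  have g'_int: "integrable lborel g'"
    by (rule Bochner_Integration.integrable_bound[OF bound(1)])
      (use bound(2)[of 0] in \<open>auto intro: order_trans[OF _ abs_ge_self]\<close>)
  have "((\<lambda>t. \<integral>x. g (x + t *\<^sub>R e) \<partial>lborel) has_derivative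
      (\<lambda>h. \<integral>x. h *\<^sub>R g' (x + 0 *\<^sub>R e) \<partial>lborel)) (at 0 within ?S)"
  proof (rule has_derivative_integral)
    fix t :: real and x
    show "((\<lambda>t. g (x + t *\<^sub>R e)) has_derivative (\<lambda>h. h *\<^sub>R g' (x + t *\<^sub>R e))) (at t within ?S)"
      using has_vector_derivative_line_shift[of g x t e, OF deriv]
      unfolding has_vector_derivative_def by (rule has_derivative_at_withinI)
    show "integrable lborel (\<lambda>x. g (x + t *\<^sub>R e))"
      using g by (simp add: integrable_lborel_translation_iff[OF g_meas])
    assume "t \<in> ?S"
    then have "norm (g' (x + t *\<^sub>R e)) \<le> B x"
      by (intro bound(2)) (simp add: abs_le_iff)
    then show "onorm (\<lambda>h. h *\<^sub>R g' (x + t *\<^sub>R e)) \<le> B x"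
      by (intro onorm_le) (simp add: mult.commute[of "\<bar>_\<bar>"] mult_right_mono)
  qed (use g'_int bound(1) in auto)
  then have "((\<lambda>t. \<integral>x. g x \<partial>lborel) has_derivative (\<lambda>h. h *\<^sub>R (\<integral>x. g' x \<partial>lborel))) (at (0::real))"
    by (simp add: at_within_open[of _ ?S] integral_lborel_translation(2)[OF g_meas])
  then have "(\<lambda>h. h *\<^sub>R (\<integral>x. g' x \<partial>lborel)) = (\<lambda>h. 0)"
    by (rule has_derivative_unique) (rule has_derivative_const)
  from fun_cong[OF this, of 1] show ?thesis by simp
qed

subsection \<open>Integrability of decaying functions\<close>

lemma integrable_lborel_prod_Basis:
  fixes f :: "'a::euclidean_space \<Rightarrow> real \<Rightarrow>
    'b::{real_normed_field, banach, second_countable_topology}"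
  assumes int: "\<And>b. b \<in> Basis \<Longrightarrow> integrable lborel (f b)"
  shows "integrable lborel (\<lambda>x. \<Prod>b\<in>Basis. f b (x \<bullet> b))"
proof -
  interpret product_sigma_finite "\<lambda>_::'a. lborel :: real measure" by standard
  have [measurable]: "f b \<in> borel_measurable borel" if "b \<in> Basis" for b
    using borel_measurable_integrable[OF int[OF that]] by simp
  have "integrable (\<Pi>\<^sub>M b\<in>Basis. lborel) (\<lambda>y. \<Prod>b\<in>Basis. f b (y b))"
    by (rule product_integrable_prod) (use int in auto)
  moreover have "(\<Sum>c\<in>Basis. y c *\<^sub>R c) \<bullet> b = y b" if "b \<in> Basis" for y and b :: 'a
    using that by (rule inner_sum_left_Basis)
  ultimately show ?thesis
    unfolding lborel_eq[where 'a = 'a] by (subst integrable_distr_eq) auto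
qed

lemma integrable_lborel_growth:
  fixes f :: "'a::euclidean_space \<Rightarrow> 'b::{banach, second_countable_topology}"
  assumes f: "f \<in> borel_measurable borel" and growth: "f \<in> growth (- real DIM('a))"
  shows "integrable lborel f"
proof -
  obtain C where C: "0 \<le> C" "\<And>x. norm (f x) \<le> C * bracket x powr (- real DIM('a))"
    using growthE[OF growth] by blast
  define w where "w x = (\<Prod>b\<in>Basis. inverse (1 + (x \<bullet> b)\<^sup>2))" for x :: 'a
  have "bracket x powr (- real DIM('a)) \<le> w x" for x :: 'a
  proof -
    have "(\<Prod>b\<in>(Basis::'a set). inverse (bracket x)) \<le> w x"
      unfolding w_def
    proof (intro prod_mono conjI le_imp_inverse_le)
      fix b :: 'a assume "b \<in> Basis"
      then have "(x \<bullet> b)\<^sup>2 \<le> (norm x)\<^sup>2"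
        using power_mono[OF Basis_le_norm, of b x 2] by simp
      then show "1 + (x \<bullet> b)\<^sup>2 \<le> bracket x" by simp
    qed (auto simp: add_pos_nonneg)
    then show ?thesis by (simp add: powr_minus powr_realpow power_inverse)
  qed
  then have f_le: "norm (f x) \<le> C * w x" for x
    by (intro order_trans[OF C(2) mult_left_mono[OF _ C(1)]])
  have "integrable lborel w"
    unfolding w_def
    by (intro integrable_lborel_prod_Basis)
      (use integrable_inverse_1_plus_square in \<open>simp add: set_integrable_def\<close>)
  then have "integrable lborel (\<lambda>x. C * w x)" by simp
  then show ?thesis
    by (rule Bochner_Integration.integrable_bound)
      (use f f_le in \<open>auto intro: order_trans[OF _ abs_ge_self]\<close>)
qed

lemma integrable_lborel_bracket_powr:
  "integrable lborel (\<lambda>x::'a::euclidean_space. bracket x powr (- real DIM('a)))"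
  by (intro integrable_lborel_growth growthI[of _ 1]) auto

subsection \<open>The weighted measure\<close>

text \<open>Extends the density of \<open>mu \<alpha>\<close> by zero off the open orthant, since \<open>0 powr a = 0\<close>.\<close>

definition weight :: "real^'n::finite \<Rightarrow> real^'n \<Rightarrow> real" where
  "weight \<alpha> x = (\<Prod>i\<in>UNIV. max 0 (x $ i) powr (2 * \<alpha> $ i + 1))"

lemma weight_measurable [measurable]: "weight \<alpha> \<in> borel_measurable borel"
  unfolding weight_def[abs_def] by measurable

lemma weight_eq_indicator:
  "weight \<alpha> x = indicator pos_orthant x * (\<Prod>i\<in>UNIV. x $ i powr (2 * \<alpha> $ i + 1))"
proof (cases "x \<in> pos_orthant")
  case True
  then have "max 0 (x $ i) = x $ i" for i unfolding pos_orthant_def by (simp add: less_imp_le)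
  then show ?thesis using True by (simp add: weight_def)
next
  case False
  then obtain i where "x $ i \<le> 0" unfolding pos_orthant_def by (auto simp: not_less)
  then have "weight \<alpha> x = 0" unfolding weight_def by (intro prod_zero bexI[of _ i]) auto
  then show ?thesis using False by simp
qed

lemma open_pos_orthant: "open (pos_orthant :: (real^'n::finite) set)"
  unfolding pos_orthant_def Collect_all_eq
  by (auto intro!: open_INT open_Collect_less continuous_intros)

lemma pos_orthant_borel [measurable]: "pos_orthant \<in> sets borel"
  by (rule borel_open[OF open_pos_orthant])

lemma sets_mu: "sets (mu \<alpha>) = sets (restrict_space borel pos_orthant)"
  by (simp add: mu_def sets_restrict_space)

lemma space_mu: "space (mu \<alpha>) = pos_orthant"
  by (simp add: mu_def space_restrict_space)

lemma borel_measurable_mu: "f \<in> borel_measurable borel \<Longrightarrow> f \<in> borel_measurable (mu \<alpha>)"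
  using measurable_restrict_space1[of f borel borel pos_orthant]
    measurable_cong_sets[OF sets_mu[of \<alpha>] refl, of borel] by blast

lemma orthant_density_measurable:
  "(\<lambda>x. \<Prod>i\<in>UNIV. x $ i powr a i) \<in> borel_measurable (restrict_space lborel pos_orthant)"
  for a :: "'n::finite \<Rightarrow> real"
  by (rule measurable_restrict_space1) measurable

lemma sigma_finite_mu: "sigma_finite_measure (mu \<alpha>)"
proof -
  interpret sigma_finite_measure "restrict_space lborel pos_orthant :: (real^'a) measure"
    by (intro sigma_finite_measure_restrict_space sigma_finite_lborel) simp
  show ?thesis
    unfolding mu_def using orthant_density_measurable[of "\<lambda>i. 2 * \<alpha> $ i + 1"]
    by (subst sigma_finite_iff_density_finite) auto
qed

lemma
  fixes f :: "real^'n::finite \<Rightarrow> 'b::{banach, second_countable_topology}"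
  assumes f: "f \<in> borel_measurable borel"
  shows integrable_mu_iff: "integrable (mu \<alpha>) f \<longleftrightarrow> integrable lborel (\<lambda>x. weight \<alpha> x *\<^sub>R f x)"
    and integral_mu: "(\<integral>x. f x \<partial>mu \<alpha>) = (\<integral>x. weight \<alpha> x *\<^sub>R f x \<partial>lborel)"
proof -
  let ?R = "restrict_space (lborel :: (real^'n) measure) pos_orthant"
  let ?w = "\<lambda>x::real^'n. \<Prod>i\<in>UNIV. x $ i powr (2 * \<alpha> $ i + 1)"
  have w_meas: "?w \<in> borel_measurable ?R"
    by (rule orthant_density_measurable)
  have w_nonneg: "AE x in ?R. 0 \<le> ?w x" by (intro AE_I2 prod_nonneg) auto
  have f_meas: "f \<in> borel_measurable ?R" using f by (intro measurable_restrict_space1) simp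
  have orthant: "pos_orthant \<inter> space lborel \<in> sets (lborel :: (real^'n) measure)" by simp
  have weight: "indicator pos_orthant x *\<^sub>R (?w x *\<^sub>R f x) = weight \<alpha> x *\<^sub>R f x" for x
    by (simp add: weight_eq_indicator)
  show "integrable (mu \<alpha>) f \<longleftrightarrow> integrable lborel (\<lambda>x. weight \<alpha> x *\<^sub>R f x)"
    unfolding mu_def integrable_density[OF f_meas w_meas w_nonneg]
      integrable_restrict_space[OF orthant] set_integrable_def weight ..
  show "(\<integral>x. f x \<partial>mu \<alpha>) = (\<integral>x. weight \<alpha> x *\<^sub>R f x \<partial>lborel)"
    unfolding mu_def integral_density[OF f_meas w_meas w_nonneg]
      integral_restrict_space[OF orthant] set_lebesgue_integral_def weight ..
qed

lemma growth_coord_powr: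
  assumes "0 \<le> a"
  shows "(\<lambda>x::real^'n::finite. max 0 (x $ i) powr a) \<in> growth (a / 2)"
proof -
  obtain C where "0 \<le> C" and C: "\<And>x::real^'n. norm (x $ i) \<le> C * bracket x powr (1 / 2)"
    using growthE[OF growth_coord[of i]] by blast
  have "norm (max 0 (x $ i) powr a) \<le> C powr a * bracket x powr (a / 2)" for x :: "real^'n"
  proof -
    have "max 0 (x $ i) powr a \<le> (C * bracket x powr (1 / 2)) powr a"
      using C[of x] \<open>0 \<le> C\<close> assms by (intro powr_mono2) auto
    also have "\<dots> = C powr a * bracket x powr (a / 2)"
      using \<open>0 \<le> C\<close> by (simp add: powr_mult powr_powr)
    finally show ?thesis by simp
  qed
  then show ?thesis by (rule growthI)
qed

text \<open>Growth of order \<open>- n\<close> suffices for Lebesgue integrability, and the weight has growth of order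
  \<open>\<Sum>\<^sub>i (\<alpha>\<^sub>i + 1 / 2)\<close>.\<close>

definition integrable_order :: "real^'n::finite \<Rightarrow> real" where
  "integrable_order \<alpha> = - real CARD('n) - (\<Sum>i\<in>UNIV. \<alpha> $ i + 1 / 2)"

locale poly_axial =
  fixes \<alpha> :: "real^'n::finite"
  assumes order_gt: "\<And>i. - 1 / 2 < \<alpha> $ i"
begin

lemma growth_weight: "weight \<alpha> \<in> growth (\<Sum>i\<in>UNIV. \<alpha> $ i + 1 / 2)"
proof -
  have "(\<lambda>x. max 0 (x $ i) powr (2 * \<alpha> $ i + 1)) \<in> growth (\<alpha> $ i + 1 / 2)" for i
    using growth_coord_powr[of "2 * \<alpha> $ i + 1" i] order_gt[of i] by (simp add: add_divide_distrib)
  then show ?thesis unfolding weight_def[abs_def] by (rule growth_prod)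
qed

lemma growth_weight_scaleR:
  assumes "f \<in> growth (integrable_order \<alpha>)"
  shows "(\<lambda>x. weight \<alpha> x *\<^sub>R f x) \<in> growth (- real CARD('n))"
  using growth_scaleR[OF growth_weight assms] by (simp add: integrable_order_def)

lemma integrable_mu_growth:
  fixes f :: "real^'n \<Rightarrow> 'b::{banach, second_countable_topology}"
  assumes [measurable]: "f \<in> borel_measurable borel" and "f \<in> growth (integrable_order \<alpha>)"
  shows "integrable (mu \<alpha>) f"
  unfolding integrable_mu_iff[OF assms(1)]
  using growth_weight_scaleR[OF assms(2)] by (intro integrable_lborel_growth) auto

end

subsection \<open>Domination by seminorms\<close>

definition seminorm_dominated :: "'a set \<Rightarrow> ('a \<Rightarrow> real) set \<Rightarrow> ('a \<Rightarrow> 'i \<Rightarrow> real) \<Rightarrow> bool" where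
  "seminorm_dominated V P Q \<longleftrightarrow>
     (\<exists>F C. finite F \<and> F \<subseteq> P \<and> 0 \<le> C \<and> (\<forall>f\<in>V. \<forall>i. Q f i \<le> C * (\<Sum>p\<in>F. \<bar>p f\<bar>)))"

lemma seminorm_dominatedI:
  assumes "finite F" "F \<subseteq> P" "0 \<le> C" "\<And>f i. f \<in> V \<Longrightarrow> Q f i \<le> C * (\<Sum>p\<in>F. \<bar>p f\<bar>)"
  shows "seminorm_dominated V P Q"
  unfolding seminorm_dominated_def using assms by blast

lemma seminorm_dominatedE:
  assumes "seminorm_dominated V P Q"
  obtains F C where "finite F" "F \<subseteq> P" "0 \<le> C" "\<forall>f\<in>V. \<forall>i. Q f i \<le> C * (\<Sum>p\<in>F. \<bar>p f\<bar>)"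
  using assms unfolding seminorm_dominated_def by blast

lemma seminorm_dominated_seminorm: "p \<in> P \<Longrightarrow> seminorm_dominated V P (\<lambda>f i. p f)"
  by (rule seminorm_dominatedI[of "{p}" _ 1]) auto

lemma seminorm_dominated_mono:
  assumes "seminorm_dominated V P Q" "\<And>f i. f \<in> V \<Longrightarrow> R f i \<le> Q f i"
  shows "seminorm_dominated V P R"
  using assms unfolding seminorm_dominated_def by (meson order_trans)

lemma seminorm_dominated_add:
  assumes "seminorm_dominated V P Q" "seminorm_dominated V P R"
  shows "seminorm_dominated V P (\<lambda>f i. Q f i + R f i)"
proof -
  obtain F C where F: "finite F" "F \<subseteq> P" "0 \<le> C" "\<forall>f\<in>V. \<forall>i. Q f i \<le> C * (\<Sum>p\<in>F. \<bar>p f\<bar>)"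
    by (rule seminorm_dominatedE[OF assms(1)])
  obtain G D where G: "finite G" "G \<subseteq> P" "0 \<le> D" "\<forall>f\<in>V. \<forall>i. R f i \<le> D * (\<Sum>p\<in>G. \<bar>p f\<bar>)"
    by (rule seminorm_dominatedE[OF assms(2)])
  show ?thesis
  proof (rule seminorm_dominatedI[of "F \<union> G" _ "C + D"])
    fix f i assume "f \<in> V"
    then have "Q f i + R f i \<le> C * (\<Sum>p\<in>F. \<bar>p f\<bar>) + D * (\<Sum>p\<in>G. \<bar>p f\<bar>)"
      using F(4) G(4) by (intro add_mono) auto
    also have "\<dots> \<le> C * (\<Sum>p\<in>F \<union> G. \<bar>p f\<bar>) + D * (\<Sum>p\<in>F \<union> G. \<bar>p f\<bar>)"
      using F G by (intro add_mono mult_left_mono sum_mono2) auto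
    finally show "Q f i + R f i \<le> (C + D) * (\<Sum>p\<in>F \<union> G. \<bar>p f\<bar>)"
      by (simp add: distrib_right)
  qed (use F G in auto)
qed

lemma seminorm_dominated_cmult:
  assumes "seminorm_dominated V P Q" "0 \<le> c"
  shows "seminorm_dominated V P (\<lambda>f i. c * Q f i)"
proof -
  obtain F C where F: "finite F" "F \<subseteq> P" "0 \<le> C" "\<forall>f\<in>V. \<forall>i. Q f i \<le> C * (\<Sum>p\<in>F. \<bar>p f\<bar>)"
    by (rule seminorm_dominatedE[OF assms(1)])
  show ?thesis
    by (rule seminorm_dominatedI[of F _ "c * C"])
      (use F assms(2) in \<open>auto simp: mult.assoc intro: mult_left_mono\<close>)
qed

lemma seminorm_dominated_zero: "seminorm_dominated V P (\<lambda>f i. 0)"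
  by (rule seminorm_dominatedI[of "{}" _ 0]) auto

lemma seminorm_dominated_sum_list:
  assumes "\<And>j. j \<in> set js \<Longrightarrow> seminorm_dominated V P (Q j)"
  shows "seminorm_dominated V P (\<lambda>f i. \<Sum>j\<leftarrow>js. Q j f i)"
  using assms
  by (induction js) (simp_all add: seminorm_dominated_zero seminorm_dominated_add)

lemma seminorm_dominated_bounded:
  assumes "seminorm_dominated V P Q" "f \<in> V"
  shows "\<exists>C. \<forall>i. Q f i \<le> C"
  using assms unfolding seminorm_dominated_def by blast

lemma seminorm_dominated_finite:
  assumes "finite I" "\<And>i. i \<in> I \<Longrightarrow> seminorm_dominated V P (\<lambda>f (_::unit). Q f i)"
  shows "seminorm_dominated V P (\<lambda>f i. if i \<in> I then Q f i else 0)"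
proof -
  have "\<exists>F C. finite F \<and> F \<subseteq> P \<and> 0 \<le> C \<and> (\<forall>f\<in>V. Q f i \<le> C * (\<Sum>p\<in>F. \<bar>p f\<bar>))" if "i \<in> I" for i
    using assms(2)[OF that] unfolding seminorm_dominated_def by blast
  then obtain F C where F: "\<And>i. i \<in> I \<Longrightarrow> finite (F i)" "\<And>i. i \<in> I \<Longrightarrow> F i \<subseteq> P"
    and C: "\<And>i. i \<in> I \<Longrightarrow> 0 \<le> C i"
    and dominated: "\<And>i f. i \<in> I \<Longrightarrow> f \<in> V \<Longrightarrow> Q f i \<le> C i * (\<Sum>p\<in>F i. \<bar>p f\<bar>)"
    by metis
  show ?thesis
  proof (rule seminorm_dominatedI[of "\<Union>i\<in>I. F i" _ "\<Sum>i\<in>I. C i"])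
    show "0 \<le> (\<Sum>i\<in>I. C i)" using C by (rule sum_nonneg)
    fix f i assume f: "f \<in> V"
    show "(if i \<in> I then Q f i else 0) \<le> (\<Sum>i\<in>I. C i) * (\<Sum>p\<in>(\<Union>i\<in>I. F i). \<bar>p f\<bar>)"
    proof (cases "i \<in> I")
      case True
      then have "C i * (\<Sum>p\<in>F i. \<bar>p f\<bar>) \<le> (\<Sum>i\<in>I. C i) * (\<Sum>p\<in>(\<Union>i\<in>I. F i). \<bar>p f\<bar>)"
        using assms(1) F C by (intro mult_mono member_le_sum sum_mono2 sum_nonneg) auto
      then show ?thesis using order_trans[OF dominated[OF True f]] True by simp
    next
      case False
      then show ?thesis using C by (auto intro!: mult_nonneg_nonneg sum_nonneg)
    qed
  qed (use assms(1) F in auto)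
qed

lemma seminorm_dominated_small:
  assumes "seminorm_dominated V P Q" and nonneg: "\<And>p f. p \<in> P \<Longrightarrow> f \<in> V \<Longrightarrow> 0 \<le> p f" and "0 < r"
  obtains F \<delta> where "finite F" "F \<subseteq> P" "0 < \<delta>"
    "\<forall>f\<in>V. (\<forall>p\<in>F. p f < \<delta>) \<longrightarrow> (\<forall>i. Q f i < r)"
proof -
  obtain F C where F: "finite F" "F \<subseteq> P" "0 \<le> C" "\<forall>f\<in>V. \<forall>i. Q f i \<le> C * (\<Sum>p\<in>F. \<bar>p f\<bar>)"
    by (rule seminorm_dominatedE[OF assms(1)])
  define \<delta> where "\<delta> = r / (1 + C * card F)"
  have \<delta>: "0 < \<delta>" "C * (card F * \<delta>) < r"
    using \<open>0 < r\<close> \<open>0 \<le> C\<close> by (auto simp: \<delta>_def field_simps add_pos_nonneg)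
  have "Q f i < r" if "f \<in> V" "\<forall>p\<in>F. p f < \<delta>" for f i
  proof -
    have "(\<Sum>p\<in>F. \<bar>p f\<bar>) \<le> card F * \<delta>"
      using that F(2) nonneg by (intro sum_bounded_above) (auto simp: subset_iff less_imp_le)
    then have "C * (\<Sum>p\<in>F. \<bar>p f\<bar>) < r"
      by (rule le_less_trans[OF mult_left_mono[OF _ F(3)] \<delta>(2)])
    then show ?thesis using F(4) that(1) le_less_trans by blast
  qed
  with F(1,2) \<delta>(1) show ?thesis by (intro that[of F \<delta>]) auto
qed

lemma continuous_map_seminorm_topology:
  assumes maps: "\<And>x. x \<in> V \<Longrightarrow> A x \<in> V'"
    and diff: "\<And>x y. x \<in> V \<Longrightarrow> y \<in> V \<Longrightarrow> y - x \<in> V"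
    and linear: "\<And>x y. x \<in> V \<Longrightarrow> y \<in> V \<Longrightarrow> A (y - x) = A y - A x"
    and nonneg: "\<And>p x. p \<in> P \<Longrightarrow> x \<in> V \<Longrightarrow> 0 \<le> p x"
    and dominated: "\<And>q. q \<in> P' \<Longrightarrow> seminorm_dominated V P (\<lambda>x (_::unit). q (A x))"
  shows "continuous_map (seminorm_topology V P) (seminorm_topology V' P') A"
  unfolding continuous_map topspace_seminorm_topology
proof (intro conjI allI impI)
  show "A ` V \<subseteq> V'" using maps by blast
  fix U assume U: "openin (seminorm_topology V' P') U"
  show "openin (seminorm_topology V P) {x \<in> V. A x \<in> U}"
    unfolding openin_seminorm_topology
  proof (intro conjI ballI)
    fix x assume "x \<in> {x \<in> V. A x \<in> U}"
    then have x: "x \<in> V" "A x \<in> U" by auto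
    obtain G r where "finite G" "G \<subseteq> P'" "0 < r" and G: "{y \<in> V'. \<forall>q\<in>G. q (y - A x) < r} \<subseteq> U"
      using bspec[OF conjunct2[OF U[unfolded openin_seminorm_topology]] x(2)] by (elim exE conjE)
    have "seminorm_dominated V P (\<lambda>x q. if q \<in> G then q (A x) else 0)"
      using \<open>finite G\<close> \<open>G \<subseteq> P'\<close> dominated by (intro seminorm_dominated_finite) auto
    then obtain F \<delta> where F: "finite F" "F \<subseteq> P" "0 < \<delta>"
      and small: "\<forall>z\<in>V. (\<forall>p\<in>F. p z < \<delta>) \<longrightarrow> (\<forall>q. (if q \<in> G then q (A z) else 0) < r)"
      by (rule seminorm_dominated_small[OF _ _ \<open>0 < r\<close>]) (rule nonneg)
    have "A y \<in> U" if y: "y \<in> V" "\<forall>p\<in>F. p (y - x) < \<delta>" for y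
    proof -
      have "q (A y - A x) < r" if "q \<in> G" for q
        using small[rule_format, OF diff[OF x(1) y(1)], of q] y(2) that linear[OF x(1) y(1)] by auto
      then show ?thesis using G maps[OF y(1)] by blast
    qed
    then show "\<exists>F r. finite F \<and> F \<subseteq> P \<and> 0 < r \<and>
        {y \<in> V. \<forall>p\<in>F. p (y - x) < r} \<subseteq> {x \<in> V. A x \<in> U}"
      using F by (intro exI[of _ F] exI[of _ \<delta>]) auto
  qed auto
qed

subsection \<open>Operators bounded in the Schwartz seminorms\<close>

abbreviation schwartz_dominated :: "((real^'n::finite \<Rightarrow> complex) \<Rightarrow> 'i \<Rightarrow> real) \<Rightarrow> bool" where
  "schwartz_dominated \<equiv> seminorm_dominated schwartz_even (range (\<lambda>(m, is). schwartz_seminorm m is))"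

definition schwartz_bounded :: "((real^'n::finite \<Rightarrow> complex) \<Rightarrow> real^'n \<Rightarrow> complex) \<Rightarrow> bool" where
  "schwartz_bounded A \<longleftrightarrow> (\<forall>f\<in>schwartz_even. smooth_fun (A f)) \<and>
     (\<forall>m is. schwartz_dominated (\<lambda>f x. bracket x ^ m * norm (partials is (A f) x)))"

lemma bracket_power_norm_le_schwartz_seminorm:
  assumes "f \<in> schwartz_even"
  shows "bracket x ^ m * norm (partials is f x) \<le> schwartz_seminorm m is f"
proof -
  obtain C where "\<And>x. norm (bracket x ^ m *\<^sub>R partials is f x) \<le> C"
    using assms unfolding schwartz_even_def bounded_iff by blast
  then have "bdd_above (range (\<lambda>x. bracket x ^ m * norm (partials is f x)))"
    by (intro bdd_aboveI2[of _ _ C]) simp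
  then show ?thesis
    unfolding schwartz_seminorm_def by (intro cSUP_upper) auto
qed

lemma schwartz_seminorm_nonneg: "f \<in> schwartz_even \<Longrightarrow> 0 \<le> schwartz_seminorm m is f"
  by (rule order_trans[OF _ bracket_power_norm_le_schwartz_seminorm]) auto

lemma schwartz_dominated_schwartz_seminorm: "schwartz_dominated (\<lambda>f x. schwartz_seminorm m is f)"
  by (rule seminorm_dominated_seminorm) auto

lemma schwartz_dominated_partials:
  "schwartz_dominated (\<lambda>f x. bracket x ^ m * norm (partials is f x))"
  by (rule seminorm_dominated_mono[OF schwartz_dominated_schwartz_seminorm
        bracket_power_norm_le_schwartz_seminorm])

lemma schwartz_bounded_partials: "schwartz_bounded (partials is)"
  by (auto simp: schwartz_bounded_def partials_append[symmetric]
      intro: schwartz_dominated_partials smooth_fun_partials schwartz_even_smooth)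

lemma schwartz_bounded_add:
  assumes A: "schwartz_bounded A" and B: "schwartz_bounded B"
  shows "schwartz_bounded (\<lambda>f x. A f x + B f x)"
  unfolding schwartz_bounded_def
proof (intro conjI ballI allI)
  fix m "is"
  have "schwartz_dominated (\<lambda>f x. bracket x ^ m * norm (partials is (A f) x) +
      bracket x ^ m * norm (partials is (B f) x))"
    using assms by (intro seminorm_dominated_add) (auto simp: schwartz_bounded_def)
  then show "schwartz_dominated (\<lambda>f x. bracket x ^ m * norm (partials is (\<lambda>x. A f x + B f x) x))"
  proof (rule seminorm_dominated_mono)
    fix f :: "real^'a \<Rightarrow> complex" and x assume "f \<in> schwartz_even"
    then have "partials is (\<lambda>x. A f x + B f x) x = partials is (A f) x + partials is (B f) x"
      using assms by (auto simp: partials_add schwartz_bounded_def)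
    then show "bracket x ^ m * norm (partials is (\<lambda>x. A f x + B f x) x) \<le>
        bracket x ^ m * norm (partials is (A f) x) + bracket x ^ m * norm (partials is (B f) x)"
      by (simp add: distrib_left[symmetric] mult_left_mono norm_triangle_ineq)
  qed
qed (use assms in \<open>auto simp: schwartz_bounded_def intro: smooth_fun_add\<close>)

lemma schwartz_bounded_cmult:
  assumes "schwartz_bounded A"
  shows "schwartz_bounded (\<lambda>f x. c * A f x)"
  unfolding schwartz_bounded_def
proof (intro conjI ballI allI)
  fix m "is"
  have "schwartz_dominated (\<lambda>f x. norm c * (bracket x ^ m * norm (partials is (A f) x)))"
    using assms by (intro seminorm_dominated_cmult) (auto simp: schwartz_bounded_def)
  then show "schwartz_dominated (\<lambda>f x. bracket x ^ m * norm (partials is (\<lambda>x. c * A f x) x))"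
    by (rule seminorm_dominated_mono)
      (use assms in \<open>auto simp: schwartz_bounded_def partials_cmult norm_mult\<close>)
qed (use assms in \<open>auto simp: schwartz_bounded_def intro: smooth_fun_cmult\<close>)

lemma schwartz_bounded_sum:
  assumes "\<And>i. i \<in> I \<Longrightarrow> schwartz_bounded (A i)"
  shows "schwartz_bounded (\<lambda>f x. \<Sum>i\<in>I. A i f x)"
proof -
  have "schwartz_bounded (\<lambda>f x. 0 * partials [] f x)"
    by (intro schwartz_bounded_cmult schwartz_bounded_partials)
  then have "schwartz_bounded (\<lambda>f x. 0)" by simp
  then show ?thesis
    using assms
    by (induction I rule: infinite_finite_induct) (auto intro: schwartz_bounded_add)
qed

lemma schwartz_bounded_symbols:
  assumes A: "schwartz_bounded A" and f: "f \<in> schwartz_even"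
  shows "A f \<in> symbols K"
proof (rule symbols_all_orders)
  fix m
  have "partials is (A f) \<in> growth (- real m)" for "is"
  proof -
    have "schwartz_dominated (\<lambda>f x. bracket x ^ m * norm (partials is (A f) x))"
      using A by (simp add: schwartz_bounded_def)
    from seminorm_dominated_bounded[OF this f]
    have "\<exists>C. \<forall>x. bracket x ^ m * norm (partials is (A f) x) \<le> C" .
    then show ?thesis by (auto simp: growth_uminus_of_nat_iff bounded_iff)
  qed
  then show "A f \<in> symbols (- real m)"
    using A f by (simp add: symbols_def schwartz_bounded_def)
qed

lemma schwartz_bounded_schwartz_even:
  assumes "schwartz_bounded A" "f \<in> schwartz_even" "even_fun (A f)"
  shows "A f \<in> schwartz_even"
  using assms by (simp add: schwartz_even_iff schwartz_bounded_symbols)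

lemma continuous_map_schwartz_topology:
  assumes bounded: "schwartz_bounded A"
    and maps: "\<And>f. f \<in> schwartz_even \<Longrightarrow> A f \<in> schwartz_even"
    and diff: "\<And>f g. f \<in> schwartz_even \<Longrightarrow> g \<in> schwartz_even \<Longrightarrow> A (g - f) = A g - A f"
  shows "continuous_map schwartz_topology schwartz_topology A"
  unfolding schwartz_topology_def
proof (rule continuous_map_seminorm_topology)
  show "g - f \<in> schwartz_even" if "f \<in> schwartz_even" "g \<in> schwartz_even"
    for f g :: "real^'a \<Rightarrow> complex"
    using schwartz_even_diff[OF that(2,1)] by (simp add: fun_diff_def)
  fix q :: "(real^'a \<Rightarrow> complex) \<Rightarrow> real" assume "q \<in> range (\<lambda>(m, is). schwartz_seminorm m is)"
  then obtain m "is" where q: "q = schwartz_seminorm m is" by auto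
  have "schwartz_dominated (\<lambda>f x. bracket x ^ m * norm (partials is (A f) x))"
    using bounded by (simp add: schwartz_bounded_def)
  then show "schwartz_dominated (\<lambda>f (_::unit). q (A f))"
    unfolding q schwartz_seminorm_def seminorm_dominated_def by (meson UNIV_not_empty cSUP_least)
qed (use maps diff schwartz_seminorm_nonneg in auto)

lemma tempered_even_dual_op:
  assumes T: "T \<in> tempered_even" and bounded: "schwartz_bounded A"
    and maps: "\<And>f. f \<in> schwartz_even \<Longrightarrow> A f \<in> schwartz_even"
    and linear: "\<And>f g a b. f \<in> schwartz_even \<Longrightarrow> g \<in> schwartz_even \<Longrightarrow>
      A (\<lambda>x. a * f x + b * g x) = (\<lambda>x. a * A f x + b * A g x)"
  shows "dual_op A T \<in> tempered_even"
  unfolding tempered_even_def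
proof (intro CollectI conjI ballI allI impI)
  fix f g :: "real^'a \<Rightarrow> complex" and c :: complex
  assume f: "f \<in> schwartz_even"
  show "dual_op A T (\<lambda>x. c * f x) = c * dual_op A T f"
    using T f linear[OF f f, of c 0] schwartz_even_cmult[OF f, of c] maps[OF f]
    by (simp add: dual_op_def tempered_even_def)
  assume g: "g \<in> schwartz_even"
  show "dual_op A T (\<lambda>x. f x + g x) = dual_op A T f + dual_op A T g"
    using T f g linear[OF f g, of 1 1] schwartz_even_add[OF f g] maps
    by (simp add: dual_op_def tempered_even_def)
next
  have "A (g - f) = A g - A f" if "f \<in> schwartz_even" "g \<in> schwartz_even" for f g
    using linear[OF that(2,1), of 1 "- 1"] by (simp add: fun_diff_def)
  then have "continuous_map schwartz_topology schwartz_topology A"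
    by (intro continuous_map_schwartz_topology bounded maps)
  moreover have "continuous_map schwartz_topology euclidean T"
    using T by (simp add: tempered_even_def)
  ultimately have "continuous_map schwartz_topology euclidean (T \<circ> A)"
    by (rule continuous_map_compose)
  then show "continuous_map schwartz_topology euclidean (dual_op A T)"
    by (rule continuous_map_eq) (simp add: dual_op_def schwartz_topology_def)
qed (simp add: dual_op_def)

subsection \<open>Division of an odd derivative by the coordinate\<close>

text \<open>For even \<open>f\<close>, the quotient \<open>q = \<partial>\<^sub>i f / x\<^sub>i\<close> is the average of \<open>\<partial>\<^sub>i\<^sup>2 f\<close> over the dilations
  \<open>x\<^sub>i \<mapsto> t x\<^sub>i\<close>. This shows smoothness but loses the decay in \<open>x\<^sub>i\<close>; for \<open>|x\<^sub>i| \<ge> 1\<close> the decay is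
  recovered by differentiating the identity \<open>x\<^sub>i q = \<partial>\<^sub>i f\<close>.\<close>

definition dilation_avg :: "'n::finite \<Rightarrow> nat \<Rightarrow> (real^'n \<Rightarrow> complex) \<Rightarrow> real^'n \<Rightarrow> complex" where
  "dilation_avg i c g x = (\<integral>t. t ^ c *\<^sub>R g (scale_coord i t x) \<partial>lebesgue_on {0..1})"

lemma integrable_dilation:
  assumes "smooth_fun g"
  shows "integrable (lebesgue_on {0..1}) (\<lambda>t. t ^ c *\<^sub>R g (scale_coord i t x))"
proof -
  have "continuous_on {0..1} (\<lambda>t. g (scale_coord i t x))"
    by (rule continuous_on_compose2[OF smooth_fun_continuous_on[OF assms]
          continuous_on_subset[OF continuous_on_scale_coord]]) auto
  then have "continuous_on {0..1} (\<lambda>t. t ^ c *\<^sub>R g (scale_coord i t x))"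
    by (intro continuous_intros)
  then show ?thesis by (rule continuous_imp_integrable_real)
qed

lemma norm_dilation_le:
  assumes "t \<in> {0..1}" "norm z \<le> C"
  shows "norm (t ^ c *\<^sub>R z) \<le> C"
proof -
  have "\<bar>t\<bar> ^ c * norm z \<le> 1 * C"
    using assms by (intro mult_mono power_le_one) auto
  then show ?thesis by (simp add: power_abs)
qed

lemma norm_dilation_avg_le:
  assumes "smooth_fun g" and bound: "\<And>t. t \<in> {0..1} \<Longrightarrow> norm (g (scale_coord i t x)) \<le> C"
  shows "norm (dilation_avg i c g x) \<le> C"
proof -
  have "norm (dilation_avg i c g x) \<le> (\<integral>t. C \<partial>lebesgue_on {0..1::real})"
    unfolding dilation_avg_def
  proof (rule order_trans[OF integral_norm_bound integral_mono])
    show "integrable (lebesgue_on {0..1}) (\<lambda>t. norm (t ^ c *\<^sub>R g (scale_coord i t x)))"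
      by (rule integrable_norm[OF integrable_dilation[OF assms(1)]])
    show "norm (t ^ c *\<^sub>R g (scale_coord i t x)) \<le> C" if "t \<in> space (lebesgue_on {0..1})" for t
      using that by (intro norm_dilation_le bound) auto
  qed auto
  then show ?thesis by (simp add: measure_restrict_space)
qed

lemma has_derivative_dilation_avg:
  assumes g: "g \<in> symbols 0"
  shows "(dilation_avg i c g has_derivative
    differential (\<lambda>j. dilation_avg i (if j = i then Suc c else c) (partial_deriv j g) x)) (at x)"
proof -
  have "\<exists>C. \<forall>x. norm (partial_deriv j g x) \<le> C" for j
    using symbols_growth[OF symbols_partial_deriv[OF g], of j]
    by (simp add: growth_0_iff_bounded bounded_iff)
  then obtain C where C: "\<And>j x. norm (partial_deriv j g x) \<le> C j" by metis
  show ?thesis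
    unfolding dilation_avg_def
  proof (rule has_derivative_integral_differential)
    fix t :: real and y j assume "t \<in> space (lebesgue_on {0..1})"
    then show "norm (t ^ (if j = i then Suc c else c) *\<^sub>R
        partial_deriv j g (scale_coord i t y)) \<le> C j"
      using C by (intro norm_dilation_le) auto
    have "((\<lambda>y. t ^ c *\<^sub>R g (scale_coord i t y)) has_derivative
        (\<lambda>h. t ^ c *\<^sub>R differential (\<lambda>j. (if j = i then t else 1) *\<^sub>R
          partial_deriv j g (scale_coord i t y)) h)) (at y)"
      by (intro has_derivative_scaleR_right has_derivative_comp_scale_coord
          symbols_differentiable[OF g])
    moreover have "t ^ c *\<^sub>R differential (\<lambda>j. (if j = i then t else 1) *\<^sub>R d j) h =
        differential (\<lambda>j. t ^ (if j = i then Suc c else c) *\<^sub>R d j) h" for d :: "'a \<Rightarrow> complex" and h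
      unfolding scaleR_sum_right by (rule sum.cong) (auto simp: mult_ac)
    ultimately show "((\<lambda>y. t ^ c *\<^sub>R g (scale_coord i t y)) has_derivative
        differential (\<lambda>j. t ^ (if j = i then Suc c else c) *\<^sub>R
          partial_deriv j g (scale_coord i t y))) (at y)"
      by simp
  qed (rule integrable_dilation smooth_fun_partial_deriv symbols_smooth[OF g] | simp)+
qed

lemma partial_deriv_dilation_avg:
  "g \<in> symbols 0 \<Longrightarrow> partial_deriv j (dilation_avg i c g) =
    dilation_avg i (if j = i then Suc c else c) (partial_deriv j g)"
  by (intro ext partial_deriv_eq_differentialI[OF has_derivative_dilation_avg])

lemma partials_dilation_avg:
  "\<exists>c'. \<forall>g\<in>symbols 0. partials is (dilation_avg i c g) = dilation_avg i c' (partials is g)"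
proof (induction "is")
  case Nil
  show ?case by (intro exI[of _ c]) simp
next
  case (Cons j "is")
  then obtain c' where
    "\<forall>g\<in>symbols 0. partials is (dilation_avg i c g) = dilation_avg i c' (partials is g)" by blast
  then show ?case
    by (intro exI[of _ "if j = i then Suc c' else c'"])
      (simp add: partial_deriv_dilation_avg symbols_partials)
qed

lemma smooth_fun_dilation_avg:
  assumes "g \<in> symbols 0"
  shows "smooth_fun (dilation_avg i c g)"
  unfolding smooth_fun_def
proof (intro allI)
  fix "is" and x :: "real^'a"
  obtain c' where "partials is (dilation_avg i c g) = dilation_avg i c' (partials is g)"
    using partials_dilation_avg assms by blast
  then show "partials is (dilation_avg i c g) differentiable (at x)"
    by (simp only: differentiableI[OF has_derivative_dilation_avg[OF symbols_partials[OF assms]]])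
qed

definition radial_quot :: "'n::finite \<Rightarrow> (real^'n \<Rightarrow> complex) \<Rightarrow> real^'n \<Rightarrow> complex" where
  "radial_quot i f x = (if x $ i = 0 then partial_deriv i (partial_deriv i f) x
     else partial_deriv i f x / of_real (x $ i))"

lemma coord_times_radial_quot:
  assumes "smooth_fun f" "even_fun f"
  shows "of_real (x $ i) * radial_quot i f x = partial_deriv i f x"
  using partial_deriv_even_eq_0[OF assms] by (simp add: radial_quot_def)

lemma radial_quot_eq_dilation_avg:
  assumes smooth: "smooth_fun f" and even: "even_fun f"
  shows "radial_quot i f = dilation_avg i 0 (partial_deriv i (partial_deriv i f))"
proof
  fix x
  let ?g = "partial_deriv i f"
  have smooth_g: "smooth_fun ?g" by (rule smooth_fun_partial_deriv[OF smooth])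
  show "radial_quot i f x = dilation_avg i 0 (partial_deriv i ?g) x"
  proof (cases "x $ i = 0")
    case True
    then show ?thesis
      by (simp add: radial_quot_def dilation_avg_def scale_coord_fixed measure_restrict_space)
  next
    case False
    have "((\<lambda>t. ?g (scale_coord i t x)) has_vector_derivative
        (x $ i) *\<^sub>R partial_deriv i ?g (scale_coord i t x)) (at t)" for t
    proof -
      have "((\<lambda>t. (t - 1) * x $ i) has_vector_derivative x $ i) (at t)"
        by (auto intro!: derivative_eq_intros
            simp: has_real_derivative_iff_has_vector_derivative[symmetric])
      from vector_diff_chain_at[OF this
          has_vector_derivative_axis_line[OF smooth_fun_differentiable[OF smooth_g]]]
      show ?thesis unfolding scale_coord_conv_axis_line o_def .
    qed
    then have "((\<lambda>t. (x $ i) *\<^sub>R partial_deriv i ?g (scale_coord i t x)) has_integral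
        ?g (scale_coord i 1 x) - ?g (scale_coord i 0 x)) {0..1}"
      by (rule fundamental_theorem_of_calculus[OF zero_le_one has_vector_derivative_at_within])
    from integral_unique[OF this]
    have "integral {0..1} (\<lambda>t. (x $ i) *\<^sub>R partial_deriv i ?g (scale_coord i t x)) = ?g x"
      using partial_deriv_even_eq_0[OF smooth even, of "scale_coord i 0 x" i] by simp
    moreover have "dilation_avg i 0 (partial_deriv i ?g) x =
        integral {0..1} (\<lambda>t. t ^ 0 *\<^sub>R partial_deriv i ?g (scale_coord i t x))"
      unfolding dilation_avg_def
      by (intro lebesgue_integral_eq_integral integrable_dilation smooth_fun_partial_deriv smooth)
        simp
    ultimately have "(x $ i) *\<^sub>R dilation_avg i 0 (partial_deriv i ?g) x = ?g x"
      by simp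
    then show ?thesis using False by (simp add: radial_quot_def scaleR_conv_of_real field_simps)
  qed
qed

lemma smooth_fun_radial_quot:
  assumes "f \<in> schwartz_even"
  shows "smooth_fun (radial_quot i f)"
  unfolding
    radial_quot_eq_dilation_avg[OF schwartz_even_smooth[OF assms] schwartz_even_even[OF assms]]
  by (intro smooth_fun_dilation_avg symbols_partial_deriv schwartz_even_symbols assms)

fun deletions :: "'a \<Rightarrow> 'a list \<Rightarrow> 'a list list" where
  "deletions i [] = []"
| "deletions i (j # is) = (if j = i then [is] else []) @ map ((#) j) (deletions i is)"

lemma length_deletions: "l \<in> set (deletions i is) \<Longrightarrow> length l < length is"
  by (induction "is" arbitrary: l) (auto split: if_splits)

lemma partial_deriv_sum_list:
  assumes "\<And>l. l \<in> set ls \<Longrightarrow> smooth_fun (f l)"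
  shows "smooth_fun (\<lambda>x. \<Sum>l\<leftarrow>ls. f l x) \<and>
    partial_deriv j (\<lambda>x. \<Sum>l\<leftarrow>ls. f l x) = (\<lambda>x. \<Sum>l\<leftarrow>ls. partial_deriv j (f l) x)"
  using assms
proof (induction ls)
  case Nil
  show ?case using symbols_smooth[OF symbols_const[of 0 0]] by simp
next
  case (Cons l ls)
  then show ?case
    by (auto intro!: smooth_fun_add ext simp: partial_deriv_add smooth_fun_differentiable)
qed

lemma norm_sum_list_le: "norm (\<Sum>l\<leftarrow>ls. f l) \<le> (\<Sum>l\<leftarrow>ls. norm (f l))"
  for f :: "'a \<Rightarrow> 'b::real_normed_vector"
  by (induction ls) (auto intro: order_trans[OF norm_triangle_ineq])

lemma coord_times_partials:
  assumes q: "smooth_fun q" and g: "smooth_fun g" and eq: "\<And>x. of_real (x $ i) * q x = g x"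
  shows "of_real (x $ i) * partials is q x =
    partials is g x - (\<Sum>l\<leftarrow>deletions i is. partials l q x)"
proof (induction "is" arbitrary: x)
  case Nil
  show ?case by (simp add: eq)
next
  case (Cons j "is")
  let ?S = "\<lambda>x. \<Sum>l\<leftarrow>deletions i is. partials l q x"
  have S: "smooth_fun ?S" "partial_deriv j ?S = (\<lambda>x. \<Sum>l\<leftarrow>deletions i is. partials (j # l) q x)"
    using partial_deriv_sum_list[of "deletions i is" "\<lambda>l. partials l q" j] smooth_fun_partials[OF q]
    by auto
  have "(\<lambda>x. of_real (x $ i) * partials is q x) = (\<lambda>x. partials is g x - ?S x)"
    using Cons by blast
  then have "partial_deriv j (\<lambda>x. of_real (x $ i) * partials is q x) x =
      partial_deriv j (\<lambda>x. partials is g x - ?S x) x"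
    by simp
  moreover have "partial_deriv j (\<lambda>x. of_real (x $ i) * partials is q x) x =
      (if i = j then 1 else 0) * partials is q x +
      of_real (x $ i) * partial_deriv j (partials is q) x"
    by (simp add: partial_deriv_mult[OF differentiable_coord] partial_deriv_coord
        smooth_fun_differentiable smooth_fun_partials q)
  moreover have "partial_deriv j (\<lambda>x. partials is g x - ?S x) x =
      partial_deriv j (partials is g) x - (\<Sum>l\<leftarrow>deletions i is. partials (j # l) q x)"
    using S by (simp add: partial_deriv_diff smooth_fun_differentiable smooth_fun_partials g)
  ultimately show ?case
    by (auto simp: o_def algebra_simps)
qed

lemma bracket_le_scale_coord:
  assumes "\<bar>x $ i\<bar> \<le> 1"
  shows "bracket x \<le> 2 * bracket (scale_coord i t x)"
proof -
  have "(norm x)\<^sup>2 \<le> (\<Sum>j\<in>UNIV. (scale_coord i t x $ j)\<^sup>2 + (if j = i then 1 else 0))"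
    unfolding norm_power2_eq_sum
    using assms by (intro sum_mono) (auto simp: abs_square_le_1 add_increasing)
  then have "(norm x)\<^sup>2 \<le> (norm (scale_coord i t x))\<^sup>2 + 1"
    by (simp add: sum.distrib norm_power2_eq_sum)
  then show ?thesis
    using zero_le_power2[of "norm (scale_coord i t x)"] by (smt (verit))
qed

lemma norm_partials_radial_quot_near:
  assumes f: "f \<in> schwartz_even" and x: "\<bar>x $ i\<bar> \<le> 1"
  shows "bracket x ^ m * norm (partials is (radial_quot i f) x) \<le>
    2 ^ m * schwartz_seminorm m (is @ [i, i]) f"
proof -
  let ?g = "partial_deriv i (partial_deriv i f)" and ?C = "schwartz_seminorm m (is @ [i, i]) f"
  have g: "?g \<in> symbols 0" by (intro symbols_partial_deriv schwartz_even_symbols f)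
  obtain c where c: "partials is (dilation_avg i 0 ?g) = dilation_avg i c (partials is ?g)"
    using partials_dilation_avg g by blast
  have "norm (dilation_avg i c (partials is ?g) x) \<le> 2 ^ m * ?C / bracket x ^ m"
  proof (rule norm_dilation_avg_le)
    show "smooth_fun (partials is ?g)" by (intro smooth_fun_partials symbols_smooth[OF g])
    fix t :: real
    let ?y = "scale_coord i t x"
    have "bracket x ^ m * norm (partials is ?g ?y) \<le>
        (2 * bracket ?y) ^ m * norm (partials is ?g ?y)"
      by (intro mult_right_mono power_mono bracket_le_scale_coord x) auto
    also have "\<dots> = 2 ^ m * (bracket ?y ^ m * norm (partials (is @ [i, i]) f ?y))"
      by (simp only: power_mult_distrib partials_append partials_Cons partials_Nil mult.assoc)
    also have "\<dots> \<le> 2 ^ m * ?C"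
      by (intro mult_left_mono bracket_power_norm_le_schwartz_seminorm f) auto
    finally show "norm (partials is ?g ?y) \<le> 2 ^ m * ?C / bracket x ^ m"
      by (subst pos_le_divide_eq) (auto simp: mult.commute)
  qed
  then show ?thesis
    unfolding radial_quot_eq_dilation_avg[OF schwartz_even_smooth[OF f] schwartz_even_even[OF f]] c
    by (subst (asm) pos_le_divide_eq) (auto simp: mult.commute)
qed

lemma norm_partials_radial_quot_far:
  assumes f: "f \<in> schwartz_even" and x: "1 \<le> \<bar>x $ i\<bar>"
  shows "norm (partials is (radial_quot i f) x) \<le>
    norm (partials (is @ [i]) f x) + (\<Sum>l\<leftarrow>deletions i is. norm (partials l (radial_quot i f) x))"
proof -
  let ?q = "radial_quot i f"
  have smooth: "smooth_fun f" by (rule schwartz_even_smooth[OF f])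
  have "1 * norm (partials is ?q x) \<le> \<bar>x $ i\<bar> * norm (partials is ?q x)"
    using x by (intro mult_right_mono) auto
  then have "norm (partials is ?q x) \<le> norm (of_real (x $ i) * partials is ?q x)"
    by (simp add: norm_mult)
  also have "of_real (x $ i) * partials is ?q x =
      partials (is @ [i]) f x - (\<Sum>l\<leftarrow>deletions i is. partials l ?q x)"
    using coord_times_partials[OF smooth_fun_radial_quot[OF f] smooth_fun_partial_deriv[OF smooth]
        coord_times_radial_quot[OF smooth schwartz_even_even[OF f]]]
    by (simp add: partials_append)
  also have "norm \<dots> \<le> norm (partials (is @ [i]) f x) +
      (\<Sum>l\<leftarrow>deletions i is. norm (partials l ?q x))"
    by (intro order_trans[OF norm_triangle_ineq4] add_left_mono norm_sum_list_le)
  finally show ?thesis .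
qed

lemma schwartz_bounded_radial_quot: "schwartz_bounded (radial_quot i)"
  unfolding schwartz_bounded_def
proof (intro conjI ballI allI)
  fix m "is"
  show "schwartz_dominated (\<lambda>f x. bracket x ^ m * norm (partials is (radial_quot i f) x))"
  proof (induction "length is" arbitrary: "is" rule: less_induct)
    case less
    let ?near = "\<lambda>f x. 2 ^ m * schwartz_seminorm m (is @ [i, i]) f"
    let ?far = "\<lambda>f x. bracket x ^ m * norm (partials (is @ [i]) f x) +
      (\<Sum>l\<leftarrow>deletions i is. bracket x ^ m * norm (partials l (radial_quot i f) x))"
    have "schwartz_dominated (\<lambda>f x. ?near f x + ?far f x)"
      using less length_deletions[of _ i "is"]
      by (intro seminorm_dominated_add seminorm_dominated_cmult seminorm_dominated_sum_list
          schwartz_dominated_schwartz_seminorm schwartz_dominated_partials) auto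
    then show ?case
    proof (rule seminorm_dominated_mono)
      fix f :: "real^'a \<Rightarrow> complex" and x assume f: "f \<in> schwartz_even"
      have "0 \<le> ?near f x" by (simp add: schwartz_seminorm_nonneg[OF f])
      moreover have "0 \<le> ?far f x" by (intro add_nonneg_nonneg sum_list_nonneg) auto
      moreover have "bracket x ^ m * norm (partials is (radial_quot i f) x) \<le> ?far f x"
        if "1 \<le> \<bar>x $ i\<bar>"
        using mult_left_mono[OF norm_partials_radial_quot_far[OF f that, of "is"],
            of "bracket x ^ m"]
        by (simp add: distrib_left sum_list_const_mult)
      ultimately show "bracket x ^ m * norm (partials is (radial_quot i f) x) \<le>
          ?near f x + ?far f x"
        using norm_partials_radial_quot_near[OF f, of x i m "is"]
        by (cases "\<bar>x $ i\<bar> \<le> 1") auto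
    qed
  qed
qed (rule smooth_fun_radial_quot)

lemma even_fun_radial_quot:
  assumes "smooth_fun f" "even_fun f"
  shows "even_fun (radial_quot i f)"
  using even_fun_partial_deriv_partial_deriv[OF assms]
    partial_deriv_even_scale_coord_minus_one[OF assms]
  by (simp add: even_fun_iff_scale_coord radial_quot_def)

subsection \<open>The operator on even Schwartz functions\<close>

definition axial_laplace :: "real^'n::finite \<Rightarrow> 'n \<Rightarrow> (real^'n \<Rightarrow> complex) \<Rightarrow> real^'n \<Rightarrow> complex" where
  "axial_laplace \<alpha> i f x =
     partial_deriv i (partial_deriv i f) x + of_real (2 * \<alpha> $ i + 1) * radial_quot i f x"

lemma laplace_eq_sum_axial: "laplace \<alpha> f = (\<lambda>x. \<Sum>i\<in>UNIV. axial_laplace \<alpha> i f x)"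
  by (simp add: laplace_def axial_laplace_def radial_quot_def fun_eq_iff)

lemma schwartz_bounded_axial_laplace: "schwartz_bounded (axial_laplace \<alpha> i)"
proof -
  have "schwartz_bounded (\<lambda>f x. partials [i, i] f x + of_real (2 * \<alpha> $ i + 1) * radial_quot i f x)"
    by (intro schwartz_bounded_add schwartz_bounded_cmult schwartz_bounded_partials
        schwartz_bounded_radial_quot)
  then show ?thesis by (simp add: axial_laplace_def[abs_def])
qed

lemma schwartz_even_axial_laplace:
  assumes "f \<in> schwartz_even"
  shows "axial_laplace \<alpha> i f \<in> schwartz_even"
proof (rule schwartz_bounded_schwartz_even[OF schwartz_bounded_axial_laplace assms])
  have "smooth_fun f" "even_fun f" using assms by (auto simp: schwartz_even_def)
  then show "even_fun (axial_laplace \<alpha> i f)"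
    using even_fun_radial_quot[of f i] even_fun_partial_deriv_partial_deriv[of f i]
    by (simp add: even_fun_def axial_laplace_def)
qed

lemma schwartz_bounded_laplace: "schwartz_bounded (laplace \<alpha>)"
  unfolding laplace_eq_sum_axial[abs_def]
  by (intro schwartz_bounded_sum schwartz_bounded_axial_laplace)

lemma schwartz_even_laplace:
  assumes "f \<in> schwartz_even"
  shows "laplace \<alpha> f \<in> schwartz_even"
proof (rule schwartz_bounded_schwartz_even[OF schwartz_bounded_laplace assms])
  have "even_fun (axial_laplace \<alpha> i f)" for i
    using schwartz_even_axial_laplace[OF assms] by (rule schwartz_even_even)
  then show "even_fun (laplace \<alpha> f)"
    by (simp add: laplace_eq_sum_axial even_fun_def)
qed

lemma laplace_linear:
  assumes "smooth_fun f" "smooth_fun g"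
  shows "laplace \<alpha> (\<lambda>x. a * f x + b * g x) = (\<lambda>x. a * laplace \<alpha> f x + b * laplace \<alpha> g x)"
proof -
  have "partials is (\<lambda>x. a * f x + b * g x) =
      (\<lambda>x. a * partials is f x + b * partials is g x)" for "is"
    by (simp add: partials_add partials_cmult smooth_fun_cmult assms)
  from this[of "[i]" for i] this[of "[i, i]" for i]
  have "axial_laplace \<alpha> i (\<lambda>x. a * f x + b * g x) x =
      a * axial_laplace \<alpha> i f x + b * axial_laplace \<alpha> i g x" for i x
    by (simp add: axial_laplace_def radial_quot_def algebra_simps add_divide_distrib)
  then show ?thesis
    by (simp add: laplace_eq_sum_axial sum_distrib_left sum.distrib)
qed

lemma tempered_even_laplace_dist: "T \<in> tempered_even \<Longrightarrow> laplace_dist \<alpha> T \<in> tempered_even"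
  unfolding laplace_dist_def
  by (intro tempered_even_dual_op schwartz_bounded_laplace schwartz_even_laplace laplace_linear
      schwartz_even_smooth)

subsection \<open>The Fourier-Bessel kernel\<close>

lemma bessel_equation_scaled:
  assumes "- 1 < \<gamma>"
  shows "y\<^sup>2 * bessel_deriv 2 \<gamma> (s * y) + (2 * \<gamma> + 1) *
      (if s = 0 then y\<^sup>2 * bessel_deriv 2 \<gamma> (s * y) else y * bessel_deriv 1 \<gamma> (s * y) / s)
    = - (y\<^sup>2 * bessel_j \<gamma> (s * y))"
proof (cases "s = 0")
  case True
  have "y\<^sup>2 * (bessel_deriv 2 \<gamma> 0 + (2 * \<gamma> + 1) * bessel_deriv 2 \<gamma> 0) = y\<^sup>2 * - bessel_j \<gamma> 0"
    unfolding bessel_equation_0[OF assms] ..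
  then show ?thesis using True by (simp add: algebra_simps del: bessel_deriv.simps)
next
  case False
  show ?thesis
  proof (cases "y = 0")
    case nonzero: False
    then have "s * y \<noteq> 0" using False by simp
    have "y\<^sup>2 * bessel_deriv 2 \<gamma> (s * y) + (2 * \<gamma> + 1) * (y * bessel_deriv 1 \<gamma> (s * y) / s) =
        y\<^sup>2 * (bessel_deriv 2 \<gamma> (s * y) + (2 * \<gamma> + 1) / (s * y) * bessel_deriv 1 \<gamma> (s * y))"
      using nonzero by (simp add: distrib_left power2_eq_square del: bessel_deriv.simps)
    also have "\<dots> = - (y\<^sup>2 * bessel_j \<gamma> (s * y))"
      unfolding bessel_equation[OF assms \<open>s * y \<noteq> 0\<close>] by simp
    finally show ?thesis using False by simp
  qed simp
qed

context poly_axial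
begin

abbreviation incr_at :: "'a \<Rightarrow> ('a \<Rightarrow> nat) \<Rightarrow> 'a \<Rightarrow> nat" where
  "incr_at i m \<equiv> m(i := Suc (m i))"

text \<open>\<open>m i\<close> counts the derivatives in \<open>\<xi>\<^sub>i\<close>.\<close>

definition bessel_kernel_deriv :: "('n \<Rightarrow> nat) \<Rightarrow> real^'n \<Rightarrow> real^'n \<Rightarrow> complex" where
  "bessel_kernel_deriv m \<xi> x =
     of_real (\<Prod>i\<in>UNIV. (x $ i) ^ m i * bessel_deriv (m i) (\<alpha> $ i) (\<xi> $ i * x $ i))"

abbreviation bessel_kernel :: "real^'n \<Rightarrow> real^'n \<Rightarrow> complex" where
  "bessel_kernel \<equiv> bessel_kernel_deriv (\<lambda>_. 0)"

lemma order_gt_minus_1: "- 1 < \<alpha> $ i"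
  using order_gt[of i] by simp

lemma bessel_kernel_commute: "bessel_kernel \<xi> x = bessel_kernel x \<xi>"
  by (simp add: bessel_kernel_deriv_def mult.commute)

lemma has_derivative_bessel_kernel_deriv:
  "((\<lambda>\<xi>. bessel_kernel_deriv m \<xi> x) has_derivative
    differential (\<lambda>i. bessel_kernel_deriv (incr_at i m) \<xi> x)) (at \<xi>)"
proof -
  let ?f = "\<lambda>i \<xi>. (x $ i) ^ m i * bessel_deriv (m i) (\<alpha> $ i) (\<xi> $ i * x $ i)"
  let ?d = "\<lambda>i. (x $ i) ^ Suc (m i) * bessel_deriv (Suc (m i)) (\<alpha> $ i) (\<xi> $ i * x $ i)"
  have factor: "(?f i has_derivative (\<lambda>h. (h $ i) * ?d i)) (at \<xi>)" for i
  proof -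
    have "((\<lambda>\<xi>. \<xi> $ i * x $ i) has_derivative (\<lambda>h. h $ i * x $ i)) (at \<xi>)"
      by (intro has_derivative_mult_left bounded_linear.has_derivative[OF bounded_linear_vec_nth]
          has_derivative_ident)
    moreover have "(bessel_deriv (m i) (\<alpha> $ i) has_derivative
        (\<lambda>h. bessel_deriv (Suc (m i)) (\<alpha> $ i) (\<xi> $ i * x $ i) * h)) (at (\<xi> $ i * x $ i))"
      using has_real_derivative_bessel_deriv[OF order_gt_minus_1]
      unfolding has_field_derivative_def by blast
    ultimately have "(?f i has_derivative (\<lambda>h. (x $ i) ^ m i *
        (bessel_deriv (Suc (m i)) (\<alpha> $ i) (\<xi> $ i * x $ i) * (h $ i * x $ i)))) (at \<xi>)"
      by (rule has_derivative_mult_right[OF has_derivative_compose])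
    then show ?thesis by (simp add: mult_ac)
  qed
  have "((\<lambda>\<xi>. bessel_kernel_deriv m \<xi> x) has_derivative
     (\<lambda>h. of_real (\<Sum>i\<in>UNIV. (h $ i * ?d i) * (\<Prod>j\<in>UNIV - {i}. ?f j \<xi>)))) (at \<xi>)"
    unfolding bessel_kernel_deriv_def by (intro has_derivative_of_real has_derivative_prod factor)
  moreover have "of_real ((h $ i * ?d i) * (\<Prod>j\<in>UNIV - {i}. ?f j \<xi>)) =
      (h $ i) *\<^sub>R bessel_kernel_deriv (incr_at i m) \<xi> x" for h i
    unfolding bessel_kernel_deriv_def prod.remove[OF finite_class.finite_UNIV UNIV_I, of _ i]
    by (simp add: scaleR_conv_of_real)
  ultimately show ?thesis by (simp only: of_real_sum)
qed

lemma partial_deriv_bessel_kernel_deriv: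
  "partial_deriv i (\<lambda>\<xi>. bessel_kernel_deriv m \<xi> x) = (\<lambda>\<xi>. bessel_kernel_deriv (incr_at i m) \<xi> x)"
  by (intro ext partial_deriv_eq_differentialI[OF has_derivative_bessel_kernel_deriv])

lemma norm_bessel_kernel_deriv_le:
  obtains C K where "0 \<le> C" "\<forall>\<xi> x. norm (bessel_kernel_deriv m \<xi> x) \<le> C * bracket x powr K"
proof -
  have "\<exists>B. \<forall>t. \<bar>bessel_deriv (m i) (\<alpha> $ i) t\<bar> \<le> B" for i
    using bounded_bessel_deriv[of "\<alpha> $ i" "m i"] order_gt[of i]
    by (auto simp: bounded_iff less_imp_le)
  then obtain B where B: "\<And>i t. \<bar>bessel_deriv (m i) (\<alpha> $ i) t\<bar> \<le> B i" by metis
  define K where "K = (\<Sum>i\<in>UNIV. real (m i) * (1 / 2))"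
  have "(\<lambda>x::real^'n. \<Prod>i\<in>UNIV. (x $ i) ^ m i) \<in> growth K"
    unfolding K_def by (intro growth_prod growth_power growth_coord)
  then obtain C where C: "0 \<le> C" "\<And>x::real^'n. norm (\<Prod>i\<in>UNIV. (x $ i) ^ m i) \<le> C * bracket x powr K"
    using growthE by blast
  have B_nonneg: "0 \<le> (\<Prod>i\<in>UNIV. B i)"
    using B abs_ge_zero order_trans by (intro prod_nonneg) blast
  have "norm (bessel_kernel_deriv m \<xi> x) \<le> (C * (\<Prod>i\<in>UNIV. B i)) * bracket x powr K" for \<xi> x
  proof -
    have "norm (bessel_kernel_deriv m \<xi> x) = norm (\<Prod>i\<in>UNIV. (x $ i) ^ m i) *
        (\<Prod>i\<in>UNIV. \<bar>bessel_deriv (m i) (\<alpha> $ i) (\<xi> $ i * x $ i)\<bar>)"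
      by (simp only: bessel_kernel_deriv_def norm_of_real prod.distrib abs_mult abs_prod
          real_norm_def)
    also have "\<dots> \<le> (C * bracket x powr K) * (\<Prod>i\<in>UNIV. B i)"
      using C B by (intro mult_mono prod_mono) (auto intro: prod_nonneg)
    finally show ?thesis by (simp add: mult_ac)
  qed
  with C(1) B_nonneg show ?thesis by (intro that[of "C * (\<Prod>i\<in>UNIV. B i)" K]) auto
qed

lemma borel_measurable_bessel_kernel_deriv [measurable]:
  "bessel_kernel_deriv m \<xi> \<in> borel_measurable borel"
proof -
  have [measurable]: "bessel_deriv k (\<alpha> $ i) \<in> borel_measurable borel" for k i
    by (rule bessel_deriv_borel_measurable[OF order_gt_minus_1])
  show ?thesis unfolding bessel_kernel_deriv_def[abs_def] by measurable
qed

lemma symbols_bessel_kernel: "(\<lambda>\<xi>. bessel_kernel \<xi> x) \<in> symbols 0"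
proof (rule symbols_coinduct[of _ "range (\<lambda>m \<xi>. bessel_kernel_deriv m \<xi> x)"])
  fix h assume "h \<in> range (\<lambda>m \<xi>. bessel_kernel_deriv m \<xi> x)"
  then obtain m where h: "h = (\<lambda>\<xi>. bessel_kernel_deriv m \<xi> x)" by blast
  show "h differentiable (at \<xi>)" for \<xi>
    unfolding h by (rule differentiableI[OF has_derivative_bessel_kernel_deriv])
  show "partial_deriv i h \<in> additive_closure (range (\<lambda>m \<xi>. bessel_kernel_deriv m \<xi> x))" for i
    unfolding h partial_deriv_bessel_kernel_deriv by (intro additive_closure.incl rangeI)
  obtain C K where "\<forall>\<xi> x. norm (bessel_kernel_deriv m \<xi> x) \<le> C * bracket x powr K"
    using norm_bessel_kernel_deriv_le[of m] by metis
  then show "h \<in> growth 0"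
    unfolding h by (intro growthI[of _ "C * bracket x powr K"]) simp
qed blast

lemma even_fun_bessel_kernel: "even_fun (\<lambda>\<xi>. bessel_kernel \<xi> x)"
proof -
  have "bessel_j (\<alpha> $ j) (scale_coord i (- 1) \<xi> $ j * x $ j) = bessel_j (\<alpha> $ j) (\<xi> $ j * x $ j)"
    for i j \<xi>
    by (cases "j = i") auto
  then show ?thesis by (simp add: even_fun_iff_scale_coord bessel_kernel_deriv_def)
qed

lemma axial_laplace_bessel_kernel:
  "axial_laplace \<alpha> i (\<lambda>\<xi>. bessel_kernel \<xi> x) = (\<lambda>\<xi>. - of_real ((x $ i)\<^sup>2) * bessel_kernel \<xi> x)"
proof
  fix \<xi> :: "real^'n"
  define R where "R = (\<Prod>j\<in>UNIV - {i}. bessel_j (\<alpha> $ j) (\<xi> $ j * x $ j))"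
  have kernel: "bessel_kernel_deriv ((\<lambda>_. 0)(i := k)) \<xi> x =
      of_real ((x $ i) ^ k * bessel_deriv k (\<alpha> $ i) (\<xi> $ i * x $ i) * R)" for k
    unfolding bessel_kernel_deriv_def R_def
      prod.remove[OF finite_class.finite_UNIV UNIV_I, of _ i]
    by simp
  let ?L = "(x $ i)\<^sup>2 * bessel_deriv 2 (\<alpha> $ i) (\<xi> $ i * x $ i) + (2 * \<alpha> $ i + 1) *
      (if \<xi> $ i = 0 then (x $ i)\<^sup>2 * bessel_deriv 2 (\<alpha> $ i) (\<xi> $ i * x $ i)
       else x $ i * bessel_deriv 1 (\<alpha> $ i) (\<xi> $ i * x $ i) / \<xi> $ i)"
  have "axial_laplace \<alpha> i (\<lambda>\<xi>. bessel_kernel \<xi> x) \<xi> = of_real (?L * R)"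
    unfolding axial_laplace_def radial_quot_def partial_deriv_bessel_kernel_deriv
    using kernel[of 1] kernel[of 2]
    by (simp add: numeral_2_eq_2 algebra_simps del: bessel_deriv.simps)
  also have "?L = - ((x $ i)\<^sup>2 * bessel_j (\<alpha> $ i) (\<xi> $ i * x $ i))"
    by (rule bessel_equation_scaled[OF order_gt_minus_1])
  also have "complex_of_real (\<dots> * R) = - of_real ((x $ i)\<^sup>2) * bessel_kernel \<xi> x"
    using kernel[of 0] by (simp add: fun_upd_idem)
  finally show "axial_laplace \<alpha> i (\<lambda>\<xi>. bessel_kernel \<xi> x) \<xi> =
      - of_real ((x $ i)\<^sup>2) * bessel_kernel \<xi> x" .
qed

subsection \<open>The operator under the Fourier-Bessel integral\<close>

lemma integrable_mu_schwartz_mult: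
  fixes g :: "real^'n \<Rightarrow> complex"
  assumes f: "f \<in> schwartz_even" and g: "g \<in> borel_measurable borel" "g \<in> growth K"
  shows "integrable (mu \<alpha>) (\<lambda>x. f x * g x)"
proof (rule integrable_mu_growth)
  show "(\<lambda>x. f x * g x) \<in> borel_measurable borel"
    by (intro borel_measurable_times schwartz_even_borel_measurable[OF f] g(1))
  show "(\<lambda>x. f x * g x) \<in> growth (integrable_order \<alpha>)"
    using growth_mult[OF symbols_growth[OF schwartz_even_symbols[OF f]] g(2),
        of "integrable_order \<alpha> - K"]
    by simp
qed

lemma integrable_mu_norm_schwartz_mult:
  assumes f: "f \<in> schwartz_even"
  shows "integrable (mu \<alpha>) (\<lambda>x. norm (f x) * (C * bracket x powr K))"
proof -
  have "(\<lambda>x::real^'n. complex_of_real (bracket x powr K)) \<in> borel_measurable borel"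
    by (intro smooth_fun_borel_measurable symbols_smooth[OF symbols_bracket_powr])
  from integrable_norm[OF integrable_mu_schwartz_mult[OF f this growth_bracket_powr]]
  have "integrable (mu \<alpha>) (\<lambda>x. C * (norm (f x) * bracket x powr K))"
    by (simp add: norm_mult)
  then show ?thesis by (simp only: mult.left_commute)
qed

definition fourier_bessel_deriv :: "('n \<Rightarrow> nat) \<Rightarrow> (real^'n \<Rightarrow> complex) \<Rightarrow> real^'n \<Rightarrow> complex" where
  "fourier_bessel_deriv m f \<xi> = (\<integral>x. f x * bessel_kernel_deriv m \<xi> x \<partial>mu \<alpha>)"

lemma fourier_bessel_eq_deriv_0: "fourier_bessel \<alpha> f = fourier_bessel_deriv (\<lambda>_. 0) f"
  by (simp add: fun_eq_iff fourier_bessel_def fourier_bessel_deriv_def bessel_kernel_deriv_def)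

lemma growth_bessel_kernel_deriv:
  obtains K where "\<And>\<xi>. bessel_kernel_deriv m \<xi> \<in> growth K"
  using norm_bessel_kernel_deriv_le[of m] by (metis growthI)

lemma integrable_mu_bessel_kernel_deriv:
  assumes "f \<in> schwartz_even"
  shows "integrable (mu \<alpha>) (\<lambda>x. f x * bessel_kernel_deriv m \<xi> x)"
proof -
  obtain K where "bessel_kernel_deriv m \<xi> \<in> growth K" using growth_bessel_kernel_deriv by blast
  then show ?thesis
    by (rule integrable_mu_schwartz_mult[OF assms borel_measurable_bessel_kernel_deriv])
qed

lemma has_derivative_fourier_bessel_deriv:
  assumes f: "f \<in> schwartz_even"
  shows "(fourier_bessel_deriv m f has_derivative
    differential (\<lambda>i. fourier_bessel_deriv (incr_at i m) f \<xi>)) (at \<xi>)"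
proof -
  have "\<exists>C K. \<forall>\<xi> x. norm (bessel_kernel_deriv (incr_at i m) \<xi> x) \<le> C * bracket x powr K" for i
    using norm_bessel_kernel_deriv_le by metis
  then obtain C K where
    CK: "\<And>i \<xi> x. norm (bessel_kernel_deriv (incr_at i m) \<xi> x) \<le> C i * bracket x powr K i"
    by metis
  show ?thesis
    unfolding fourier_bessel_deriv_def
  proof (rule has_derivative_integral_differential)
    fix \<xi> x :: "real^'n" and i
    have "((\<lambda>\<xi>. f x * bessel_kernel_deriv m \<xi> x) has_derivative
        (\<lambda>h. f x * differential (\<lambda>i. bessel_kernel_deriv (incr_at i m) \<xi> x) h)) (at \<xi>)"
      by (intro has_derivative_mult_right has_derivative_bessel_kernel_deriv)
    then show "((\<lambda>\<xi>. f x * bessel_kernel_deriv m \<xi> x) has_derivative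
        differential (\<lambda>i. f x * bessel_kernel_deriv (incr_at i m) \<xi> x)) (at \<xi>)"
      by (simp add: sum_distrib_left)
    show "norm (f x * bessel_kernel_deriv (incr_at i m) \<xi> x) \<le>
        norm (f x) * (C i * bracket x powr K i)"
      unfolding norm_mult by (intro mult_left_mono CK) simp
  qed (intro integrable_mu_bessel_kernel_deriv integrable_mu_norm_schwartz_mult f)+
qed

lemma partial_deriv_fourier_bessel_deriv:
  "f \<in> schwartz_even \<Longrightarrow>
    partial_deriv i (fourier_bessel_deriv m f) = fourier_bessel_deriv (incr_at i m) f"
  by (intro ext partial_deriv_eq_differentialI[OF has_derivative_fourier_bessel_deriv])

lemma symbols_0_fourier_bessel:
  assumes f: "f \<in> schwartz_even"
  shows "fourier_bessel \<alpha> f \<in> symbols 0"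
  unfolding fourier_bessel_eq_deriv_0
proof (rule symbols_coinduct[of _ "range (\<lambda>m. fourier_bessel_deriv m f)"])
  fix h assume "h \<in> range (\<lambda>m. fourier_bessel_deriv m f)"
  then obtain m where h: "h = fourier_bessel_deriv m f" by blast
  show "h differentiable (at \<xi>)" for \<xi>
    unfolding h by (rule differentiableI[OF has_derivative_fourier_bessel_deriv[OF f]])
  show "partial_deriv i h \<in> additive_closure (range (\<lambda>m. fourier_bessel_deriv m f))" for i
    unfolding h partial_deriv_fourier_bessel_deriv[OF f] by (intro additive_closure.incl rangeI)
  obtain C K where CK: "\<forall>\<xi> x. norm (bessel_kernel_deriv m \<xi> x) \<le> C * bracket x powr K"
    using norm_bessel_kernel_deriv_le[of m] by metis
  have "norm (h \<xi>) \<le> (\<integral>x. norm (f x) * (C * bracket x powr K) \<partial>mu \<alpha>)" for \<xi>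
    unfolding h fourier_bessel_deriv_def
  proof (rule order_trans[OF integral_norm_bound integral_mono])
    show "norm (f x * bessel_kernel_deriv m \<xi> x) \<le> norm (f x) * (C * bracket x powr K)" for x
      unfolding norm_mult using CK by (intro mult_left_mono) auto
  qed (intro integrable_norm integrable_mu_bessel_kernel_deriv integrable_mu_norm_schwartz_mult f)+
  then show "h \<in> growth 0" by (auto simp: growth_0_iff_bounded bounded_iff)
qed blast

lemma axial_laplace_fourier_bessel:
  assumes f: "f \<in> schwartz_even"
  shows "axial_laplace \<alpha> i (fourier_bessel \<alpha> f) \<xi> =
    - (\<integral>x. of_real ((x $ i)\<^sup>2) * (f x * bessel_kernel \<xi> x) \<partial>mu \<alpha>)"
proof -
  let ?m1 = "(\<lambda>_. 0)(i := Suc 0)" and ?m2 = "(\<lambda>_. 0)(i := Suc (Suc 0))"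
  let ?q = "\<lambda>x. if \<xi> $ i = 0 then f x * bessel_kernel_deriv ?m2 \<xi> x
    else f x * bessel_kernel_deriv ?m1 \<xi> x / of_real (\<xi> $ i)"
  have int: "integrable (mu \<alpha>) (\<lambda>x. f x * bessel_kernel_deriv m \<xi> x)" for m
    by (rule integrable_mu_bessel_kernel_deriv[OF f])
  have int_q: "integrable (mu \<alpha>) ?q"
    using int by (cases "\<xi> $ i = 0") auto
  have "radial_quot i (fourier_bessel_deriv (\<lambda>_. 0) f) \<xi> = (\<integral>x. ?q x \<partial>mu \<alpha>)"
    by (simp add: radial_quot_def partial_deriv_fourier_bessel_deriv[OF f] fourier_bessel_deriv_def)
  then have "axial_laplace \<alpha> i (fourier_bessel \<alpha> f) \<xi> =
      (\<integral>x. f x * bessel_kernel_deriv ?m2 \<xi> x + of_real (2 * \<alpha> $ i + 1) * ?q x \<partial>mu \<alpha>)"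
    unfolding fourier_bessel_eq_deriv_0 axial_laplace_def
    using int int_q by (simp add: partial_deriv_fourier_bessel_deriv[OF f] fourier_bessel_deriv_def)
  also have "\<dots> = (\<integral>x. - (of_real ((x $ i)\<^sup>2) * (f x * bessel_kernel \<xi> x)) \<partial>mu \<alpha>)"
  proof (rule Bochner_Integration.integral_cong[OF refl])
    fix x
    have "f x * axial_laplace \<alpha> i (\<lambda>\<xi>. bessel_kernel \<xi> x) \<xi> =
        f x * bessel_kernel_deriv ?m2 \<xi> x + of_real (2 * \<alpha> $ i + 1) * ?q x"
      by (simp add: axial_laplace_def radial_quot_def partial_deriv_bessel_kernel_deriv
          algebra_simps)
    then show "f x * bessel_kernel_deriv ?m2 \<xi> x + of_real (2 * \<alpha> $ i + 1) * ?q x =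
        - (of_real ((x $ i)\<^sup>2) * (f x * bessel_kernel \<xi> x))"
      unfolding axial_laplace_bessel_kernel by (simp add: algebra_simps)
  qed
  finally show ?thesis by simp
qed

lemma laplace_fourier_bessel:
  assumes f: "f \<in> schwartz_even"
  shows "laplace \<alpha> (fourier_bessel \<alpha> f) =
    (\<lambda>\<xi>. - fourier_bessel \<alpha> (\<lambda>x. of_real ((norm x)\<^sup>2) * f x) \<xi>)"
proof
  fix \<xi>
  have int: "integrable (mu \<alpha>) (\<lambda>x. of_real ((x $ i)\<^sup>2) * (f x * bessel_kernel \<xi> x))" for i
  proof -
    obtain K where "bessel_kernel \<xi> \<in> growth K" using growth_bessel_kernel_deriv by blast
    moreover have "(\<lambda>x::real^'n. complex_of_real ((x $ i)\<^sup>2)) \<in> growth 1"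
      using symbols_growth[OF symbols_power[OF symbols_coord[of i], of 2]] by simp
    ultimately have "(\<lambda>x. of_real ((x $ i)\<^sup>2) * bessel_kernel \<xi> x) \<in> growth (1 + K)"
      by (rule growth_mult[rotated])
    from integrable_mu_schwartz_mult[OF f _ this] show ?thesis by (simp add: mult.left_commute)
  qed
  have "laplace \<alpha> (fourier_bessel \<alpha> f) \<xi> =
      - (\<Sum>i\<in>UNIV. \<integral>x. of_real ((x $ i)\<^sup>2) * (f x * bessel_kernel \<xi> x) \<partial>mu \<alpha>)"
    by (simp add: laplace_eq_sum_axial axial_laplace_fourier_bessel[OF f] sum_negf)
  also have "\<dots> = - (\<integral>x. (\<Sum>i\<in>UNIV. of_real ((x $ i)\<^sup>2) * (f x * bessel_kernel \<xi> x)) \<partial>mu \<alpha>)"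
    by (subst Bochner_Integration.integral_sum) (simp_all add: int del: of_real_power)
  also have "\<dots> = - fourier_bessel \<alpha> (\<lambda>x. of_real ((norm x)\<^sup>2) * f x) \<xi>"
    by (simp add: fourier_bessel_eq_deriv_0 fourier_bessel_deriv_def norm_power2_eq_sum
        sum_distrib_right
        mult.assoc)
  finally show "laplace \<alpha> (fourier_bessel \<alpha> f) \<xi> =
      - fourier_bessel \<alpha> (\<lambda>x. of_real ((norm x)\<^sup>2) * f x) \<xi>" .
qed

end

subsection \<open>Integration by parts\<close>

lemma has_vector_derivative_scaleR_vanishing:
  fixes u :: "real \<Rightarrow> real" and v :: "real \<Rightarrow> 'a::real_normed_vector"
  assumes v: "(v has_vector_derivative v') (at x)" and "v x = 0" and u: "isCont u x"
  shows "((\<lambda>t. u t *\<^sub>R v t) has_vector_derivative u x *\<^sub>R v') (at x)"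
  unfolding has_vector_derivative_def has_derivative_at_within
proof
  have "((\<lambda>t. u t *\<^sub>R ((v t - v x - (t - x) *\<^sub>R v') /\<^sub>R norm (t - x))) \<longlongrightarrow> u x *\<^sub>R 0) (at x)"
    using v u unfolding has_vector_derivative_def has_derivative_at_within isCont_def
    by (intro tendsto_scaleR) auto
  moreover have "((\<lambda>t. ((t - x) / norm (t - x)) *\<^sub>R ((u t - u x) *\<^sub>R v')) \<longlongrightarrow> 0) (at x)"
  proof (rule Lim_null_comparison)
    have "((\<lambda>t. norm ((u t - u x) *\<^sub>R v')) \<longlongrightarrow> norm ((u x - u x) *\<^sub>R v')) (at x)"
      using u unfolding isCont_def by (intro tendsto_intros)
    then show "((\<lambda>t. norm ((u t - u x) *\<^sub>R v')) \<longlongrightarrow> 0) (at x)" by simp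
    show "eventually (\<lambda>t. norm (((t - x) / norm (t - x)) *\<^sub>R ((u t - u x) *\<^sub>R v')) \<le>
        norm ((u t - u x) *\<^sub>R v')) (at x)"
      by (rule eventually_at_filter[THEN iffD2, OF always_eventually]) (auto simp: abs_mult)
  qed
  ultimately have "((\<lambda>t. u t *\<^sub>R ((v t - v x - (t - x) *\<^sub>R v') /\<^sub>R norm (t - x)) +
      ((t - x) / norm (t - x)) *\<^sub>R ((u t - u x) *\<^sub>R v')) \<longlongrightarrow> u x *\<^sub>R 0 + 0) (at x)"
    by (rule tendsto_add)
  then show "((\<lambda>t. (u t *\<^sub>R v t - u x *\<^sub>R v x - (t - x) *\<^sub>R u x *\<^sub>R v') /\<^sub>R
      norm (t - x)) \<longlongrightarrow> 0) (at x)"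
    by (simp add: \<open>v x = 0\<close> algebra_simps divide_inverse)
qed (rule bounded_linear_scaleR_left)

lemma has_vector_derivative_max_powr_scaleR:
  fixes v :: "real \<Rightarrow> 'a::real_normed_vector"
  assumes v: "(v has_vector_derivative v') (at 0)" and "0 < a" and y: "y = 0 \<Longrightarrow> v 0 = 0"
  shows "((\<lambda>t. max 0 (y + t) powr a *\<^sub>R v t) has_vector_derivative
     (max 0 y powr a *\<^sub>R (v' + (a / y) *\<^sub>R v 0))) (at 0)"
proof (cases y "0::real" rule: linorder_cases)
  case less
  have "((\<lambda>t. 0) has_vector_derivative (0::'a)) (at 0)" by simp
  then have "((\<lambda>t. max 0 (y + t) powr a *\<^sub>R v t) has_vector_derivative 0) (at 0)"
    by (rule has_vector_derivative_transform_within_open[of _ _ _ "{..< - y}"]) (use less in auto)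
  then show ?thesis using less by simp
next
  case equal
  have "isCont (\<lambda>t. max 0 t powr a) 0"
    unfolding isCont_def using \<open>0 < a\<close> by (intro tendsto_powr' tendsto_intros) auto
  from has_vector_derivative_scaleR_vanishing[OF v y[OF equal] this]
  show ?thesis using equal by simp
next
  case greater
  have "((\<lambda>t. (y + t) powr a) has_field_derivative a * y powr (a - 1)) (at 0)"
    using greater by (auto intro!: derivative_eq_intros simp: powr_diff)
  from has_vector_derivative_scaleR[OF this v]
  have "((\<lambda>t. (y + t) powr a *\<^sub>R v t) has_vector_derivative
      (y powr a *\<^sub>R v' + (a * y powr (a - 1)) *\<^sub>R v 0)) (at 0)"
    by simp
  then have "((\<lambda>t. max 0 (y + t) powr a *\<^sub>R v t) has_vector_derivative
      (y powr a *\<^sub>R v' + (a * y powr (a - 1)) *\<^sub>R v 0)) (at 0)"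
    by (rule has_vector_derivative_transform_within_open[of _ _ _ "{- y <..}"])
      (use greater in auto)
  moreover have "y powr a *\<^sub>R v' + (a * y powr (a - 1)) *\<^sub>R v 0 =
      max 0 y powr a *\<^sub>R (v' + (a / y) *\<^sub>R v 0)"
    using greater by (simp add: scaleR_add_right powr_diff mult.commute)
  ultimately show ?thesis by simp
qed

definition wronskian :: "'n::finite \<Rightarrow> (real^'n \<Rightarrow> complex) \<Rightarrow> (real^'n \<Rightarrow> complex) \<Rightarrow> real^'n \<Rightarrow> complex"
  where "wronskian i f g x = partial_deriv i f x * g x - f x * partial_deriv i g x"

lemma has_vector_derivative_wronskian:
  assumes f: "smooth_fun f" and g: "smooth_fun g"
  shows "((\<lambda>t. wronskian i f g (x + t *\<^sub>R axis i 1)) has_vector_derivative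
    partial_deriv i (partial_deriv i f) x * g x - f x * partial_deriv i (partial_deriv i g) x)
    (at 0)"
proof -
  note diff = f[THEN smooth_fun_differentiable] g[THEN smooth_fun_differentiable]
    f[THEN smooth_fun_partial_deriv, THEN smooth_fun_differentiable]
    g[THEN smooth_fun_partial_deriv, THEN smooth_fun_differentiable]
  have "wronskian i f g differentiable (at (x + 0 *\<^sub>R axis i 1))"
    unfolding wronskian_def[abs_def] by (intro differentiable_diff differentiable_mult diff)
  from has_vector_derivative_axis_line[OF this] show ?thesis
    unfolding wronskian_def[abs_def]
    by (simp add: partial_deriv_diff partial_deriv_mult differentiable_mult diff)
qed

context poly_axial
begin

lemma has_vector_derivative_weight_wronskian:
  assumes f: "smooth_fun f" "even_fun f" and g: "smooth_fun g" "even_fun g"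
  shows "((\<lambda>t. weight \<alpha> (x + t *\<^sub>R axis i 1) *\<^sub>R wronskian i f g (x + t *\<^sub>R axis i 1))
    has_vector_derivative
      weight \<alpha> x *\<^sub>R (axial_laplace \<alpha> i f x * g x - f x * axial_laplace \<alpha> i g x)) (at 0)"
proof -
  define a where "a = 2 * \<alpha> $ i + 1"
  define w where "w = (\<Prod>j\<in>UNIV - {i}. max 0 (x $ j) powr (2 * \<alpha> $ j + 1))"
  define v where "v t = wronskian i f g (x + t *\<^sub>R axis i 1)" for t
  define v' where "v' = partial_deriv i (partial_deriv i f) x * g x -
    f x * partial_deriv i (partial_deriv i g) x"
  have "(v has_vector_derivative v') (at 0)"
    unfolding v_def v'_def by (rule has_vector_derivative_wronskian[OF f(1) g(1)])
  moreover have "0 < a" using order_gt[of i] by (simp add: a_def)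
  moreover have "v 0 = 0" if "x $ i = 0"
    using partial_deriv_even_eq_0[OF f that] partial_deriv_even_eq_0[OF g that]
    by (simp add: v_def wronskian_def)
  ultimately have "((\<lambda>t. max 0 (x $ i + t) powr a *\<^sub>R v t) has_vector_derivative
      max 0 (x $ i) powr a *\<^sub>R (v' + (a / x $ i) *\<^sub>R v 0)) (at 0)"
    by (rule has_vector_derivative_max_powr_scaleR)
  then have "((\<lambda>t. w *\<^sub>R (max 0 (x $ i + t) powr a *\<^sub>R v t)) has_vector_derivative
      w *\<^sub>R (max 0 (x $ i) powr a *\<^sub>R (v' + (a / x $ i) *\<^sub>R v 0))) (at 0)"
    by (rule bounded_linear.has_vector_derivative[OF bounded_linear_scaleR_right])
  moreover have weight: "weight \<alpha> (x + t *\<^sub>R axis i 1) = w * max 0 (x $ i + t) powr a" for t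
    unfolding weight_def w_def a_def prod.remove[OF finite_class.finite_UNIV UNIV_I, of _ i]
    by (auto simp: axis_def mult.commute intro!: prod.cong)
  moreover have "v' + (a / x $ i) *\<^sub>R v 0 =
      axial_laplace \<alpha> i f x * g x - f x * axial_laplace \<alpha> i g x"
    if "0 < x $ i"
    using that
    by (simp add: v'_def v_def wronskian_def axial_laplace_def radial_quot_def a_def
        scaleR_conv_of_real field_simps)
  then have "w *\<^sub>R (max 0 (x $ i) powr a *\<^sub>R (v' + (a / x $ i) *\<^sub>R v 0)) =
      weight \<alpha> x *\<^sub>R (axial_laplace \<alpha> i f x * g x - f x * axial_laplace \<alpha> i g x)"
    using weight[of 0] by (cases "0 < x $ i") auto
  ultimately show ?thesis by (simp add: v_def)
qed

lemma integrable_mu_symbols: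
  assumes "f \<in> symbols (integrable_order \<alpha>)"
  shows "integrable (mu \<alpha>) f"
  using assms
  by (intro integrable_mu_growth smooth_fun_borel_measurable symbols_smooth symbols_growth)

lemma integrable_lborel_weight_symbols:
  "f \<in> symbols (integrable_order \<alpha>) \<Longrightarrow> integrable lborel (\<lambda>x. weight \<alpha> x *\<^sub>R f x)"
  using integrable_mu_symbols[of f]
  by (simp add: integrable_mu_iff smooth_fun_borel_measurable symbols_smooth)

lemma symbols_schwartz_even_mult:
  assumes "f \<in> schwartz_even" "g \<in> symbols K"
  shows "(\<lambda>x. f x * g x) \<in> symbols L" "(\<lambda>x. partial_deriv i f x * g x) \<in> symbols L"
proof -
  have f: "f \<in> symbols (L - K)" by (rule schwartz_even_symbols[OF assms(1)])
  show "(\<lambda>x. f x * g x) \<in> symbols L"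
    using symbols_mult[OF f assms(2)] by simp
  show "(\<lambda>x. partial_deriv i f x * g x) \<in> symbols L"
    using symbols_mult[OF symbols_partial_deriv[OF f] assms(2)] by simp
qed

lemma integral_axial_laplace_symmetric:
  assumes f: "f \<in> schwartz_even" and g: "g \<in> symbols K" "even_fun g"
    and Lg: "axial_laplace \<alpha> i g \<in> symbols L"
  shows "(\<integral>x. axial_laplace \<alpha> i f x * g x \<partial>mu \<alpha>) = (\<integral>x. f x * axial_laplace \<alpha> i g x \<partial>mu \<alpha>)"
proof -
  let ?N = "real CARD('n)"
  define h where "h x = axial_laplace \<alpha> i f x * g x - f x * axial_laplace \<alpha> i g x" for x
  have Lf: "axial_laplace \<alpha> i f \<in> schwartz_even" by (rule schwartz_even_axial_laplace[OF f])
  note products = symbols_schwartz_even_mult(1)[OF Lf g(1)] symbols_schwartz_even_mult(1)[OF f Lg]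
  have h: "h \<in> symbols (integrable_order \<alpha>)"
    unfolding h_def[abs_def] by (intro symbols_diff products)
  have wronskian: "wronskian i f g \<in> symbols (integrable_order \<alpha>)"
    unfolding wronskian_def[abs_def]
    by (intro symbols_diff symbols_schwartz_even_mult(2)[OF f g(1)]
        symbols_schwartz_even_mult(1)[OF f symbols_partial_deriv[OF g(1)]])
  obtain C where "0 \<le> C"
    and C: "\<forall>x. norm (weight \<alpha> x *\<^sub>R h x) \<le> C * bracket x powr (- ?N)"
    using growthE[OF growth_weight_scaleR[OF symbols_growth[OF h]]] by metis
  have "(\<integral>x. weight \<alpha> x *\<^sub>R h x \<partial>lborel) = 0"
  proof (rule integral_directional_derivative_eq_0)
    show "((\<lambda>t. weight \<alpha> (x + t *\<^sub>R axis i 1) *\<^sub>R wronskian i f g (x + t *\<^sub>R axis i 1))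
        has_vector_derivative weight \<alpha> x *\<^sub>R h x) (at 0)" for x
      unfolding h_def using schwartz_even_smooth[OF f] schwartz_even_even[OF f]
        symbols_smooth[OF g(1)] g(2)
      by (rule has_vector_derivative_weight_wronskian)
    show "integrable lborel (\<lambda>x::real^'n. C * (3 powr ?N * bracket x powr (- ?N)))"
      using integrable_lborel_bracket_powr[where 'a = "real^'n"] by simp
    show "norm (weight \<alpha> (x + t *\<^sub>R axis i 1) *\<^sub>R h (x + t *\<^sub>R axis i 1)) \<le>
        C * (3 powr ?N * bracket x powr (- ?N))" if "\<bar>t\<bar> \<le> 1" for x t
      using that \<open>0 \<le> C\<close>
      by (intro order_trans[OF C[rule_format]] mult_left_mono bracket_powr_translate_le) auto
  qed (use wronskian[THEN integrable_lborel_weight_symbols]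
      h[THEN integrable_lborel_weight_symbols] in auto)
  then have "(\<integral>x. h x \<partial>mu \<alpha>) = 0"
    by (simp add: integral_mu smooth_fun_borel_measurable symbols_smooth[OF h])
  then show ?thesis
    using products[THEN integrable_mu_symbols] by (simp add: h_def)
qed

lemma fourier_bessel_axial_laplace:
  assumes f: "f \<in> schwartz_even"
  shows "fourier_bessel \<alpha> (axial_laplace \<alpha> i f) \<xi> = - of_real ((\<xi> $ i)\<^sup>2) * fourier_bessel \<alpha> f \<xi>"
proof -
  have commute: "(\<lambda>x. bessel_kernel \<xi> x) = (\<lambda>x. bessel_kernel x \<xi>)"
    by (rule ext) (rule bessel_kernel_commute)
  have eigenfunction: "axial_laplace \<alpha> i (bessel_kernel \<xi>) =
      (\<lambda>x. - of_real ((\<xi> $ i)\<^sup>2) * bessel_kernel \<xi> x)"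
    unfolding commute by (rule axial_laplace_bessel_kernel)
  have "bessel_kernel \<xi> \<in> symbols 0" "even_fun (bessel_kernel \<xi>)"
    unfolding commute by (rule symbols_bessel_kernel even_fun_bessel_kernel)+
  moreover from this have "axial_laplace \<alpha> i (bessel_kernel \<xi>) \<in> symbols 0"
    unfolding eigenfunction by (intro symbols_cmult)
  ultimately have "fourier_bessel \<alpha> (axial_laplace \<alpha> i f) \<xi> =
      (\<integral>x. f x * axial_laplace \<alpha> i (bessel_kernel \<xi>) x \<partial>mu \<alpha>)"
    unfolding fourier_bessel_eq_deriv_0 fourier_bessel_deriv_def
    by (rule integral_axial_laplace_symmetric[OF f])
  also have "\<dots> = (\<integral>x. - of_real ((\<xi> $ i)\<^sup>2) * (f x * bessel_kernel \<xi> x) \<partial>mu \<alpha>)"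
    unfolding eigenfunction by (simp only: mult.left_commute)
  finally show ?thesis
    by (simp add: fourier_bessel_eq_deriv_0 fourier_bessel_deriv_def)
qed

lemma fourier_bessel_laplace:
  assumes f: "f \<in> schwartz_even"
  shows "fourier_bessel \<alpha> (laplace \<alpha> f) \<xi> = - of_real ((norm \<xi>)\<^sup>2) * fourier_bessel \<alpha> f \<xi>"
proof -
  have "fourier_bessel \<alpha> (laplace \<alpha> f) \<xi> = (\<Sum>i\<in>UNIV. fourier_bessel \<alpha> (axial_laplace \<alpha> i f) \<xi>)"
    unfolding fourier_bessel_eq_deriv_0 fourier_bessel_deriv_def laplace_eq_sum_axial
      sum_distrib_right
    by (intro Bochner_Integration.integral_sum integrable_mu_bessel_kernel_deriv
        schwartz_even_axial_laplace f)
  then show ?thesis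
    by (simp add: fourier_bessel_axial_laplace[OF f] norm_power2_eq_sum sum_distrib_right sum_negf)
qed

subsection \<open>The Fourier-Bessel transform of even Schwartz functions\<close>

lemma even_fun_fourier_bessel: "even_fun (fourier_bessel \<alpha> f)"
  using even_fun_bessel_kernel
  by (simp add: even_fun_def fourier_bessel_eq_deriv_0 fourier_bessel_deriv_def)

lemma bracket_power_fourier_bessel:
  assumes "f \<in> schwartz_even"
  shows "\<exists>g\<in>schwartz_even. \<forall>\<xi>.
    of_real (bracket \<xi> ^ m) * fourier_bessel \<alpha> f \<xi> = fourier_bessel \<alpha> g \<xi>"
proof (induction m)
  case 0
  show ?case using assms by auto
next
  case (Suc m)
  then obtain g where g: "g \<in> schwartz_even"
    and IH: "\<And>\<xi>. of_real (bracket \<xi> ^ m) * fourier_bessel \<alpha> f \<xi> = fourier_bessel \<alpha> g \<xi>"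
    by blast
  define g' where "g' x = g x - laplace \<alpha> g x" for x
  have "fourier_bessel \<alpha> g' \<xi> = fourier_bessel \<alpha> g \<xi> - fourier_bessel \<alpha> (laplace \<alpha> g) \<xi>" for \<xi>
    unfolding fourier_bessel_eq_deriv_0 fourier_bessel_deriv_def g'_def left_diff_distrib
    by (intro Bochner_Integration.integral_diff integrable_mu_bessel_kernel_deriv g
        schwartz_even_laplace)
  then have "of_real (bracket \<xi> ^ Suc m) * fourier_bessel \<alpha> f \<xi> = fourier_bessel \<alpha> g' \<xi>" for \<xi>
    using IH[of \<xi>] by (simp add: fourier_bessel_laplace[OF g] algebra_simps)
  moreover have "g' \<in> schwartz_even"
    unfolding g'_def by (intro schwartz_even_diff g schwartz_even_laplace)
  ultimately show ?case by blast
qed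

lemma schwartz_even_fourier_bessel:
  assumes f: "f \<in> schwartz_even"
  shows "fourier_bessel \<alpha> f \<in> schwartz_even"
proof -
  have "fourier_bessel \<alpha> f \<in> symbols (- real m)" for m
  proof -
    obtain g where g: "g \<in> schwartz_even"
      and eq: "\<And>\<xi>. of_real (bracket \<xi> ^ m) * fourier_bessel \<alpha> f \<xi> = fourier_bessel \<alpha> g \<xi>"
      using bracket_power_fourier_bessel[OF f] by blast
    have "fourier_bessel \<alpha> f = (\<lambda>\<xi>. of_real (bracket \<xi> powr (- real m)) * fourier_bessel \<alpha> g \<xi>)"
    proof
      fix \<xi> :: "real^'n"
      have "bracket \<xi> powr (- real m) * bracket \<xi> ^ m = 1"
        by (simp add: powr_minus powr_realpow)
      then show "fourier_bessel \<alpha> f \<xi> = of_real (bracket \<xi> powr (- real m)) * fourier_bessel \<alpha> g \<xi>"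
        unfolding eq[symmetric] mult.assoc[symmetric] of_real_mult[symmetric] by simp
    qed
    also have "\<dots> \<in> symbols (- real m + 0)"
      by (intro symbols_mult symbols_bracket_powr symbols_0_fourier_bessel g)
    finally show ?thesis by simp
  qed
  then show ?thesis
    using even_fun_fourier_bessel by (simp add: schwartz_even_iff symbols_all_orders)
qed

end

subsection \<open>Test functions approximating boxes\<close>

lemma exp_minus_le_powr:
  assumes "0 \<le> (r::real)"
  shows "exp (- r) \<le> fact m * exp 1 * (1 + r) powr (- real m)"
proof -
  have "(\<Sum>n\<in>{m}. (1 + r) ^ n /\<^sub>R fact n) \<le> (\<Sum>n. (1 + r) ^ n /\<^sub>R fact n)"
    using assms by (intro sum_le_suminf summable_exp_generic) auto
  then have "(1 + r) ^ m / fact m \<le> exp (1 + r)"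
    by (simp add: exp_def divide_inverse mult.commute)
  then have "exp (- r) * ((1 + r) ^ m / fact m) \<le> exp (- r) * exp (1 + r)"
    by (intro mult_left_mono) auto
  also have "\<dots> = exp 1" by (simp add: exp_add[symmetric])
  finally show ?thesis using assms by (simp add: powr_minus powr_realpow field_simps)
qed

lemma growth_exp_minus:
  fixes p :: "'a::real_normed_vector \<Rightarrow> complex"
  assumes "\<And>x. (norm x)\<^sup>2 \<le> Re (p x)"
  shows "(\<lambda>x. exp (- p x)) \<in> growth K"
proof (rule growth_mono)
  define m where "m = nat \<lceil>- K\<rceil>"
  show "- real m \<le> K" unfolding m_def by linarith
  have "norm (exp (- p x)) \<le> fact m * exp 1 * bracket x powr (- real m)" for x
  proof -
    have "norm (exp (- p x)) \<le> exp (- (norm x)\<^sup>2)" using assms[of x] by simp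
    also have "\<dots> \<le> fact m * exp 1 * bracket x powr (- real m)"
      by (rule exp_minus_le_powr) simp
    finally show ?thesis .
  qed
  then show "(\<lambda>x. exp (- p x)) \<in> growth (- real m)" by (rule growthI)
qed

lemma has_derivative_exp_minus:
  fixes p :: "real^'n::finite \<Rightarrow> complex"
  assumes "p differentiable (at x)"
  shows "((\<lambda>x. exp (- p x)) has_derivative
    differential (\<lambda>i. - partial_deriv i p x * exp (- p x))) (at x)"
proof -
  have "((\<lambda>x. - p x) has_derivative (\<lambda>h. - differential (\<lambda>i. partial_deriv i p x) h)) (at x)"
    by (intro has_derivative_minus has_derivative_differential assms)
  moreover have "(exp has_derivative (\<lambda>h. exp (- p x) * h)) (at (- p x))"
    using DERIV_exp[of "- p x"] by (simp add: has_field_derivative_def)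
  ultimately have "((\<lambda>x. exp (- p x)) has_derivative
      (\<lambda>h. exp (- p x) * - differential (\<lambda>i. partial_deriv i p x) h)) (at x)"
    by (rule has_derivative_compose)
  then show ?thesis by (simp add: sum_distrib_left sum_negf mult.commute)
qed

lemma symbols_exp_minus:
  fixes p :: "real^'n::finite \<Rightarrow> complex"
  assumes p: "p \<in> symbols L" and norm_le: "\<And>x. (norm x)\<^sup>2 \<le> Re (p x)"
  shows "(\<lambda>x. exp (- p x)) \<in> symbols K"
proof (rule symbols_coinduct)
  let ?A = "{(\<lambda>x. q x * exp (- p x)) | q a. q \<in> symbols a}"
  have incl: "(\<lambda>x. q x * exp (- p x)) \<in> ?A" if "q \<in> symbols a" for q a
    using that by blast
  show "(\<lambda>x. exp (- p x)) \<in> ?A"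
    using incl[OF symbols_const[of 0 1]] by simp
  fix h assume "h \<in> ?A"
  then obtain q a where h: "h = (\<lambda>x. q x * exp (- p x))" and q: "q \<in> symbols a" by blast
  note exp_deriv = has_derivative_exp_minus[OF symbols_differentiable[OF p]]
  show "h differentiable (at x)" for x
    unfolding h
    by (intro differentiable_mult symbols_differentiable[OF q] differentiableI[OF exp_deriv])
  show "h \<in> growth K"
    unfolding h
    using growth_mult[OF symbols_growth[OF q] growth_exp_minus[of p "K - a", OF norm_le]] by simp
  have leibniz: "partial_deriv i h = (\<lambda>x. partial_deriv i q x * exp (- p x) +
      (- 1 * (q x * partial_deriv i p x)) * exp (- p x))" for i
    unfolding h
    by (rule ext)
      (simp add: partial_deriv_mult[OF symbols_differentiable[OF q] differentiableI[OF exp_deriv]]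
        partial_deriv_eq_differentialI[OF exp_deriv] mult.assoc)
  show "partial_deriv i h \<in> additive_closure ?A" for i
    unfolding leibniz
    by (intro additive_closure.add additive_closure.incl incl[OF symbols_partial_deriv[OF q]]
        incl[OF symbols_cmult[OF symbols_mult[OF q symbols_partial_deriv[OF p]]]])
qed

text \<open>On the positive orthant \<open>exp (- box_exponent b k x)\<close> tends to \<open>exp (- |x|\<^sup>2)\<close> times the
  indicator of \<open>{..b}\<close>; the factor \<open>1 / k\<close> makes this hold at the boundary as well.\<close>

definition box_exponent :: "real^'n::finite \<Rightarrow> nat \<Rightarrow> real^'n \<Rightarrow> real" where
  "box_exponent b k x = (norm x)\<^sup>2 + (\<Sum>i\<in>UNIV. (x $ i / b $ i) ^ (2 * k)) / real k"

lemma norm_power2_le_box_exponent: "(norm x)\<^sup>2 \<le> box_exponent b k x"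
  unfolding box_exponent_def by (simp add: sum_nonneg)

lemma symbols_box_exponent:
  "(\<lambda>x. complex_of_real (box_exponent b k x)) \<in> symbols (1 + real k)"
proof -
  have "(\<lambda>x. (of_real (1 / b $ i) * complex_of_real (x $ i)) ^ (2 * k)) \<in> symbols (1 + real k)"
    for i
    by (rule symbols_mono[OF symbols_power[OF symbols_cmult[OF symbols_coord]]]) simp
  then have "(\<lambda>x. complex_of_real ((norm x)\<^sup>2) + of_real (1 / real k) *
      (\<Sum>i\<in>UNIV. (of_real (1 / b $ i) * complex_of_real (x $ i)) ^ (2 * k))) \<in> symbols (1 + real k)"
    by (intro symbols_add symbols_mono[OF symbols_norm_power2] symbols_cmult symbols_sum) auto
  then show ?thesis by (simp add: box_exponent_def)
qed

lemma schwartz_even_exp_minus_box_exponent: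
  "(\<lambda>x. of_real (exp (- box_exponent b k x))) \<in> schwartz_even"
proof -
  have "(\<lambda>x. of_real (exp (- box_exponent b k x))) \<in> symbols K" for K
    using symbols_exp_minus[OF symbols_box_exponent[of b k], of K]
      norm_power2_le_box_exponent[of _ b k]
    by (simp add: exp_of_real[symmetric])
  moreover have "box_exponent b k (scale_coord i (- 1) x) = box_exponent b k x" for i x
  proof -
    have "(scale_coord i (- 1) x $ j / b $ j) ^ (2 * k) = (x $ j / b $ j) ^ (2 * k)" for j
      by (simp add: power_mult)
    then show ?thesis unfolding box_exponent_def norm_scale_coord_minus_one by (simp only:)
  qed
  ultimately show ?thesis by (simp add: schwartz_even_iff even_fun_iff_scale_coord)
qed

lemma power_div_nat_tendsto_0: "0 \<le> v \<Longrightarrow> v \<le> 1 \<Longrightarrow> (\<lambda>k. v ^ k / real k) \<longlonglongrightarrow> 0" for v :: real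
  by (rule tendsto_sandwich[OF _ _ tendsto_const lim_1_over_n])
    (auto intro!: always_eventually divide_right_mono power_le_one)

lemma power_div_nat_at_top: "1 < v \<Longrightarrow> filterlim (\<lambda>k. v ^ k / real k) at_top sequentially"
  for v :: real
  by real_asymp

lemma exp_minus_box_exponent_tendsto:
  fixes x b :: "real^'n::finite"
  assumes b: "\<And>i. 0 < b $ i" and x: "\<And>i. 0 < x $ i"
  shows "(\<lambda>k. exp (- box_exponent b k x)) \<longlonglongrightarrow> indicator {..b} x * exp (- (norm x)\<^sup>2)"
proof (cases "x \<in> {..b}")
  case True
  then have "x $ i \<le> b $ i" for i by (simp add: less_eq_vec_def)
  then have "(\<lambda>k. ((x $ i / b $ i)\<^sup>2) ^ k / real k) \<longlonglongrightarrow> 0" for i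
    using b[of i] x[of i] by (intro power_div_nat_tendsto_0) (auto simp: power_le_one)
  then have "(\<lambda>k. exp (- ((norm x)\<^sup>2 + (\<Sum>i\<in>UNIV. ((x $ i / b $ i)\<^sup>2) ^ k / real k))))
      \<longlonglongrightarrow> exp (- ((norm x)\<^sup>2 + (\<Sum>i\<in>(UNIV::'n set). 0)))"
    by (intro tendsto_intros)
  then show ?thesis
    using True by (simp add: box_exponent_def power_mult sum_divide_distrib)
next
  case False
  then obtain i where i: "b $ i < x $ i" by (auto simp: less_eq_vec_def not_le)
  have le: "((x $ i / b $ i)\<^sup>2) ^ k / real k \<le> box_exponent b k x" for k
  proof -
    have "((x $ i / b $ i)\<^sup>2) ^ k \<le> (\<Sum>i\<in>UNIV. (x $ i / b $ i) ^ (2 * k))"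
      using member_le_sum[of i UNIV "\<lambda>i. (x $ i / b $ i) ^ (2 * k)"] by (simp add: power_mult)
    then have "((x $ i / b $ i)\<^sup>2) ^ k / real k \<le> (\<Sum>i\<in>UNIV. (x $ i / b $ i) ^ (2 * k)) / real k"
      by (intro divide_right_mono) auto
    then show ?thesis by (simp add: box_exponent_def add_increasing)
  qed
  have "filterlim (\<lambda>k. ((x $ i / b $ i)\<^sup>2) ^ k / real k) at_top sequentially"
    using b[of i] i by (intro power_div_nat_at_top) (auto simp: one_less_power)
  then have "filterlim (\<lambda>k. box_exponent b k x) at_top sequentially"
    by (rule filterlim_at_top_mono) (intro always_eventually allI le)
  then have "(\<lambda>k. exp (- box_exponent b k x)) \<longlonglongrightarrow> 0"
    by (intro filterlim_compose[OF exp_at_bot]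
        filterlim_uminus_at_bot_at_top[THEN filterlim_compose])
  then show ?thesis using False by simp
qed

subsection \<open>Uniqueness of the representing function\<close>

lemma AE_zero_of_generator_integrals:
  fixes f :: "'a \<Rightarrow> 'b::{banach, second_countable_topology}"
  assumes "sigma_finite_measure M" and f: "integrable M f"
    and G: "sets M = sigma_sets (space M) G" "G \<subseteq> Pow (space M)" "Int_stable G"
    and total: "(\<integral>x. f x \<partial>M) = 0"
    and generator: "\<And>A. A \<in> G \<Longrightarrow> set_lebesgue_integral M A f = 0"
  shows "AE x in M. f x = 0"
proof -
  interpret sigma_finite_measure M by fact
  have f_on: "set_integrable M A f" if "A \<in> sets M" for A
    unfolding set_integrable_def using that f by (rule integrable_mult_indicator)
  have "set_lebesgue_integral M A f = 0" if "A \<in> sigma_sets (space M) G" for A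
    using G(3,2) that
  proof (induction rule: sigma_sets_induct_disjoint)
    case (compl A)
    then have A: "A \<in> sets M" using G(1) by simp
    have "set_lebesgue_integral M (A \<union> (space M - A)) f =
        set_lebesgue_integral M A f + set_lebesgue_integral M (space M - A) f"
      using A by (intro set_integral_Un f_on) auto
    moreover have "A \<union> (space M - A) = space M" using sets.sets_into_space[OF A] by auto
    ultimately show ?case using compl total set_integral_space[OF f] by simp
  next
    case (union A)
    then have A: "A i \<in> sets M" for i using G(1) by auto
    have "set_lebesgue_integral M (\<Union>i. A i) f = (\<Sum>i. set_lebesgue_integral M (A i) f)"
      using A union(1)
      by (intro lebesgue_integral_countable_add f_on) (auto simp: disjoint_family_on_def)
    then show ?case using union by simp
  qed (use generator in \<open>auto simp: set_lebesgue_integral_def\<close>)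
  then show ?thesis using G(1) by (intro density_zero[OF f]) simp
qed

lemma sets_mu_eq_sigma_sets_atMost:
  "sets (mu \<alpha>) = sigma_sets (space (mu \<alpha>)) (range (\<lambda>b. pos_orthant \<inter> {..b}))"
proof -
  have borel: "sets borel = sigma_sets UNIV (range (\<lambda>b::real^'a. {..b}))"
    unfolding borel_eq_atMost by (simp add: sets_measure_of)
  have "sets (mu \<alpha>) = (\<inter>) pos_orthant ` sigma_sets UNIV (range (\<lambda>b::real^'a. {..b}))"
    unfolding sets_mu sets_restrict_space borel ..
  also have "\<dots> = sigma_sets pos_orthant ((\<inter>) pos_orthant ` range (\<lambda>b::real^'a. {..b}))"
    by (rule sigma_sets_Int) (simp_all add: borel[symmetric])
  finally show ?thesis by (simp add: space_mu image_image)
qed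

lemma AE_mu_zero_of_box_integrals:
  fixes f :: "real^'n::finite \<Rightarrow> 'b::{banach, second_countable_topology}"
  assumes f: "integrable (mu \<alpha>) f" and total: "(\<integral>x. f x \<partial>mu \<alpha>) = 0"
    and box: "\<And>b. set_lebesgue_integral (mu \<alpha>) (pos_orthant \<inter> {..b}) f = 0"
  shows "AE x in mu \<alpha>. f x = 0"
proof (rule AE_zero_of_generator_integrals[OF sigma_finite_mu f sets_mu_eq_sigma_sets_atMost])
  show "Int_stable (range (\<lambda>b::real^'n. pos_orthant \<inter> {..b}))"
  proof (rule Int_stableI_image)
    fix a b :: "real^'n"
    show "\<exists>c\<in>UNIV. (pos_orthant \<inter> {..a}) \<inter> (pos_orthant \<inter> {..b}) = pos_orthant \<inter> {..c}"
      by (intro bexI[of _ "inf a b"]) auto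
  qed
qed (use total box in \<open>auto simp: space_mu\<close>)

lemma LpD:
  assumes "\<psi> \<in> Lp \<alpha> p"
  shows "\<psi> \<in> borel_measurable (mu \<alpha>)" "integrable (mu \<alpha>) (\<lambda>x. norm (\<psi> x) powr p)"
  using assms by (auto simp: Lp_def)

lemma Lp_dominated:
  assumes \<psi>: "\<psi> \<in> Lp \<alpha> p" and \<phi>: "\<phi> \<in> borel_measurable (mu \<alpha>)"
    and le: "\<And>x. norm (\<phi> x) \<le> norm (\<psi> x)" and "0 \<le> p"
  shows "\<phi> \<in> Lp \<alpha> p" "Lp_norm \<alpha> p \<phi> \<le> Lp_norm \<alpha> p \<psi>"
proof -
  have powr_le: "norm (\<phi> x) powr p \<le> norm (\<psi> x) powr p" for x
    using le \<open>0 \<le> p\<close> by (intro powr_mono2) auto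
  have int: "integrable (mu \<alpha>) (\<lambda>x. norm (\<phi> x) powr p)"
    by (rule Bochner_Integration.integrable_bound[OF LpD(2)[OF \<psi>]]) (use \<phi> powr_le in auto)
  then show "\<phi> \<in> Lp \<alpha> p" using \<phi> by (simp add: Lp_def)
  have "(\<integral>x. norm (\<phi> x) powr p \<partial>mu \<alpha>) \<le> (\<integral>x. norm (\<psi> x) powr p \<partial>mu \<alpha>)"
    by (rule integral_mono[OF int LpD(2)[OF \<psi>] powr_le])
  then show "Lp_norm \<alpha> p \<phi> \<le> Lp_norm \<alpha> p \<psi>"
    unfolding Lp_norm_def using \<open>0 \<le> p\<close> by (intro powr_mono2) (auto intro: integral_nonneg_AE)
qed

lemma Lp_diff:
  assumes \<psi>: "\<psi> \<in> Lp \<alpha> p" and \<psi>': "\<psi>' \<in> Lp \<alpha> p" and "0 \<le> p"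
  shows "(\<lambda>x. \<psi> x - \<psi>' x) \<in> Lp \<alpha> p"
proof -
  let ?B = "\<lambda>x. 2 powr p * (norm (\<psi> x) powr p + norm (\<psi>' x) powr p)"
  have meas: "(\<lambda>x. \<psi> x - \<psi>' x) \<in> borel_measurable (mu \<alpha>)"
    using LpD(1)[OF \<psi>] LpD(1)[OF \<psi>'] by (rule borel_measurable_diff)
  have le: "norm (\<psi> x - \<psi>' x) powr p \<le> ?B x" for x
  proof -
    let ?m = "max (norm (\<psi> x)) (norm (\<psi>' x))"
    have "norm (\<psi> x - \<psi>' x) \<le> 2 * ?m" using norm_triangle_ineq4[of "\<psi> x" "\<psi>' x"] by simp
    then have "norm (\<psi> x - \<psi>' x) powr p \<le> (2 * ?m) powr p"
      using \<open>0 \<le> p\<close> by (intro powr_mono2) auto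
    also have "\<dots> = 2 powr p * ?m powr p" by (simp add: powr_mult)
    also have "\<dots> \<le> ?B x" by (intro mult_left_mono) (auto simp: max_def)
    finally show ?thesis .
  qed
  have "integrable (mu \<alpha>) ?B"
    using LpD(2)[OF \<psi>] LpD(2)[OF \<psi>'] by simp
  then have "integrable (mu \<alpha>) (\<lambda>x. norm (\<psi> x - \<psi>' x) powr p)"
    by (rule Bochner_Integration.integrable_bound) (use meas le in auto)
  with meas show ?thesis by (simp add: Lp_def)
qed

context poly_axial
begin

lemma integrable_Lp_schwartz_mult:
  assumes p: "1 \<le> p" and \<psi>: "\<psi> \<in> Lp \<alpha> p" and f: "f \<in> schwartz_even"
  shows "integrable (mu \<alpha>) (\<lambda>x. \<psi> x * f x)"
proof -
  obtain C where C: "\<forall>x. norm (f x) \<le> C"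
    using symbols_growth[OF schwartz_even_symbols[OF f, of 0]]
    by (auto simp: growth_0_iff_bounded bounded_iff)
  then have "0 \<le> C" using norm_ge_zero[of "f 0"] order_trans by blast
  let ?B = "\<lambda>x. norm (f x) + C * norm (\<psi> x) powr p"
  have le: "norm (\<psi> x) * norm (f x) \<le> ?B x" for x
  proof (cases "norm (\<psi> x) \<le> 1")
    case True
    then have "norm (\<psi> x) * norm (f x) \<le> 1 * norm (f x)" by (intro mult_right_mono) auto
    then show ?thesis using \<open>0 \<le> C\<close> by (simp add: add_increasing2)
  next
    case False
    then have "norm (\<psi> x) powr 1 \<le> norm (\<psi> x) powr p" using p by (intro powr_mono) auto
    then have "norm (\<psi> x) * norm (f x) \<le> norm (\<psi> x) powr p * C"
      using C False by (intro mult_mono) auto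
    then show ?thesis by (simp add: mult.commute add_increasing)
  qed
  have "integrable (mu \<alpha>) (\<lambda>x. norm (f x))"
    by (intro integrable_norm integrable_mu_symbols schwartz_even_symbols f)
  then have "integrable (mu \<alpha>) ?B" using LpD(2)[OF \<psi>] by simp
  then show ?thesis
  proof (rule Bochner_Integration.integrable_bound)
    show "(\<lambda>x. \<psi> x * f x) \<in> borel_measurable (mu \<alpha>)"
      using LpD(1)[OF \<psi>] borel_measurable_mu[OF schwartz_even_borel_measurable[OF f]]
      by (rule borel_measurable_times)
    show "AE x in mu \<alpha>. norm (\<psi> x * f x) \<le> norm (?B x)"
      using le by (intro AE_I2) (auto simp: norm_mult intro: order_trans[OF _ abs_ge_self])
  qed
qed

lemma set_integral_box_eq_0:
  assumes p: "1 \<le> p" and \<psi>: "\<psi> \<in> Lp \<alpha> p" and b: "\<And>i. 0 < b $ i"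
    and zero: "\<And>f. f \<in> schwartz_even \<Longrightarrow> (\<integral>x. \<psi> x * f x \<partial>mu \<alpha>) = 0"
    and gaussian: "integrable (mu \<alpha>) (\<lambda>x. \<psi> x * of_real (exp (- (norm x)\<^sup>2)))"
  shows "set_lebesgue_integral (mu \<alpha>) (pos_orthant \<inter> {..b})
    (\<lambda>x. \<psi> x * of_real (exp (- (norm x)\<^sup>2))) = 0"
proof -
  let ?\<theta> = "\<lambda>x. \<psi> x * of_real (exp (- (norm x)\<^sup>2))" and ?B = "pos_orthant \<inter> {..b}"
  define e where "e k x = complex_of_real (exp (- box_exponent b k x))" for k x
  have e: "e k \<in> schwartz_even" for k
    unfolding e_def by (rule schwartz_even_exp_minus_box_exponent)
  have "(\<lambda>k. \<integral>x. \<psi> x * e k x \<partial>mu \<alpha>) \<longlonglongrightarrow> (\<integral>x. indicator ?B x *\<^sub>R ?\<theta> x \<partial>mu \<alpha>)"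
  proof (rule integral_dominated_convergence)
    have "?B \<in> sets (mu \<alpha>)" unfolding sets_mu sets_restrict_space by auto
    from integrable_mult_indicator[OF this gaussian]
    show "(\<lambda>x. indicator ?B x *\<^sub>R ?\<theta> x) \<in> borel_measurable (mu \<alpha>)" by simp
    show "(\<lambda>x. \<psi> x * e k x) \<in> borel_measurable (mu \<alpha>)" for k
      using integrable_Lp_schwartz_mult[OF p \<psi> e] by simp
    show "integrable (mu \<alpha>) (\<lambda>x. norm (?\<theta> x))" using gaussian by (rule integrable_norm)
    show "AE x in mu \<alpha>. (\<lambda>k. \<psi> x * e k x) \<longlonglongrightarrow> indicator ?B x *\<^sub>R ?\<theta> x"
    proof (rule AE_I2)
      fix x assume x: "x \<in> space (mu \<alpha>)"
      then have "(\<lambda>k. \<psi> x * e k x) \<longlonglongrightarrow> \<psi> x * of_real (indicator {..b} x * exp (- (norm x)\<^sup>2))"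
        unfolding e_def
        by (intro tendsto_intros exp_minus_box_exponent_tendsto b)
          (simp add: space_mu pos_orthant_def)
      also have "\<psi> x * of_real (indicator {..b} x * exp (- (norm x)\<^sup>2)) = indicator ?B x *\<^sub>R ?\<theta> x"
        using x by (simp add: space_mu indicator_def)
      finally show "(\<lambda>k. \<psi> x * e k x) \<longlonglongrightarrow> indicator ?B x *\<^sub>R ?\<theta> x" .
    qed
    show "AE x in mu \<alpha>. norm (\<psi> x * e k x) \<le> norm (?\<theta> x)" for k
      unfolding norm_mult e_def using norm_power2_le_box_exponent
      by (intro AE_I2 mult_left_mono) auto
  qed
  then show ?thesis
    unfolding zero[OF e] by (simp add: LIMSEQ_const_iff set_lebesgue_integral_def)
qed

lemma AE_zero_of_schwartz_pairing:
  assumes p: "1 \<le> p" and \<psi>: "\<psi> \<in> Lp \<alpha> p"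
    and zero: "\<And>f. f \<in> schwartz_even \<Longrightarrow> (\<integral>x. \<psi> x * f x \<partial>mu \<alpha>) = 0"
  shows "AE x in mu \<alpha>. \<psi> x = 0"
proof -
  let ?e = "\<lambda>x::real^'n. complex_of_real (exp (- (norm x)\<^sup>2))"
  have e: "?e \<in> schwartz_even"
    using schwartz_even_exp_minus_box_exponent[of 0 0] by (simp add: box_exponent_def)
  have gaussian: "integrable (mu \<alpha>) (\<lambda>x. \<psi> x * ?e x)"
    by (rule integrable_Lp_schwartz_mult[OF p \<psi> e])
  have "set_lebesgue_integral (mu \<alpha>) (pos_orthant \<inter> {..b}) (\<lambda>x. \<psi> x * ?e x) = 0" for b :: "real^'n"
  proof (cases "\<forall>i. 0 < b $ i")
    case True
    then show ?thesis using set_integral_box_eq_0[OF p \<psi> _ zero gaussian] by blast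
  next
    case False
    then obtain i where "b $ i \<le> 0" by (auto simp: not_less)
    then have "pos_orthant \<inter> {..b} = {}"
      by (force simp: pos_orthant_def less_eq_vec_def dest: spec[of _ i])
    then show ?thesis by (simp add: set_lebesgue_integral_def)
  qed
  with zero[OF e] have "AE x in mu \<alpha>. \<psi> x * ?e x = 0"
    by (intro AE_mu_zero_of_box_integrals gaussian)
  then show ?thesis by eventually_elim simp
qed


lemma dist_of_fun_diff:
  assumes "1 \<le> p" and \<psi>: "\<psi> \<in> Lp \<alpha> p" and \<psi>': "\<psi>' \<in> Lp \<alpha> p"
  shows "dist_of_fun \<alpha> (\<lambda>x. \<psi> x - \<psi>' x) = dist_of_fun \<alpha> \<psi> - dist_of_fun \<alpha> \<psi>'"
  using integrable_Lp_schwartz_mult[OF assms(1) \<psi>] integrable_Lp_schwartz_mult[OF assms(1) \<psi>']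
  by (auto simp: dist_of_fun_def fun_eq_iff left_diff_distrib)

lemma dist_Lp_norm_dist_of_fun:
  assumes p: "1 \<le> p" and \<psi>: "\<psi> \<in> Lp \<alpha> p"
  shows "dist_Lp_norm \<alpha> p (dist_of_fun \<alpha> \<psi>) = Lp_norm \<alpha> p \<psi>"
proof -
  define \<psi>' where "\<psi>' = (SOME \<psi>'. \<psi>' \<in> Lp \<alpha> p \<and> dist_of_fun \<alpha> \<psi>' = dist_of_fun \<alpha> \<psi>)"
  have \<psi>': "\<psi>' \<in> Lp \<alpha> p" "dist_of_fun \<alpha> \<psi>' = dist_of_fun \<alpha> \<psi>"
    using someI[of "\<lambda>\<psi>'. \<psi>' \<in> Lp \<alpha> p \<and> dist_of_fun \<alpha> \<psi>' = dist_of_fun \<alpha> \<psi>" \<psi>] \<psi>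
    by (auto simp: \<psi>'_def)
  have "AE x in mu \<alpha>. \<psi>' x - \<psi> x = 0"
  proof (rule AE_zero_of_schwartz_pairing[OF p])
    show "(\<lambda>x. \<psi>' x - \<psi> x) \<in> Lp \<alpha> p" using p by (intro Lp_diff \<psi>'(1) \<psi>) simp
    fix f :: "real^'n \<Rightarrow> complex" assume "f \<in> schwartz_even"
    moreover have "dist_of_fun \<alpha> (\<lambda>x. \<psi>' x - \<psi> x) f = 0"
      unfolding dist_of_fun_diff[OF p \<psi>'(1) \<psi>] \<psi>'(2) by simp
    ultimately show "(\<integral>x. (\<psi>' x - \<psi> x) * f x \<partial>mu \<alpha>) = 0" by (simp add: dist_of_fun_def)
  qed
  then have "AE x in mu \<alpha>. norm (\<psi>' x) powr p = norm (\<psi> x) powr p" by eventually_elim simp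
  then have "(\<integral>x. norm (\<psi>' x) powr p \<partial>mu \<alpha>) = (\<integral>x. norm (\<psi> x) powr p \<partial>mu \<alpha>)"
    using LpD(2)[OF \<psi>] LpD(2)[OF \<psi>'(1)]
    by (intro integral_cong_AE) (auto intro: borel_measurable_integrable)
  then show ?thesis by (simp add: dist_Lp_norm_def \<psi>'_def[symmetric] Lp_norm_def)
qed

end

subsection \<open>Multipliers and the weighted transform\<close>

lemma mult_dist_mult_dist:
  assumes "h \<in> symbols K" "even_fun h"
  shows "mult_dist h (mult_dist g T) = mult_dist (\<lambda>x. g x * h x) T"
  using schwartz_even_mult_symbol[OF assms]
  by (auto simp: mult_dist_def dual_op_def fun_eq_iff mult.assoc)

lemma mult_dist_dist_of_fun:
  assumes "h \<in> symbols K" "even_fun h"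
  shows "mult_dist h (dist_of_fun \<alpha> \<psi>) = dist_of_fun \<alpha> (\<lambda>x. h x * \<psi> x)"
  using schwartz_even_mult_symbol[OF assms]
  by (auto simp: mult_dist_def dual_op_def dist_of_fun_def fun_eq_iff mult_ac)

lemma even_fun_bracket_powr: "even_fun (\<lambda>x. of_real (bracket x powr s))"
  by (rule even_fun_radial[of "\<lambda>r. of_real ((1 + r\<^sup>2) powr s)"])

lemma symbols_norm_power2_bracket_powr:
  "(\<lambda>x. complex_of_real ((norm x)\<^sup>2 * bracket x powr s)) \<in> symbols (1 + s)"
  unfolding of_real_mult by (intro symbols_mult symbols_norm_power2 symbols_bracket_powr)

lemma even_fun_norm_power2_bracket_powr:
  "even_fun (\<lambda>x. complex_of_real ((norm x)\<^sup>2 * bracket x powr s))"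
  by (rule even_fun_radial[of "\<lambda>r. of_real (r\<^sup>2 * (1 + r\<^sup>2) powr s)"])

lemma weighted_transform_shift:
  "weighted_transform \<alpha> s T =
    mult_dist (\<lambda>\<xi>. of_real (bracket \<xi> powr (s - t))) (weighted_transform \<alpha> t T)"
  unfolding weighted_transform_def
    mult_dist_mult_dist[OF symbols_bracket_powr even_fun_bracket_powr] of_real_mult[symmetric]
    powr_add[symmetric]
  by simp

lemma weighted_transform_diff:
  "weighted_transform \<alpha> s (T - S) = weighted_transform \<alpha> s T - weighted_transform \<alpha> s S"
  by (auto simp: weighted_transform_def mult_dist_def fourier_bessel_dist_def dual_op_def
      fun_eq_iff)

lemma tempered_even_diff: "T \<in> tempered_even \<Longrightarrow> S \<in> tempered_even \<Longrightarrow> T - S \<in> tempered_even"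
  unfolding tempered_even_def
  by (auto simp: algebra_simps fun_diff_def intro: continuous_map_diff)

lemma tempered_even_minus: "T \<in> tempered_even \<Longrightarrow> - T \<in> tempered_even"
  unfolding tempered_even_def by (auto simp: fun_Compl_def)

lemma tempered_even_uminus_apply:
  assumes "T \<in> tempered_even" "f \<in> schwartz_even"
  shows "T (\<lambda>x. - f x) = - T f"
proof -
  have "T (\<lambda>x. - 1 * f x) = - 1 * T f"
    using assms unfolding tempered_even_def by blast
  then show ?thesis by simp
qed

context poly_axial
begin

lemma fourier_bessel_dist_neg_laplace:
  assumes T: "T \<in> tempered_even"
  shows "fourier_bessel_dist \<alpha> (- laplace_dist \<alpha> T) =
    mult_dist (\<lambda>\<xi>. of_real ((norm \<xi>)\<^sup>2)) (fourier_bessel_dist \<alpha> T)"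
proof
  fix \<phi> :: "real^'n \<Rightarrow> complex"
  show "fourier_bessel_dist \<alpha> (- laplace_dist \<alpha> T) \<phi> =
      mult_dist (\<lambda>\<xi>. of_real ((norm \<xi>)\<^sup>2)) (fourier_bessel_dist \<alpha> T) \<phi>"
  proof (cases "\<phi> \<in> schwartz_even")
    case True
    note norm2 = schwartz_even_norm_power2_mult[OF True]
    show ?thesis
      using True norm2 schwartz_even_fourier_bessel[OF True] schwartz_even_fourier_bessel[OF norm2]
      by (simp add: fourier_bessel_dist_def mult_dist_def laplace_dist_def dual_op_def
          laplace_fourier_bessel tempered_even_uminus_apply[OF T] del: of_real_power)
  qed (simp add: fourier_bessel_dist_def mult_dist_def dual_op_def)
qed

lemma weighted_transform_neg_laplace:
  assumes T: "T \<in> tempered_even"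
  shows "weighted_transform \<alpha> (s - 1) (- laplace_dist \<alpha> T) =
    mult_dist (\<lambda>\<xi>. of_real ((norm \<xi>)\<^sup>2 * bracket \<xi> powr - 1)) (weighted_transform \<alpha> s T)"
proof -
  have "weighted_transform \<alpha> (s - 1) (- laplace_dist \<alpha> T) =
      mult_dist (\<lambda>\<xi>. of_real ((norm \<xi>)\<^sup>2) * of_real (bracket \<xi> powr (s - 1)))
        (fourier_bessel_dist \<alpha> T)"
    unfolding weighted_transform_def fourier_bessel_dist_neg_laplace[OF T]
    by (rule mult_dist_mult_dist[OF symbols_bracket_powr even_fun_bracket_powr])
  also have "(\<lambda>\<xi>::real^'n. of_real ((norm \<xi>)\<^sup>2) * of_real (bracket \<xi> powr (s - 1))) =
      (\<lambda>\<xi>. of_real (bracket \<xi> powr s) * complex_of_real ((norm \<xi>)\<^sup>2 * bracket \<xi> powr - 1))"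
    unfolding diff_conv_add_uminus powr_add of_real_mult by (simp only: mult_ac)
  also have "mult_dist \<dots> (fourier_bessel_dist \<alpha> T) =
      mult_dist (\<lambda>\<xi>. of_real ((norm \<xi>)\<^sup>2 * bracket \<xi> powr - 1)) (weighted_transform \<alpha> s T)"
    unfolding weighted_transform_def
    by (rule mult_dist_mult_dist[OF symbols_norm_power2_bracket_powr
          even_fun_norm_power2_bracket_powr, symmetric])
  finally show ?thesis .
qed

subsection \<open>The spaces E\<close>

lemma c_const_nonneg: "0 \<le> c_const \<alpha>"
proof -
  have "0 < Gamma (\<alpha> $ i + 1)" for i
    using order_gt_minus_1[of i] by (intro Gamma_real_pos) simp
  then show ?thesis
    unfolding c_const_def by (intro divide_nonneg_nonneg prod_nonneg) (auto intro: less_imp_le)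
qed

lemma E_norm_nonneg: "0 \<le> E_norm \<alpha> s p T"
  unfolding E_norm_def dist_Lp_norm_def Lp_norm_def by (simp add: c_const_nonneg)

lemma E_spaceE:
  assumes "T \<in> E_space \<alpha> s p"
  obtains \<psi> where "\<psi> \<in> Lp \<alpha> p" "weighted_transform \<alpha> s T = dist_of_fun \<alpha> \<psi>"
  using assms unfolding E_space_def dist_in_Lp_def by auto

lemma E_space_diff:
  assumes p: "1 \<le> p" and T: "T \<in> E_space \<alpha> s p" and S: "S \<in> E_space \<alpha> s p"
  shows "T - S \<in> E_space \<alpha> s p"
proof -
  obtain \<psi> where \<psi>: "\<psi> \<in> Lp \<alpha> p" "weighted_transform \<alpha> s T = dist_of_fun \<alpha> \<psi>"
    by (rule E_spaceE[OF T])
  obtain \<psi>' where \<psi>': "\<psi>' \<in> Lp \<alpha> p" "weighted_transform \<alpha> s S = dist_of_fun \<alpha> \<psi>'"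
    by (rule E_spaceE[OF S])
  have "(\<lambda>x. \<psi> x - \<psi>' x) \<in> Lp \<alpha> p" using p by (intro Lp_diff \<psi>(1) \<psi>'(1)) simp
  moreover have "dist_of_fun \<alpha> (\<lambda>x. \<psi> x - \<psi>' x) = weighted_transform \<alpha> s (T - S)"
    by (simp add: weighted_transform_diff \<psi>(2) \<psi>'(2) dist_of_fun_diff[OF p \<psi>(1) \<psi>'(1)])
  ultimately show ?thesis
    using T S by (auto simp: E_space_def dist_in_Lp_def intro: tempered_even_diff)
qed

lemma E_space_multiplier:
  assumes p: "1 \<le> p" and T: "T \<in> E_space \<alpha> t p" and T': "T' \<in> tempered_even"
    and h: "(\<lambda>x. complex_of_real (h x)) \<in> symbols K" "even_fun (\<lambda>x. complex_of_real (h x))"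
    and h01: "\<And>x. 0 \<le> h x" "\<And>x. h x \<le> 1"
    and mult: "weighted_transform \<alpha> s T' = mult_dist (\<lambda>x. of_real (h x)) (weighted_transform \<alpha> t T)"
  shows "T' \<in> E_space \<alpha> s p" "E_norm \<alpha> s p T' \<le> E_norm \<alpha> t p T"
proof -
  obtain \<psi> where \<psi>: "\<psi> \<in> Lp \<alpha> p" "weighted_transform \<alpha> t T = dist_of_fun \<alpha> \<psi>"
    by (rule E_spaceE[OF T])
  define \<phi> where "\<phi> x = of_real (h x) * \<psi> x" for x
  have \<phi>_meas: "\<phi> \<in> borel_measurable (mu \<alpha>)"
    unfolding \<phi>_def
    using borel_measurable_mu[OF smooth_fun_borel_measurable[OF symbols_smooth[OF h(1)]]]
      LpD(1)[OF \<psi>(1)]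
    by (rule borel_measurable_times)
  have \<phi>_le: "norm (\<phi> x) \<le> norm (\<psi> x)" for x
    using h01[of x] by (simp add: \<phi>_def norm_mult mult_left_le_one_le)
  have "0 \<le> p" using p by simp
  note \<phi> = Lp_dominated[OF \<psi>(1) \<phi>_meas \<phi>_le this]
  have transform: "weighted_transform \<alpha> s T' = dist_of_fun \<alpha> \<phi>"
    unfolding mult \<psi>(2) \<phi>_def by (rule mult_dist_dist_of_fun[OF h])
  show "T' \<in> E_space \<alpha> s p"
    using T' \<phi>(1) transform by (auto simp: E_space_def dist_in_Lp_def)
  show "E_norm \<alpha> s p T' \<le> E_norm \<alpha> t p T"
    unfolding E_norm_def transform \<psi>(2) dist_Lp_norm_dist_of_fun[OF p \<phi>(1)]
      dist_Lp_norm_dist_of_fun[OF p \<psi>(1)]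
    by (rule mult_left_mono[OF \<phi>(2) c_const_nonneg])
qed

lemma E_space_embedding:
  assumes "1 \<le> p" "s \<le> t" "T \<in> E_space \<alpha> t p"
  shows "T \<in> E_space \<alpha> s p" "E_norm \<alpha> s p T \<le> E_norm \<alpha> t p T"
proof -
  have "bracket x powr (s - t) \<le> 1" for x :: "real^'n"
    using powr_mono[of "s - t" 0 "bracket x"] assms(2) by simp
  moreover have "T \<in> tempered_even" using assms(3) by (simp add: E_space_def)
  ultimately show "T \<in> E_space \<alpha> s p" "E_norm \<alpha> s p T \<le> E_norm \<alpha> t p T"
    using assms(1,3)
    by (auto intro!: E_space_multiplier[of p T t T "\<lambda>\<xi>. bracket \<xi> powr (s - t)" "s - t" s]
        symbols_bracket_powr even_fun_bracket_powr weighted_transform_shift)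
qed

lemma E_space_neg_laplace:
  assumes "1 \<le> p" "T \<in> E_space \<alpha> s p"
  shows "- laplace_dist \<alpha> T \<in> E_space \<alpha> (s - 1) p"
    "E_norm \<alpha> (s - 1) p (- laplace_dist \<alpha> T) \<le> E_norm \<alpha> s p T"
proof -
  have T: "T \<in> tempered_even" using assms(2) by (simp add: E_space_def)
  have le_1: "(norm x)\<^sup>2 * bracket x powr - 1 \<le> 1" for x :: "real^'n"
    by (simp add: powr_minus_divide divide_le_eq)
  note multiplier = E_space_multiplier[OF assms
      tempered_even_minus[OF tempered_even_laplace_dist[OF T]]
      symbols_norm_power2_bracket_powr even_fun_norm_power2_bracket_powr _ le_1
      weighted_transform_neg_laplace[OF T]]
  show "- laplace_dist \<alpha> T \<in> E_space \<alpha> (s - 1) p"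
    "E_norm \<alpha> (s - 1) p (- laplace_dist \<alpha> T) \<le> E_norm \<alpha> s p T"
    by (rule multiplier; simp)+
qed

lemma neg_laplace_pow_0: "neg_laplace_pow \<alpha> 0 T = T"
  by (simp add: neg_laplace_pow_def)

lemma neg_laplace_pow_Suc: "neg_laplace_pow \<alpha> (Suc k) T = - laplace_dist \<alpha> (neg_laplace_pow \<alpha> k T)"
  by (simp add: neg_laplace_pow_def)

lemma neg_laplace_pow_diff:
  "neg_laplace_pow \<alpha> k (T - S) = neg_laplace_pow \<alpha> k T - neg_laplace_pow \<alpha> k S"
proof (induction k)
  case 0
  show ?case by (simp add: neg_laplace_pow_0)
next
  case (Suc k)
  have laplace_dist_diff: "laplace_dist \<alpha> (T - S) = laplace_dist \<alpha> T - laplace_dist \<alpha> S" for T S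
    by (auto simp: laplace_dist_def dual_op_def fun_eq_iff)
  show ?case
    unfolding neg_laplace_pow_Suc Suc laplace_dist_diff by (simp add: fun_eq_iff)
qed

lemma E_space_neg_laplace_pow:
  assumes p: "1 \<le> p" and T: "T \<in> E_space \<alpha> s p"
  shows "neg_laplace_pow \<alpha> k T \<in> E_space \<alpha> (s - real k) p \<and>
    E_norm \<alpha> (s - real k) p (neg_laplace_pow \<alpha> k T) \<le> E_norm \<alpha> s p T"
proof (induction k)
  case 0
  show ?case using T by (simp add: neg_laplace_pow_0)
next
  case (Suc k)
  have "s - real (Suc k) = s - real k - 1" by simp
  then show ?case
    unfolding neg_laplace_pow_Suc
    using E_space_neg_laplace[OF p, of "neg_laplace_pow \<alpha> k T" "s - real k"] Suc
    by (simp only:) (blast intro: order_trans)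
qed

lemma continuous_map_E_topology:
  assumes p: "1 \<le> p"
    and maps: "\<And>T. T \<in> E_space \<alpha> s p \<Longrightarrow> A T \<in> E_space \<alpha> t p"
    and diff: "\<And>T S. A (T - S) = A T - A S"
    and norm_le: "\<And>T. T \<in> E_space \<alpha> s p \<Longrightarrow> E_norm \<alpha> t p (A T) \<le> E_norm \<alpha> s p T"
  shows "continuous_map (E_topology \<alpha> s p) (E_topology \<alpha> t p) A"
  unfolding E_topology_def
proof (rule continuous_map_seminorm_topology)
  fix q assume "q \<in> {E_norm \<alpha> t p}"
  have "seminorm_dominated (E_space \<alpha> s p) {E_norm \<alpha> s p} (\<lambda>T (_::unit). E_norm \<alpha> s p T)"
    by (rule seminorm_dominated_seminorm) simp
  then have "seminorm_dominated (E_space \<alpha> s p) {E_norm \<alpha> s p} (\<lambda>T (_::unit). E_norm \<alpha> t p (A T))"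
    by (rule seminorm_dominated_mono) (rule norm_le)
  with \<open>q \<in> {E_norm \<alpha> t p}\<close>
  show "seminorm_dominated (E_space \<alpha> s p) {E_norm \<alpha> s p} (\<lambda>T (_::unit). q (A T))" by simp
qed (use maps diff E_space_diff[OF p] E_norm_nonneg in auto)

end

theorem proposition15:
  fixes \<alpha> :: "real^'n::finite"
  assumes "\<forall>i. \<alpha> $ i > - 1 / 2"
  shows
    "(\<forall>p s t. 1 \<le> p \<and> s \<le> t \<longrightarrow>
        E_space \<alpha> t p \<subseteq> E_space \<alpha> s p \<and>
        (\<forall>T\<in>E_space \<alpha> t p. E_norm \<alpha> s p T \<le> E_norm \<alpha> t p T) \<and>
        continuous_map (E_topology \<alpha> t p) (E_topology \<alpha> s p) (\<lambda>T. T)) \<and>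
     (\<forall>s p. 1 \<le> p \<longrightarrow> (\<forall>k::nat.
        neg_laplace_pow \<alpha> k ` E_space \<alpha> s p \<subseteq> E_space \<alpha> (s - real k) p \<and>
        continuous_map (E_topology \<alpha> s p) (E_topology \<alpha> (s - real k) p) (neg_laplace_pow \<alpha> k) \<and>
        (\<forall>T\<in>E_space \<alpha> s p.
           E_norm \<alpha> (s - real k) p (neg_laplace_pow \<alpha> k T) \<le> E_norm \<alpha> s p T)))"
proof -
  interpret poly_axial \<alpha>
    using assms by unfold_locales simp
  show ?thesis
  proof (intro conjI allI impI)
    fix p s t :: real assume "1 \<le> p \<and> s \<le> t"
    then have p: "1 \<le> p" and "s \<le> t" by auto
    note embedding = E_space_embedding[OF this]
    show "E_space \<alpha> t p \<subseteq> E_space \<alpha> s p"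
      and "\<forall>T\<in>E_space \<alpha> t p. E_norm \<alpha> s p T \<le> E_norm \<alpha> t p T"
      using embedding by blast+
    show "continuous_map (E_topology \<alpha> t p) (E_topology \<alpha> s p) (\<lambda>T. T)"
      using embedding by (intro continuous_map_E_topology p) auto
  next
    fix s p :: real and k :: nat assume p: "1 \<le> p"
    note laplace_pow = E_space_neg_laplace_pow[OF p]
    show "neg_laplace_pow \<alpha> k ` E_space \<alpha> s p \<subseteq> E_space \<alpha> (s - real k) p"
      and "\<forall>T\<in>E_space \<alpha> s p. E_norm \<alpha> (s - real k) p (neg_laplace_pow \<alpha> k T) \<le> E_norm \<alpha> s p T"
      using laplace_pow by blast+
    show "continuous_map (E_topology \<alpha> s p) (E_topology \<alpha> (s - real k) p) (neg_laplace_pow \<alpha> k)"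
      using laplace_pow by (intro continuous_map_E_topology p neg_laplace_pow_diff) auto
  qed
qed

end
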